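(* There is a universal constant $c>0$ such that for all positive integers $n,t$, with $d=2^n$, the $d$-dimensional $PFC$ ensemble is a diamond $\epsilon$-approximate $t$-design with $\epsilon = c\,t/\sqrt{d}$. That is, $$\left\|\mathcal{M}^{(t)}_{PFC}-\mathcal{M}^{(t)}_{\mathrm{Haar}}\right\|_\Diamond\le c\,\frac{t}{\sqrt d}.$$
   Context: $PFC$ ensemble: identify $[d]$ with $\{0,1\}^n$. It is the distribution of the random unitary $P F C$ on $\mathbb{C}^d$, where $P,F,C$ are sampled independently: $P=P_\pi:|x\rangle\mapsto|\pi(x)\rangle$ for a uniformly random permutation $\pi\in S_d$; $F=F_f:|x\rangle\mapsto(-1)^{f(x)}|x\rangle$ for a uniformly random function $f:[d]\to\{0,1\}$; $C$ is a uniformly random $n$-qubit Clifford unitary. $t$-wise twirl: for a distribution $\nu$ on the unitary group $\mathrm{U}(d)$, $\mathcal{M}^{(t)}_\nu(X)=\mathbb{E}_{R\sim\nu}R^{\otimes t}X (R^{\otimes t})^\dagger$ for linear operators $X$ on $(\mathbb{C}^d)^{\otimes t}$; $\mathcal{M}^{(t)}_{\mathrm{Haar}}$ is the case where $\nu$ is the Haar probability measure on $\mathrm{U}(d)$. Diamond distance: for channels $\mathcal M,\mathcal N$ on operators on $\mathcal H$, $\|\mathcal M-\mathcal N\|_\Diamond=\max_{|\psi\rangle\in\mathcal H\otimes\mathcal H}\|(\mathcal M\otimes\mathrm{id})(|\psi\rangle\langle\psi|)-(\mathcal N\otimes\mathrm{id})(|\psi\rangle\langle\psi|)\|_1$, the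 maximum being over unit vectors and $\|\cdot\|_1$ being the trace norm (no factor $1/2$). Diamond $\epsilon$-approximate $t$-design: $\|\mathcal M^{(t)}_\nu-\mathcal M^{(t)}_{\mathrm{Haar}}\|_\Diamond\le\epsilon$. *)

theory Defs
  imports
    "HOL-Probability.Probability"
    "Jordan_Normal_Form.Schur_Decomposition"
begin

text \<open>Operators on \<open>\<complex>\<^sup>d\<close> are matrices of dimension \<open>d\<close>. Tensor products are Kronecker
  products with the left factor in the high-order digits, so that for \<open>d = 2 ^ n\<close> a basis index
  \<open>i < d\<close> is identified with its binary expansion, most significant bit first.\<close>

definition kron :: "complex mat \<Rightarrow> complex mat \<Rightarrow> complex mat" where
  "kron A B = mat (dim_row A * dim_row B) (dim_col A * dim_col B)
     (\<lambda>(i, j). A $$ (i div dim_row B, j div dim_col B) * B $$ (i mod dim_row B, j mod dim_col B))"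

definition kron_list :: "complex mat list \<Rightarrow> complex mat" where
  "kron_list As = foldr kron As (1\<^sub>m 1)"

definition tensor_pow :: "nat \<Rightarrow> complex mat \<Rightarrow> complex mat" where
  "tensor_pow t A = kron_list (replicate t A)"

definition unitary_group :: "nat \<Rightarrow> complex mat set" where
  "unitary_group d = {U \<in> carrier_mat d d. U * mat_adjoint U = 1\<^sub>m d \<and> mat_adjoint U * U = 1\<^sub>m d}"


subsection \<open>Haar measure\<close>

text \<open>The Borel \<open>\<sigma>\<close>-algebra of \<open>U(d)\<close> as a subspace of \<open>\<complex>\<^bsup>d \<times> d\<^esup>\<close>: the one generated by
  the matrix entries.\<close>

definition unitary_borel :: "nat \<Rightarrow> complex mat measure" where
  "unitary_borel d = vimage_algebra (unitary_group d)
     (\<lambda>U. \<lambda>p\<in>{..<d} \<times> {..<d}. U $$ p) (\<Pi>\<^sub>M p\<in>{..<d} \<times> {..<d}. borel)"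

definition haar_prob_measure :: "nat \<Rightarrow> complex mat measure \<Rightarrow> bool" where
  "haar_prob_measure d \<mu> \<longleftrightarrow>
     prob_space \<mu> \<and> sets \<mu> = sets (unitary_borel d) \<and>
     (\<forall>V \<in> unitary_group d. distr \<mu> \<mu> (\<lambda>U. V * U) = \<mu> \<and> distr \<mu> \<mu> (\<lambda>U. U * V) = \<mu>)"


subsection \<open>Pauli and Clifford groups\<close>

definition pauli_X :: "complex mat" where
  "pauli_X = mat_of_rows_list 2 [[0, 1], [1, 0]]"

definition pauli_Y :: "complex mat" where
  "pauli_Y = mat_of_rows_list 2 [[0, - \<i>], [\<i>, 0]]"

definition pauli_Z :: "complex mat" where
  "pauli_Z = mat_of_rows_list 2 [[1, 0], [0, - 1]]"

definition pauli_group :: "nat \<Rightarrow> complex mat set" where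
  "pauli_group n = {\<i> ^ k \<cdot>\<^sub>m kron_list Ps | k Ps.
     length Ps = n \<and> set Ps \<subseteq> {1\<^sub>m 2, pauli_X, pauli_Y, pauli_Z}}"

definition clifford_group :: "nat \<Rightarrow> complex mat set" where
  "clifford_group n = {U \<in> unitary_group (2 ^ n).
     \<forall>P \<in> pauli_group n. U * P * mat_adjoint U \<in> pauli_group n}"

definition phase_rel :: "nat \<Rightarrow> (complex mat \<times> complex mat) set" where
  "phase_rel n = {(U, V). U \<in> clifford_group n \<and> V \<in> clifford_group n \<and>
     (\<exists>z. cmod z = 1 \<and> V = z \<cdot>\<^sub>m U)}"

text \<open>The normaliser \<^term>\<open>clifford_group n\<close> contains all global phases and is therefore infinite;
  as usual, "uniformly random Clifford" refers to its finite quotient by phases. A class is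
  sampled uniformly and then replaced by some unitary in it. Global phases cancel in
  \<open>R\<^bsup>\<otimes>t\<^esup> X (R\<^bsup>\<otimes>t\<^esup>)\<^sup>\<dagger>\<close>, so twirls do not depend on this choice.\<close>

definition random_clifford :: "nat \<Rightarrow> complex mat pmf" where
  "random_clifford n = map_pmf (\<lambda>Q. SOME U. U \<in> Q) (pmf_of_set (clifford_group n // phase_rel n))"


subsection \<open>The PFC ensemble\<close>

definition perm_op :: "nat \<Rightarrow> (nat \<Rightarrow> nat) \<Rightarrow> complex mat" where
  "perm_op d \<pi> = mat d d (\<lambda>(i, j). if i = \<pi> j then 1 else 0)"

definition sign_op :: "nat \<Rightarrow> (nat \<Rightarrow> nat) \<Rightarrow> complex mat" where
  "sign_op d f = mat d d (\<lambda>(i, j). if i = j then (- 1) ^ f i else 0)"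

definition pfc_ensemble :: "nat \<Rightarrow> complex mat pmf" where
  "pfc_ensemble n = do {
     \<pi> \<leftarrow> pmf_of_set {\<pi>. \<pi> permutes {..<2 ^ n}};
     f \<leftarrow> pmf_of_set ({..<2 ^ n} \<rightarrow>\<^sub>E {0, 1});
     C \<leftarrow> random_clifford n;
     return_pmf (perm_op (2 ^ n) \<pi> * sign_op (2 ^ n) f * C)
   }"


subsection \<open>Twirls and the diamond distance\<close>

text \<open>The expectation of a random matrix is taken entrywise.\<close>

definition twirl :: "nat \<Rightarrow> nat \<Rightarrow> complex mat measure \<Rightarrow> complex mat \<Rightarrow> complex mat" where
  "twirl d t \<nu> X = mat (d ^ t) (d ^ t)
     (\<lambda>p. \<integral>R. (tensor_pow t R * X * mat_adjoint (tensor_pow t R)) $$ p \<partial>\<nu>)"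

text \<open>The sum of the singular values, i.e. of the square roots of the eigenvalues of
  \<open>A\<^sup>\<dagger> A\<close> (which are real and nonnegative), counted with multiplicity.\<close>

definition trace_norm :: "complex mat \<Rightarrow> real" where
  "trace_norm A = (\<Sum>x\<in>#proots (char_poly (mat_adjoint A * A)). sqrt (Re x))"

text \<open>\<open>M \<otimes> id\<close> for a linear map \<open>M\<close> on operators on \<open>\<complex>\<^sup>D\<close>: \<open>M\<close> is applied to each block
  \<open>(I \<otimes> \<langle>a|) \<rho> (I \<otimes> |b\<rangle>)\<close> of the operator \<open>\<rho>\<close> on \<open>\<complex>\<^sup>D \<otimes> \<complex>\<^sup>D\<close>, where \<open>a = r mod D\<close>
  and \<open>b = s mod D\<close>.\<close>

definition tensor_id :: "nat \<Rightarrow> (complex mat \<Rightarrow> complex mat) \<Rightarrow> complex mat \<Rightarrow> complex mat" where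
  "tensor_id D M \<rho> = mat (D * D) (D * D)
     (\<lambda>(r, s). M (mat D D (\<lambda>(i, j). \<rho> $$ (i * D + r mod D, j * D + s mod D))) $$ (r div D, s div D))"

definition ket_bra :: "complex vec \<Rightarrow> complex mat" where
  "ket_bra \<psi> = mat (dim_vec \<psi>) (dim_vec \<psi>) (\<lambda>(i, j). vec_index \<psi> i * cnj (vec_index \<psi> j))"

definition diamond_dist ::
  "nat \<Rightarrow> (complex mat \<Rightarrow> complex mat) \<Rightarrow> (complex mat \<Rightarrow> complex mat) \<Rightarrow> real" where
  "diamond_dist D M N = (SUP \<psi>\<in>{\<psi> \<in> carrier_vec (D * D). \<psi> \<bullet>c \<psi> = 1}.
     trace_norm (tensor_id D M (ket_bra \<psi>) - tensor_id D N (ket_bra \<psi>)))"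

end

(* For an ensemble nu and a pure input psi, the output of the twirl has the quadratic form
   <u, E u> = E_R |<u, R psi>|^2 (R acting on the first of the two tensor factors), and the trace
   norm of the difference of two outputs is the sum of the moduli of its quadratic form over an
   orthonormal eigenbasis. In both ensembles R may be replaced by R C with a random Clifford C:
   for P F C by definition, for Haar by invariance. Since the Clifford group is a 2-design, C psi has
   only mass O(t^2/d) on the tuples x in [d]^t with a repeated entry, so up to an error O(t/sqrt d)
   it may be replaced by its part on injective tuples. For such a state the second moment over P
   and F is a sum of |h(z)|^2 over injective tuples z. The Haar moment is, by invariance under
   P F, an average of the same expression over rotated h, and by the Clifford collision bound it lies
   between (1 - O(t^2/d)) S and S, where S is the sum over all tuples z. Both moments lie below S
   and have the same sum over an orthonormal basis, so the total difference is O(t^2/d). *)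

theory Submission
  imports Defs
begin

subsection \<open>Adjoints, unitaries and the spectral theorem\<close>

text \<open>No Weingarten calculus enters: the Haar measure is used only through right invariance,
  under Clifford unitaries, their transposes and the operators P F. The obstacle is that the P F
  moment of a fixed vector u has no lower bound in terms of S, since its sum over injective z may
  miss most of S. The one-sided bound suffices because S is comparable, vector by vector, with the
  Haar moment, whose sum over a basis is known exactly. The rate comes solely from the cross terms
  between injective and colliding amplitudes: with r = t / sqrt d the colliding mass is of order r^2
  and the cross terms are of order r, while everything else is of order r^2. The 2-design property
  is needed only for the event that two registers show the same basis state. The projection onto
  this event is the average of Q \<otimes> Q over the diagonal Pauli strings Q, so it suffices to
  know the second moments of conjugated strings. These agree for all strings but the identity,
  because the Clifford unitary (A + B) / sqrt 2 exchanges anticommuting strings A and B.\<close>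

lemma mat_adjoint_dim [simp]:
  "dim_row (mat_adjoint A) = dim_col A" "dim_col (mat_adjoint A) = dim_row A"
  by (auto simp: mat_adjoint_def)

lemma mat_adjoint_carrier [simp, intro]: "A \<in> carrier_mat m n \<Longrightarrow> mat_adjoint A \<in> carrier_mat n m"
  by (metis carrier_matD carrier_matI mat_adjoint_dim)

lemma mat_adjoint_index [simp]:
  fixes A :: "complex mat"
  shows "i < dim_col A \<Longrightarrow> j < dim_row A \<Longrightarrow> mat_adjoint A $$ (i, j) = cnj (A $$ (j, i))"
  by (simp add: mat_adjoint_def mat_of_rows_def)

lemma mat_adjoint_adjoint [simp]: "mat_adjoint (mat_adjoint A) = (A :: complex mat)"
  by (rule eq_matI) auto

lemma index_mult_mat_sum:
  "A \<in> carrier_mat m n \<Longrightarrow> B \<in> carrier_mat n p \<Longrightarrow> i < m \<Longrightarrow> j < p \<Longrightarrow>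
    (A * B) $$ (i, j) = (\<Sum>k<n. A $$ (i, k) * B $$ (k, j))"
  by (auto simp: scalar_prod_def lessThan_atLeast0 intro!: sum.cong)

lemma mat_adjoint_mult:
  fixes A :: "complex mat"
  assumes "A \<in> carrier_mat m n" "B \<in> carrier_mat n p"
  shows "mat_adjoint (A * B) = mat_adjoint B * mat_adjoint A"
  using assms
  by (intro eq_matI)
    (auto simp: index_mult_mat_sum[OF assms] index_mult_mat_sum[of _ p n _ m] mult.commute
      simp del: index_mult_mat(1))

lemma mat_adjoint_smult: "mat_adjoint (c \<cdot>\<^sub>m A) = cnj c \<cdot>\<^sub>m mat_adjoint (A :: complex mat)"
  by (rule eq_matI) auto

lemma mat_adjoint_one [simp]: "mat_adjoint (1\<^sub>m n) = (1\<^sub>m n :: complex mat)"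
  by (rule eq_matI) auto

lemma unitary_groupD:
  assumes "U \<in> unitary_group d"
  shows "U \<in> carrier_mat d d" "U * mat_adjoint U = 1\<^sub>m d" "mat_adjoint U * U = 1\<^sub>m d"
  using assms by (auto simp: unitary_group_def)

lemma unitary_groupI:
  assumes "U \<in> carrier_mat d d" "mat_adjoint U * U = 1\<^sub>m d"
  shows "U \<in> unitary_group d"
  using assms mat_mult_left_right_inverse[of "mat_adjoint U" d U]
  by (auto simp: unitary_group_def)

lemma unitary_group_mult:
  assumes U: "U \<in> unitary_group d" and V: "V \<in> unitary_group d"
  shows "U * V \<in> unitary_group d"
proof (rule unitary_groupI)
  note u = unitary_groupD[OF U] and v = unitary_groupD[OF V]
  show "U * V \<in> carrier_mat d d" using u v by auto
  have "mat_adjoint (U * V) * (U * V) = mat_adjoint V * (mat_adjoint U * (U * V))"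
    using u v by (simp add: mat_adjoint_mult[of _ d d _ d] assoc_mult_mat[of _ d d _ d _ d])
  also have "mat_adjoint U * (U * V) = V"
    using u v by (simp add: assoc_mult_mat[of _ d d _ d _ d, symmetric])
  finally show "mat_adjoint (U * V) * (U * V) = 1\<^sub>m d" using v by simp
qed

lemma unitary_group_adjoint: "U \<in> unitary_group d \<Longrightarrow> mat_adjoint U \<in> unitary_group d"
  by (auto simp: unitary_group_def)

text \<open>Transposition exchanges the two index slots of a tensor kernel; the Clifford collision
  bound acts on the first slot but is also needed for the second.\<close>

lemma unitary_group_transpose:
  assumes "U \<in> unitary_group d"
  shows "transpose_mat U \<in> unitary_group d"
proof (rule unitary_groupI)
  note u = unitary_groupD[OF assms]
  show c: "transpose_mat U \<in> carrier_mat d d" using u by auto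
  have "(mat_adjoint (transpose_mat U) * transpose_mat U) $$ (i, j) = (U * mat_adjoint U) $$ (j, i)"
    if "i < d" "j < d" for i j
    using u(1) that c
    by (simp add: index_mult_mat_sum[of _ d d _ d] mult.commute del: index_mult_mat(1))
  then show "mat_adjoint (transpose_mat U) * transpose_mat U = 1\<^sub>m d"
    using u by (intro eq_matI) auto
qed

lemma unitary_col_orthonormal:
  assumes "U \<in> unitary_group d" "i < d" "j < d"
  shows "(\<Sum>k<d. cnj (U $$ (k, i)) * U $$ (k, j)) = (if i = j then 1 else 0)"
  using unitary_groupD[OF assms(1)] assms(2,3)
    index_mult_mat_sum[of "mat_adjoint U" d d U d i j] by auto

lemma unitary_row_orthonormal:
  assumes "U \<in> unitary_group d" "i < d" "j < d"
  shows "(\<Sum>k<d. U $$ (i, k) * cnj (U $$ (j, k))) = (if i = j then 1 else 0)"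
  using unitary_groupD[OF assms(1)] assms(2,3)
    index_mult_mat_sum[of U d d "mat_adjoint U" d i j] by auto

text \<open>The Householder reflection exchanging \<open>v\<close> with the first basis vector; a real nonpositive
  first entry keeps the denominator \<open>1 - v\<^sub>0\<close> away from zero.\<close>

lemma unitary_with_first_column:
  fixes v :: "nat \<Rightarrow> complex"
  assumes v: "(\<Sum>k<Suc n. cnj (v k) * v k) = 1" and v0: "v 0 = of_real r" "r \<le> 0"
  obtains W where "W \<in> unitary_group (Suc n)" "\<And>i. i < Suc n \<Longrightarrow> W $$ (i, 0) = v i"
proof -
  define w where "w i = (if i = 0 then 1 else 0) - v i" for i
  define W where "W = mat (Suc n) (Suc n) (\<lambda>(i, j). (if i = j then 1 else 0) - w i * cnj (w j) / (1 - v 0))"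
  have nz: "1 - v 0 \<noteq> 0" using v0 by (metis diff_eq_eq add_0 of_real_eq_1_iff not_one_le_zero)
  \<comment> \<open>As \<open>v 0\<close> is real, the squared norm of \<open>w\<close> is twice the
    denominator in \<open>W\<close>, so \<open>W\<close> is the reflection that negates
    \<open>w\<close>.\<close>
  have wn: "(\<Sum>k<Suc n. cnj (w k) * w k) = 2 * (1 - v 0)"
  proof -
    have "cnj (w k) * w k = (if k = 0 then 1 - cnj (v 0) - v 0 else 0) + cnj (v k) * v k" for k
      by (auto simp: w_def algebra_simps)
    then have "(\<Sum>k<Suc n. cnj (w k) * w k) = (1 - cnj (v 0) - v 0) + 1"
      by (simp add: sum.distrib v sum.delta del: sum.lessThan_Suc)
    then show ?thesis using v0 by simp
  qed
  have "(mat_adjoint W * W) $$ (i, j) = (1\<^sub>m (Suc n) :: complex mat) $$ (i, j)"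
    if ij: "i < Suc n" "j < Suc n" for i j
  proof -
    let ?c = "1 - v 0"
    have cc: "cnj ?c = ?c" using v0 by simp
    have "(mat_adjoint W * W) $$ (i, j) = (\<Sum>k<Suc n. cnj (W $$ (k, i)) * W $$ (k, j))"
      using ij by (subst index_mult_mat_sum[of _ "Suc n" "Suc n" _ "Suc n"]) (auto simp: W_def)
    also have "\<dots> = (\<Sum>k<Suc n. ((if k = i then (if i = j then 1 else 0) - w i * cnj (w j) / ?c else 0)
        - (if k = j then w i * cnj (w j) / ?c else 0)) + w i * cnj (w j) / (?c * ?c) * (cnj (w k) * w k))"
    proof (rule sum.cong[OF refl], goal_cases)
      case (1 k)
      then show ?case using ij cc by (auto simp: W_def algebra_simps)
    qed
    also have "\<dots> = (if i = j then 1 else 0) - w i * cnj (w j) / ?c - w i * cnj (w j) / ?c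
        + w i * cnj (w j) / (?c * ?c) * (2 * ?c)"
      using ij by (simp only: sum.distrib sum_subtractf sum_distrib_left[symmetric] wn) (simp add: sum.delta)
    also have "\<dots> = (if i = j then 1 else 0)"
      using nz by (simp add: divide_simps) (simp add: algebra_simps)
    finally show ?thesis using ij by simp
  qed
  then have "W \<in> unitary_group (Suc n)" by (intro unitary_groupI eq_matI) (auto simp: W_def)
  moreover have "W $$ (i, 0) = v i" if "i < Suc n" for i
    using that nz v0 by (auto simp: W_def w_def field_simps)
  ultimately show ?thesis using that by blast
qed

text \<open>Induction by deflation: a unit eigenvector is completed to a unitary \<open>W\<close>.
  The conjugate \<open>B\<close> of \<open>A\<close> by \<open>W\<close> is again Hermitian, so off
  the corner its first row vanishes together with its first column, and the lower block is Hermitian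
  of smaller size.\<close>

theorem hermitian_spectral:
  fixes A :: "complex mat"
  assumes "A \<in> carrier_mat n n" "mat_adjoint A = A"
  shows "\<exists>P l. P \<in> unitary_group n \<and> A * P = P * mat n n (\<lambda>(i, j). if i = j then of_real (l i) else 0)"
  using assms
proof (induction n arbitrary: A)
  case 0
  then show ?case by (intro exI[of _ "1\<^sub>m 0"]) (auto simp: unitary_group_def intro!: exI eq_matI)
next
  case (Suc n)
  let ?n = "Suc n"
  note A = Suc.prems
  obtain e where "eigenvalue A e"
  proof -
    have "degree (char_poly A) = ?n" using degree_monic_char_poly[OF A(1)] by simp
    then have "\<not> constant (poly (char_poly A))" by (simp add: constant_degree)
    from fundamental_theorem_of_algebra[OF this] eigenvalue_root_char_poly[OF A(1)]
    show ?thesis using that by blast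
  qed
  then obtain x where x: "x \<in> carrier_vec ?n" "x \<noteq> 0\<^sub>v ?n" "A *\<^sub>v x = e \<cdot>\<^sub>v x"
    using A(1) by (auto simp: eigenvalue_def eigenvector_def)
  define N where "N = (\<Sum>k<?n. (cmod (x $ k))\<^sup>2)"
  obtain k0 where k0: "k0 < ?n" "x $ k0 \<noteq> 0" using x by (metis carrier_vecD eq_vecI index_zero_vec)
  have N: "N > 0" unfolding N_def
    by (rule sum_pos2[of _ k0]) (use k0 in auto)
  \<comment> \<open>This phase makes the first entry of the eigenvector a nonpositive real, as the
    reflection requires.\<close>
  define ph where "ph = (if x $ 0 = 0 then 1 else - cnj (sgn (x $ 0)))"
  have ph: "cmod ph = 1" by (auto simp: ph_def norm_sgn)
  have ph0: "ph * x $ 0 = of_real (- cmod (x $ 0))"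
  proof (cases "x $ 0 = 0")
    case False
    have "cnj (x $ 0) * x $ 0 = of_real (cmod (x $ 0)) * of_real (cmod (x $ 0))"
      by (subst mult.commute) (simp add: complex_norm_square[symmetric] power2_eq_square)
    with False show ?thesis by (simp add: ph_def sgn_eq)
  qed simp
  define v where "v k = ph / of_real (sqrt N) * x $ k" for k
  have vn: "(\<Sum>k<?n. cnj (v k) * v k) = 1"
  proof -
    have "cnj (v k) * v k = of_real ((cmod (x $ k))\<^sup>2 / N)" for k
    proof -
      have "cnj (v k) * v k = of_real ((cmod (v k))\<^sup>2)" using complex_norm_square[of "v k"] by (simp add: mult.commute)
      also have "(cmod (v k))\<^sup>2 = (cmod (x $ k))\<^sup>2 / N"
        using N by (simp add: v_def norm_mult norm_divide ph power_mult_distrib power_divide)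
      finally show ?thesis .
    qed
    then have "(\<Sum>k<?n. cnj (v k) * v k) = of_real ((\<Sum>k<?n. (cmod (x $ k))\<^sup>2) / N)"
      by (simp only: of_real_sum[symmetric] sum_divide_distrib)
    then show ?thesis using N by (simp add: N_def[symmetric] del: sum.lessThan_Suc)
  qed
  have "v 0 = of_real (- cmod (x $ 0) / sqrt N)" using ph0 by (simp add: v_def)
  moreover have "- cmod (x $ 0) / sqrt N \<le> 0" using N by simp
  ultimately obtain W where W: "W \<in> unitary_group ?n" "\<And>i. i < ?n \<Longrightarrow> W $$ (i, 0) = v i"
    using unitary_with_first_column[OF vn] by metis
  note w = unitary_groupD[OF W(1)]
  have Av: "(\<Sum>k<?n. A $$ (i, k) * v k) = e * v i" if "i < ?n" for i
  proof -
    have "(A *\<^sub>v x) $ i = (\<Sum>k<?n. A $$ (i, k) * x $ k)"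
      using A x(1) that by (auto simp: scalar_prod_def lessThan_atLeast0 intro!: sum.cong)
    then have "(\<Sum>k<?n. A $$ (i, k) * x $ k) = e * x $ i" using x that by simp
    moreover have "(\<Sum>k<?n. A $$ (i, k) * v k) = ph / of_real (sqrt N) * (\<Sum>k<?n. A $$ (i, k) * x $ k)"
      by (simp only: sum_distrib_left v_def) (simp add: ac_simps)
    ultimately show ?thesis by (simp add: v_def)
  qed
  define B where "B = mat_adjoint W * (A * W)"
  have B: "B \<in> carrier_mat ?n ?n" using A w by (auto simp: B_def)
  have Bad: "mat_adjoint B = B"
    using A w by (simp add: B_def mat_adjoint_mult[of _ ?n ?n _ ?n] assoc_mult_mat[of _ ?n ?n _ ?n _ ?n])
  have WB: "W * B = A * W"
    using A w unfolding B_def by (subst assoc_mult_mat[of _ ?n ?n _ ?n _ ?n, symmetric]) auto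
  have B0: "B $$ (i, 0) = (if i = 0 then e else 0)" if "i < ?n" for i
  proof -
    have "B $$ (i, 0) = (\<Sum>k<?n. cnj (W $$ (k, i)) * (A * W) $$ (k, 0))"
      unfolding B_def using that w A by (subst index_mult_mat_sum[of _ ?n ?n _ ?n]) auto
    also have "\<dots> = (\<Sum>k<?n. cnj (W $$ (k, i)) * (e * W $$ (k, 0)))"
    proof (rule sum.cong[OF refl], goal_cases)
      case (1 k)
      then have "(A * W) $$ (k, 0) = (\<Sum>j<?n. A $$ (k, j) * W $$ (j, 0))"
        using w A by (subst index_mult_mat_sum[of _ ?n ?n _ ?n]) auto
      also have "\<dots> = (\<Sum>j<?n. A $$ (k, j) * v j)" by (rule sum.cong) (auto simp: W(2))
      finally show ?case using Av[of k] 1 by (simp add: W(2))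
    qed
    also have "\<dots> = e * (\<Sum>k<?n. cnj (W $$ (k, i)) * W $$ (k, 0))"
      by (simp only: sum_distrib_left) (simp add: ac_simps)
    finally show ?thesis using unitary_col_orthonormal[OF W(1) that, of 0] by simp
  qed
  have B0': "B $$ (0, i) = (if i = 0 then cnj e else 0)" if "i < ?n" for i
    using B0[OF that] that B mat_adjoint_index[of 0 B i] by (simp add: Bad)
  \<comment> \<open>The corner of \<open>B\<close> equals \<open>e\<close> as a column entry and
    \<open>cnj e\<close> as a row entry.\<close>
  have er: "e = of_real (Re e)" using B0[of 0] B0'[of 0] by (simp add: complex_eq_iff)
  define A' where "A' = mat n n (\<lambda>(i, j). B $$ (Suc i, Suc j))"
  have "mat_adjoint A' = A'"
  proof (rule eq_matI)
    fix i j assume "i < dim_row A'" "j < dim_col A'"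
    then have ij: "i < n" "j < n" by (auto simp: A'_def)
    have "cnj (B $$ (Suc j, Suc i)) = B $$ (Suc i, Suc j)"
      using B ij mat_adjoint_index[of "Suc i" B "Suc j"] by (simp add: Bad)
    then show "mat_adjoint A' $$ (i, j) = A' $$ (i, j)" using ij by (simp add: A'_def)
  qed (auto simp: A'_def)
  then obtain P' l' where P': "P' \<in> unitary_group n"
    and AP': "A' * P' = P' * mat n n (\<lambda>(i, j). if i = j then of_real (l' i) else 0)"
    using Suc.IH[of A'] by (auto simp: A'_def)
  note p' = unitary_groupD[OF P']
  define l where "l i = (case i of 0 \<Rightarrow> Re e | Suc i' \<Rightarrow> l' i')" for i
  define D where "D = mat ?n ?n (\<lambda>(i, j). if i = j then complex_of_real (l i) else 0)"
  \<comment> \<open>\<open>Q\<close> is the direct sum of 1 and \<open>P'\<close>.\<close>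
  define Q where "Q = mat ?n ?n (\<lambda>(i, j). case i of
     0 \<Rightarrow> (if j = 0 then 1 else 0) | Suc i' \<Rightarrow> (case j of 0 \<Rightarrow> 0 | Suc j' \<Rightarrow> P' $$ (i', j')))"
  have Qc: "Q \<in> carrier_mat ?n ?n" and Dc: "D \<in> carrier_mat ?n ?n" by (auto simp: Q_def D_def)
  have Q: "Q \<in> unitary_group ?n"
  proof (rule unitary_groupI[OF Qc], rule eq_matI)
    fix i j assume "i < dim_row (1\<^sub>m ?n)" "j < dim_col (1\<^sub>m ?n)"
    then have ij: "i < ?n" "j < ?n" by auto
    have "(mat_adjoint Q * Q) $$ (i, j) = (\<Sum>k<?n. cnj (Q $$ (k, i)) * Q $$ (k, j))"
      using Qc ij by (subst index_mult_mat_sum[of _ ?n ?n _ ?n]) auto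
    also have "\<dots> = cnj (Q $$ (0, i)) * Q $$ (0, j) + (\<Sum>k<n. cnj (Q $$ (Suc k, i)) * Q $$ (Suc k, j))"
      by (rule sum.lessThan_Suc_shift)
    also have "\<dots> = 1\<^sub>m ?n $$ (i, j)"
      using ij unitary_col_orthonormal[OF P'] by (cases i; cases j) (auto simp: Q_def)
    finally show "(mat_adjoint Q * Q) $$ (i, j) = 1\<^sub>m ?n $$ (i, j)" .
  qed (use Qc in auto)
  have BQ: "B * Q = Q * D"
  proof (rule eq_matI)
    fix i j assume "i < dim_row (Q * D)" "j < dim_col (Q * D)"
    then have ij: "i < ?n" "j < ?n" using Qc Dc by auto
    have 1: "(B * Q) $$ (i, j) = B $$ (i, 0) * Q $$ (0, j) + (\<Sum>k<n. B $$ (i, Suc k) * Q $$ (Suc k, j))"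
      using Qc B ij by (subst index_mult_mat_sum[of _ ?n ?n _ ?n]) (auto simp: sum.lessThan_Suc_shift simp del: sum.lessThan_Suc)
    have "(Q * D) $$ (i, j) = (\<Sum>k<?n. Q $$ (i, k) * (if k = j then of_real (l k) else 0))"
      using Qc Dc ij by (subst index_mult_mat_sum[of _ ?n ?n _ ?n]) (auto simp: D_def simp del: sum.lessThan_Suc)
    then have 2: "(Q * D) $$ (i, j) = Q $$ (i, j) * of_real (l j)" using ij
      by (simp add: if_distrib[of "\<lambda>x. _ * x"] sum.delta cong: if_cong del: sum.lessThan_Suc)
    have 3: "(\<Sum>k<n. B $$ (Suc i', Suc k) * P' $$ (k, j')) = P' $$ (i', j') * of_real (l' j')"
      if "i' < n" "j' < n" for i' j'
    proof -
      have "(A' * P') $$ (i', j') = (\<Sum>k<n. B $$ (Suc i', Suc k) * P' $$ (k, j'))"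
        using p' that by (subst index_mult_mat_sum[of _ n n _ n]) (auto simp: A'_def)
      moreover have "(P' * mat n n (\<lambda>(i, j). if i = j then complex_of_real (l' i) else 0)) $$ (i', j')
        = (\<Sum>k<n. P' $$ (i', k) * (if k = j' then of_real (l' k) else 0))"
        using p' that by (subst index_mult_mat_sum[of _ n n _ n]) auto
      ultimately show ?thesis using that AP'
        by (simp add: if_distrib[of "\<lambda>x. _ * x"] sum.delta cong: if_cong)
    qed
    show "(B * Q) $$ (i, j) = (Q * D) $$ (i, j)"
      unfolding 1 2 using ij 3 er
      by (cases i; cases j) (auto simp: Q_def l_def B0 B0')
  qed (use Qc Dc B in auto)
  have "A * (W * Q) = W * B * Q"
    using A w Qc by (simp add: WB assoc_mult_mat[of _ ?n ?n _ ?n _ ?n])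
  also have "\<dots> = W * Q * D"
    using w B Qc Dc by (simp add: BQ assoc_mult_mat[of _ ?n ?n _ ?n _ ?n])
  finally show ?case
    using unitary_group_mult[OF W(1) Q] unfolding D_def by blast
qed

subsection \<open>Bounding the trace norm of a Hermitian operator\<close>

lemma proots_linear_factors:
  "proots (\<Prod>x\<leftarrow>xs. [:- f x, 1:]) = mset (map f xs :: complex list)"
proof (induction xs)
  case (Cons x xs)
  have "(\<Prod>x\<leftarrow>xs. [:- f x, 1:]) \<noteq> (0 :: complex poly)" by (auto simp: prod_list_zero_iff)
  then show ?case using Cons by (simp add: proots_mult del: mult_pCons_left)
qed simp

text \<open>The eigenbasis of \<open>H\<close> is not accessible, so the quadratic form is replaced
  by a majorant \<open>q\<close> whose sum is controlled over every orthonormal basis.\<close>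

lemma trace_norm_hermitian_le:
  fixes H :: "complex mat"
  assumes H: "H \<in> carrier_mat N N" "mat_adjoint H = H"
    and q: "\<And>u :: nat \<Rightarrow> complex. cmod (\<Sum>i<N. \<Sum>j<N. cnj (u i) * H $$ (i, j) * u j) \<le> q u"
    and K: "\<And>P. P \<in> unitary_group N \<Longrightarrow> (\<Sum>k<N. q (\<lambda>i. P $$ (i, k))) \<le> K"
  shows "trace_norm H \<le> K"
proof -
  obtain P l where P: "P \<in> unitary_group N"
    and HP: "H * P = P * mat N N (\<lambda>(i, j). if i = j then complex_of_real (l i) else 0)"
    using hermitian_spectral[OF H] by blast
  note p = unitary_groupD[OF P]
  define D where "D = mat N N (\<lambda>(i, j). if i = j then complex_of_real (l i) else 0)"
  have Dc: "D \<in> carrier_mat N N" by (simp add: D_def)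
  have MD: "(M * D) $$ (i, j) = M $$ (i, j) * of_real (l j)"
    if "M \<in> carrier_mat N N" "i < N" "j < N" for M i j
  proof -
    have "(M * D) $$ (i, j) = (\<Sum>k<N. M $$ (i, k) * (if k = j then of_real (l k) else 0))"
      using Dc that by (subst index_mult_mat_sum[of _ N N _ N]) (auto simp: D_def)
    then show ?thesis using that by (simp add: if_distrib[of "\<lambda>x. _ * x"] sum.delta cong: if_cong)
  qed
  have D2: "(D * D) $$ (i, j) = (if i = j then of_real ((l i)\<^sup>2) else 0)" if "i < N" "j < N" for i j
    using MD[OF Dc that] that by (simp add: D_def power2_eq_square)
  have "H * H * P = H * (P * D)"
    using H p by (simp add: assoc_mult_mat[of _ N N _ N _ N] HP D_def)
  also have "\<dots> = H * P * D" using H p Dc by (simp add: assoc_mult_mat[of _ N N _ N _ N])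
  also have "\<dots> = P * D * D" by (simp add: HP D_def)
  also have "\<dots> = P * (D * D)" using p Dc by (simp add: assoc_mult_mat[of _ N N _ N _ N])
  finally have "H * H * P = P * (D * D)" .
  then have "H * H = P * (D * D) * mat_adjoint P"
    using H p assoc_mult_mat[of "H * H" N N P N "mat_adjoint P" N]
    by (metis mat_adjoint_carrier mult_carrier_mat right_mult_one_mat)
  then have "similar_mat (H * H) (D * D)"
    using H p Dc unfolding similar_mat_def
    by (intro exI[of _ P] exI[of _ "mat_adjoint P"]) (auto simp: similar_mat_wit_def Let_def)
  then have "char_poly (H * H) = char_poly (D * D)" by (rule char_poly_similar)
  also have "\<dots> = (\<Prod>a\<leftarrow>diag_mat (D * D). [:- a, 1:])"
    by (rule char_poly_upper_triangular[of _ N]) (use Dc D2 in auto)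
  also have "diag_mat (D * D) = map (\<lambda>i. of_real ((l i)\<^sup>2)) [0..<N]"
    using Dc D2 by (auto simp: diag_mat_def simp del: index_mult_mat(1) intro!: map_cong)
  finally have "char_poly (H * H) = (\<Prod>i\<leftarrow>[0..<N]. [:- of_real ((l i)\<^sup>2), 1:])"
    by (simp add: o_def)
  then have "proots (char_poly (H * H)) = mset (map (\<lambda>i. complex_of_real ((l i)\<^sup>2)) [0..<N])"
    by (simp only: proots_linear_factors)
  from this have tn: "trace_norm H = (\<Sum>i<N. sqrt (Re (complex_of_real ((l i)\<^sup>2))))"
    unfolding trace_norm_def H(2)
    by (simp only: mset_map[symmetric] sum_mset_sum_list map_map o_def)
       (simp add: sum_list_distinct_conv_sum_set lessThan_atLeast0)
  have "trace_norm H = (\<Sum>i<N. \<bar>l i\<bar>)" unfolding tn by simp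
  also have "\<dots> \<le> (\<Sum>k<N. q (\<lambda>i. P $$ (i, k)))"
  proof (rule sum_mono)
    fix k assume k: "k \<in> {..<N}"
    have "(\<Sum>i<N. \<Sum>j<N. cnj (P $$ (i, k)) * H $$ (i, j) * P $$ (j, k)) = (\<Sum>i<N. cnj (P $$ (i, k)) * (H * P) $$ (i, k))"
      using H p k by (intro sum.cong refl, subst index_mult_mat_sum[of _ N N _ N]) (auto simp: sum_distrib_left mult.assoc)
    also have "\<dots> = (\<Sum>i<N. cnj (P $$ (i, k)) * P $$ (i, k)) * of_real (l k)"
      using k by (simp add: HP D_def[symmetric] MD[OF p(1)] sum_distrib_right mult.assoc del: index_mult_mat(1))
    also have "\<dots> = of_real (l k)" using unitary_col_orthonormal[OF P, of k k] k by simp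
    finally show "\<bar>l k\<bar> \<le> q (\<lambda>i. P $$ (i, k))" using q[of "\<lambda>i. P $$ (i, k)"] by simp
  qed
  also have "\<dots> \<le> K" by (rule K[OF P])
  finally show ?thesis .
qed

subsection \<open>Kronecker products and Pauli strings\<close>

lemma sum_mult_lessThan:
  fixes f :: "nat \<Rightarrow> 'a :: comm_monoid_add"
  shows "(\<Sum>k<m * n. f k) = (\<Sum>i<m. \<Sum>j<n. f (i * n + j))"
proof (induction m)
  case (Suc m)
  have "(\<Sum>k<Suc m * n. f k) = (\<Sum>k<m * n. f k) + (\<Sum>k\<in>{m * n..<m * n + n}. f k)"
    by (subst sum.union_disjoint[symmetric]) (auto intro: sum.cong)
  also have "(\<Sum>k\<in>{m * n..<m * n + n}. f k) = (\<Sum>j<n. f (m * n + j))"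
    by (rule sum.reindex_bij_witness[of _ "\<lambda>j. m * n + j" "\<lambda>k. k - m * n"]) auto
  finally show ?case using Suc by simp
qed simp

lemma div_mod_lessThan_mult:
  fixes i :: nat
  assumes "i < m * n"
  shows "i div n < m" "i mod n < n"
  using assms by (auto simp: less_mult_imp_div_less) (metis mod_less_divisor mult_0_right not_gr_zero not_less_zero)

lemma add_mult_lessThan:
  fixes i :: nat
  assumes "i < m" "j < n"
  shows "i * n + j < m * n"
proof -
  have "i * n + j < Suc i * n" using assms(2) by simp
  also have "\<dots> \<le> m * n" using assms(1) by (intro mult_right_mono) auto
  finally show ?thesis .
qed

lemma div_mod_add_mult:
  fixes j :: nat
  assumes "j < n"
  shows "(i * n + j) div n = i" "(i * n + j) mod n = j"
  using assms by auto

lemma kron_carrier: "A \<in> carrier_mat a b \<Longrightarrow> B \<in> carrier_mat c d \<Longrightarrow> kron A B \<in> carrier_mat (a * c) (b * d)"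
  by (auto simp: kron_def)

lemma kron_index:
  "A \<in> carrier_mat a b \<Longrightarrow> B \<in> carrier_mat c d \<Longrightarrow> i < a * c \<Longrightarrow> j < b * d \<Longrightarrow>
    kron A B $$ (i, j) = A $$ (i div c, j div d) * B $$ (i mod c, j mod d)"
  by (auto simp: kron_def)

lemma kron_mult:
  assumes A: "A \<in> carrier_mat a b" and B: "B \<in> carrier_mat c d"
    and C: "C \<in> carrier_mat b e" and D: "D \<in> carrier_mat d f"
  shows "kron A B * kron C D = kron (A * C) (B * D)"
proof (rule eq_matI)
  have AC: "A * C \<in> carrier_mat a e" and BD: "B * D \<in> carrier_mat c f" using assms by auto
  note kc = kron_carrier[OF A B] kron_carrier[OF C D] kron_carrier[OF AC BD]
  fix i j assume "i < dim_row (kron (A * C) (B * D))" "j < dim_col (kron (A * C) (B * D))"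
  then have ij: "i < a * c" "j < e * f" using kc by auto
  note dm = div_mod_lessThan_mult[OF ij(1)] div_mod_lessThan_mult[OF ij(2)]
  have "(kron A B * kron C D) $$ (i, j) = (\<Sum>k<b * d. kron A B $$ (i, k) * kron C D $$ (k, j))"
    using kc ij by (intro index_mult_mat_sum)
  also have "\<dots> = (\<Sum>k<b. \<Sum>l<d. (A $$ (i div c, k) * C $$ (k, j div f)) * (B $$ (i mod c, l) * D $$ (l, j mod f)))"
    unfolding sum_mult_lessThan
  proof (intro sum.cong refl, goal_cases)
    case (1 k l)
    then have "k * d + l < b * d"
      by (auto intro: add_mult_lessThan)
    with 1 show ?case
      using ij by (simp add: kron_index[OF A B] kron_index[OF C D] div_mod_add_mult)
  qed
  also have "\<dots> = (\<Sum>k<b. A $$ (i div c, k) * C $$ (k, j div f)) * (\<Sum>l<d. B $$ (i mod c, l) * D $$ (l, j mod f))"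
    by (simp only: sum_product)
  also have "\<dots> = (A * C) $$ (i div c, j div f) * (B * D) $$ (i mod c, j mod f)"
    using dm by (simp only: index_mult_mat_sum[OF A C] index_mult_mat_sum[OF B D])
  also have "\<dots> = kron (A * C) (B * D) $$ (i, j)" using ij by (simp only: kron_index[OF AC BD])
  finally show "(kron A B * kron C D) $$ (i, j) = kron (A * C) (B * D) $$ (i, j)" .
qed (use assms in \<open>auto simp: kron_def\<close>)

lemma kron_adjoint: "mat_adjoint (kron A B) = kron (mat_adjoint A) (mat_adjoint B)"
proof (rule eq_matI)
  fix i j assume "i < dim_row (kron (mat_adjoint A) (mat_adjoint B))" "j < dim_col (kron (mat_adjoint A) (mat_adjoint B))"
  then have "i < dim_col A * dim_col B" "j < dim_row A * dim_row B" by (auto simp: kron_def)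
  then show "mat_adjoint (kron A B) $$ (i, j) = kron (mat_adjoint A) (mat_adjoint B) $$ (i, j)"
    using div_mod_lessThan_mult[of i] div_mod_lessThan_mult[of j] by (simp add: kron_def)
qed (auto simp: kron_def)

lemma kron_smult: "kron (x \<cdot>\<^sub>m A) (y \<cdot>\<^sub>m B) = (x * y) \<cdot>\<^sub>m kron A B"
  by (rule eq_matI) (auto simp: kron_def div_mod_lessThan_mult)

lemma one_smult_mat [simp]: "1 \<cdot>\<^sub>m A = (A :: complex mat)"
  and smult_smult_mat [simp]: "a \<cdot>\<^sub>m (b \<cdot>\<^sub>m A) = (a * b) \<cdot>\<^sub>m (A :: complex mat)"
  by (auto intro!: eq_matI)

lemma kron_one: "kron (1\<^sub>m a) (1\<^sub>m b) = 1\<^sub>m (a * b)"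
proof (rule eq_matI)
  fix i j assume "i < dim_row (1\<^sub>m (a * b) :: complex mat)" "j < dim_col (1\<^sub>m (a * b) :: complex mat)"
  then have ij: "i < a * b" "j < a * b" by auto
  have "(i = j) = (i div b = j div b \<and> i mod b = j mod b)" by (metis div_mult_mod_eq)
  then show "kron (1\<^sub>m a) (1\<^sub>m b) $$ (i, j) = (1\<^sub>m (a * b) :: complex mat) $$ (i, j)"
    using ij div_mod_lessThan_mult[OF ij(1)] div_mod_lessThan_mult[OF ij(2)] by (auto simp: kron_def)
qed (auto simp: kron_def)

section \<open>Single-qubit Pauli matrices\<close>

lemma pauli_X_mat: "pauli_X = mat 2 2 (\<lambda>(i, j). if i = j then 0 else 1)"
  and pauli_Y_mat: "pauli_Y = mat 2 2 (\<lambda>(i, j). if i = j then 0 else if i = 0 then - \<i> else \<i>)"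
  and pauli_Z_mat: "pauli_Z = mat 2 2 (\<lambda>(i, j). if i = j then if i = 0 then 1 else - 1 else 0)"
  by (auto intro!: eq_matI simp: pauli_X_def pauli_Y_def pauli_Z_def mat_of_rows_list_def dest!: less_2_cases)

definition paulis :: "complex mat set" where
  "paulis = {1\<^sub>m 2, pauli_X, pauli_Y, pauli_Z}"

lemma pauli_carrier [simp]:
  "pauli_X \<in> carrier_mat 2 2" "pauli_Y \<in> carrier_mat 2 2" "pauli_Z \<in> carrier_mat 2 2"
  by (auto simp: pauli_X_mat pauli_Y_mat pauli_Z_mat)

lemma mat2_eqI:
  assumes "A \<in> carrier_mat 2 2" "B \<in> carrier_mat 2 2"
    "A $$ (0, 0) = B $$ (0, 0)" "A $$ (0, 1) = B $$ (0, 1)" "A $$ (1, 0) = B $$ (1, 0)" "A $$ (1, 1) = B $$ (1, 1)"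
  shows "A = B"
  using assms by (intro eq_matI) (auto dest!: less_2_cases)

lemma sum_lessThan_2: "(\<Sum>k<2. f k) = f 0 + (f (Suc 0) :: 'a :: comm_monoid_add)"
  by (simp add: numeral_2_eq_2)

lemma mat2_mult_index:
  "A \<in> carrier_mat 2 2 \<Longrightarrow> B \<in> carrier_mat 2 2 \<Longrightarrow> i < 2 \<Longrightarrow> j < 2 \<Longrightarrow>
    (A * B) $$ (i, j) = A $$ (i, 0) * B $$ (0, j) + A $$ (i, 1) * (B $$ (1, j) :: complex)"
  by (subst index_mult_mat_sum[of A 2 2 B 2]) (auto simp: sum_lessThan_2)

lemma pauli_mult:
  "pauli_X * pauli_X = 1\<^sub>m 2" "pauli_Y * pauli_Y = 1\<^sub>m 2" "pauli_Z * pauli_Z = 1\<^sub>m 2"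
  "pauli_X * pauli_Y = \<i> \<cdot>\<^sub>m pauli_Z" "pauli_Y * pauli_X = (- \<i>) \<cdot>\<^sub>m pauli_Z"
  "pauli_Y * pauli_Z = \<i> \<cdot>\<^sub>m pauli_X" "pauli_Z * pauli_Y = (- \<i>) \<cdot>\<^sub>m pauli_X"
  "pauli_Z * pauli_X = \<i> \<cdot>\<^sub>m pauli_Y" "pauli_X * pauli_Z = (- \<i>) \<cdot>\<^sub>m pauli_Y"
  by (auto intro!: mat2_eqI simp: mat2_mult_index pauli_X_mat pauli_Y_mat pauli_Z_mat
      simp del: index_mult_mat(1))

lemmas pauli_mult_one = pauli_carrier[THEN right_mult_one_mat] pauli_carrier[THEN left_mult_one_mat]

lemma pauli_distinct:
  "1\<^sub>m 2 \<noteq> pauli_X" "1\<^sub>m 2 \<noteq> pauli_Y" "1\<^sub>m 2 \<noteq> pauli_Z" "pauli_X \<noteq> pauli_Y" "pauli_X \<noteq> pauli_Z" "pauli_Y \<noteq> pauli_Z"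
proof -
  have *: "A \<noteq> B" if "A $$ (i, j) \<noteq> B $$ (i, j)" for A B :: "complex mat" and i j using that by auto
  show "1\<^sub>m 2 \<noteq> pauli_X" "1\<^sub>m 2 \<noteq> pauli_Y" "pauli_X \<noteq> pauli_Z" "pauli_Y \<noteq> pauli_Z"
    by (auto intro!: *[of _ 0 0] simp: pauli_X_mat pauli_Y_mat pauli_Z_mat)
  show "1\<^sub>m 2 \<noteq> pauli_Z" by (rule *[of _ 1 1]) (simp add: pauli_Z_mat)
  show "pauli_X \<noteq> pauli_Y" by (rule *[of _ 0 1]) (simp add: pauli_X_mat pauli_Y_mat complex_eq_iff)
qed

lemma paulis_finite [simp]: "finite paulis" by (simp add: paulis_def)

lemma paulis_carrier: "A \<in> paulis \<Longrightarrow> A \<in> carrier_mat 2 2"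
  by (auto simp: paulis_def)

lemma paulis_adjoint: "A \<in> paulis \<Longrightarrow> mat_adjoint A = A"
  by (auto simp: paulis_def) (auto intro!: mat2_eqI mat_adjoint_carrier simp: pauli_X_mat pauli_Y_mat pauli_Z_mat)

lemma paulis_square: "A \<in> paulis \<Longrightarrow> A * A = 1\<^sub>m 2"
  by (auto simp: paulis_def pauli_mult)

lemma paulis_mult:
  assumes "A \<in> paulis" "B \<in> paulis"
  shows "\<exists>k C. C \<in> paulis \<and> A * B = \<i> ^ k \<cdot>\<^sub>m C"
proof -
  have "\<exists>c\<in>{1, \<i>, - \<i>}. \<exists>C\<in>paulis. A * B = c \<cdot>\<^sub>m C"
    using assms unfolding paulis_def by (elim insertE emptyE) (simp_all add: pauli_mult pauli_mult_one)
  then obtain c C where C: "c \<in> {1, \<i>, - \<i>}" "C \<in> paulis" "A * B = c \<cdot>\<^sub>m C" by (elim bexE)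
  have "1 = \<i> ^ 0" "\<i> = \<i> ^ 1" "- \<i> = \<i> ^ 3" by (simp_all add: power3_eq_cube)
  with C(1) obtain k where "c = \<i> ^ k" by (metis empty_iff insert_iff)
  with C show ?thesis by (intro exI[of _ k] exI[of _ C]) simp
qed

lemma paulis_commute:
  assumes "A \<in> paulis" "B \<in> paulis"
  shows "\<exists>e\<in>{1, - 1}. A * B = e \<cdot>\<^sub>m (B * A)"
  using assms unfolding paulis_def by (elim insertE emptyE) (simp_all add: pauli_mult pauli_mult_one)

lemma paulis_anticommute:
  assumes "A \<in> paulis" "A \<noteq> 1\<^sub>m 2"
  shows "\<exists>B\<in>paulis. A * B = (- 1) \<cdot>\<^sub>m (B * A)"
  using assms unfolding paulis_def by (elim insertE emptyE) (simp_all add: pauli_mult pauli_mult_one)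

text \<open>The sum of A \<otimes> A over the four Paulis is twice the swap of two qubits.\<close>

lemma paulis_completeness:
  assumes "i < 2" "j < 2" "k < 2" "l < 2"
  shows "(\<Sum>A\<in>paulis. A $$ (i, j) * A $$ (k, l)) = (if i = l \<and> j = k then 2 else 0)"
  using assms pauli_distinct unfolding paulis_def
  by (auto simp: pauli_X_mat pauli_Y_mat pauli_Z_mat dest!: less_2_cases)

text \<open>The diagonal counterpart: 1 \<otimes> 1 + Z \<otimes> Z is twice the projection onto the
  span of |00> and |11>.\<close>

lemma paulis_diagonal_completeness:
  assumes "i < 2" "j < 2" "k < 2" "l < 2"
  shows "(\<Sum>A\<in>{1\<^sub>m 2, pauli_Z}. A $$ (i, j) * A $$ (k, l)) = (if i = j \<and> j = k \<and> k = l then 2 else 0)"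
  using assms pauli_distinct by (auto simp: pauli_Z_mat dest!: less_2_cases)

section \<open>Pauli strings: products, commutation and completeness\<close>

definition strings :: "nat \<Rightarrow> 'a set \<Rightarrow> 'a list set" where
  "strings n S = {xs. length xs = n \<and> set xs \<subseteq> S}"

lemma strings_0 [simp]: "strings 0 S = {[]}" by (auto simp: strings_def)

lemma strings_Suc: "strings (Suc n) S = (\<lambda>(x, xs). x # xs) ` (S \<times> strings n S)"
  by (auto simp: strings_def length_Suc_conv)

lemma finite_strings [simp]: "finite S \<Longrightarrow> finite (strings n S)"
  using finite_lists_length_eq[of S n] by (simp add: strings_def conj_commute)

lemma card_strings: "finite S \<Longrightarrow> card (strings n S) = card S ^ n"
  using card_lists_length_eq[of S n] by (simp add: strings_def conj_commute)

lemma sum_strings_Suc: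
  "(\<Sum>xs\<in>strings (Suc n) S. f xs) = (\<Sum>x\<in>S. \<Sum>xs\<in>strings n S. f (x # xs))"
  unfolding strings_Suc by (subst sum.reindex) (auto simp: inj_on_def sum.cartesian_product split_def)

lemma kron_list_Nil [simp]: "kron_list [] = 1\<^sub>m 1"
  and kron_list_Cons [simp]: "kron_list (A # As) = kron A (kron_list As)"
  by (simp_all add: kron_list_def)

lemma pauli_group_eq: "pauli_group n = {\<i> ^ k \<cdot>\<^sub>m kron_list Ps | k Ps. Ps \<in> strings n paulis}"
  by (simp add: pauli_group_def strings_def paulis_def)

lemma strings_carrier: "Ps \<in> strings n paulis \<Longrightarrow> kron_list Ps \<in> carrier_mat (2 ^ n) (2 ^ n)"
proof (induction n arbitrary: Ps)
  case (Suc n)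
  then show ?case by (auto simp: strings_Suc intro!: kron_carrier[of _ 2 2] paulis_carrier)
qed auto

lemma strings_adjoint: "Ps \<in> strings n paulis \<Longrightarrow> mat_adjoint (kron_list Ps) = kron_list Ps"
  by (induction n arbitrary: Ps) (auto simp: strings_Suc kron_adjoint paulis_adjoint)

lemma strings_square: "Ps \<in> strings n paulis \<Longrightarrow> kron_list Ps * kron_list Ps = 1\<^sub>m (2 ^ n)"
proof (induction n arbitrary: Ps)
  case (Suc n)
  then obtain A As where A: "Ps = A # As" "A \<in> paulis" "As \<in> strings n paulis" by (auto simp: strings_Suc)
  then show ?case using Suc.IH[OF A(3)] kron_one[of 2 "2 ^ n"]
    by (simp add: kron_mult[OF paulis_carrier strings_carrier paulis_carrier strings_carrier] paulis_square)
qed auto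

lemma strings_mult:
  assumes "Ps \<in> strings n paulis" "Qs \<in> strings n paulis"
  shows "\<exists>k Rs. Rs \<in> strings n paulis \<and> kron_list Ps * kron_list Qs = \<i> ^ k \<cdot>\<^sub>m kron_list Rs"
  using assms
proof (induction n arbitrary: Ps Qs)
  case 0
  then show ?case by (auto intro!: exI[of _ 0])
next
  case (Suc n)
  from Suc.prems obtain A As B Bs where A: "Ps = A # As" "A \<in> paulis" "As \<in> strings n paulis"
    and B: "Qs = B # Bs" "B \<in> paulis" "Bs \<in> strings n paulis" by (auto simp: strings_Suc)
  obtain k C where C: "C \<in> paulis" "A * B = \<i> ^ k \<cdot>\<^sub>m C" using paulis_mult[OF A(2) B(2)] by auto
  obtain l Cs where Cs: "Cs \<in> strings n paulis" "kron_list As * kron_list Bs = \<i> ^ l \<cdot>\<^sub>m kron_list Cs"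
    using Suc.IH[OF A(3) B(3)] by auto
  have "kron_list Ps * kron_list Qs = \<i> ^ (k + l) \<cdot>\<^sub>m kron_list (C # Cs)"
    using A B C Cs
    by (simp add: kron_mult[OF paulis_carrier strings_carrier paulis_carrier strings_carrier] kron_smult power_add)
  then show ?case using C Cs by (auto simp: strings_Suc)
qed

lemma strings_commute:
  assumes "Ps \<in> strings n paulis" "Qs \<in> strings n paulis"
  shows "\<exists>e\<in>{1, - 1}. kron_list Ps * kron_list Qs = e \<cdot>\<^sub>m (kron_list Qs * kron_list Ps)"
  using assms
proof (induction n arbitrary: Ps Qs)
  case (Suc n)
  from Suc.prems obtain A As B Bs where A: "Ps = A # As" "A \<in> paulis" "As \<in> strings n paulis"
    and B: "Qs = B # Bs" "B \<in> paulis" "Bs \<in> strings n paulis" by (auto simp: strings_Suc)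
  obtain e where e: "e \<in> {1, - 1}" "A * B = e \<cdot>\<^sub>m (B * A)" using paulis_commute[OF A(2) B(2)] by (elim bexE)
  obtain e' where e': "e' \<in> {1, - 1}" "kron_list As * kron_list Bs = e' \<cdot>\<^sub>m (kron_list Bs * kron_list As)"
    using Suc.IH[OF A(3) B(3)] by (elim bexE)
  have "kron_list Ps * kron_list Qs = (e * e') \<cdot>\<^sub>m (kron_list Qs * kron_list Ps)"
    using A B e e'
    by (simp add: kron_mult[OF paulis_carrier strings_carrier paulis_carrier strings_carrier] kron_smult)
  moreover have "e * e' \<in> {1, - 1}" using e e' by auto
  ultimately show ?case by blast
qed auto

lemma strings_one: "replicate n (1\<^sub>m 2) \<in> strings n paulis" "kron_list (replicate n (1\<^sub>m 2)) = 1\<^sub>m (2 ^ n)"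
proof -
  show "replicate n (1\<^sub>m 2) \<in> strings n paulis" by (auto simp: strings_def paulis_def)
  show "kron_list (replicate n (1\<^sub>m 2)) = 1\<^sub>m (2 ^ n)"
    by (induction n) (auto simp: kron_one)
qed

text \<open>One factor other than the identity is enough: an anticommuting Pauli is placed there.
  When that factor is the head, the tail of the string itself serves as the tail of the partner,
  since it commutes with itself.\<close>

lemma strings_anticommute:
  assumes "Ps \<in> strings n paulis" "Ps \<noteq> replicate n (1\<^sub>m 2)"
  shows "\<exists>Qs\<in>strings n paulis. kron_list Ps * kron_list Qs = (- 1) \<cdot>\<^sub>m (kron_list Qs * kron_list Ps)"
  using assms
proof (induction n arbitrary: Ps)
  case (Suc n)
  from Suc.prems obtain A As where A: "Ps = A # As" "A \<in> paulis" "As \<in> strings n paulis"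
    by (auto simp: strings_Suc)
  note km = kron_mult[OF paulis_carrier strings_carrier paulis_carrier strings_carrier]
  show ?case
  proof (cases "A = 1\<^sub>m 2")
    case True
    then have "As \<noteq> replicate n (1\<^sub>m 2)" using A Suc.prems by auto
    then obtain Qs where Q: "Qs \<in> strings n paulis" "kron_list As * kron_list Qs = (- 1) \<cdot>\<^sub>m (kron_list Qs * kron_list As)"
      using Suc.IH[OF A(3)] by auto
    have "kron_list Ps * kron_list (1\<^sub>m 2 # Qs) = (- 1) \<cdot>\<^sub>m (kron_list (1\<^sub>m 2 # Qs) * kron_list Ps)"
      using A Q True km[OF A(2,3) A(2) Q(1)] km[OF A(2) Q(1) A(2,3)] kron_smult[of 1 "1\<^sub>m 2" "-1"] by simp
    moreover have "1\<^sub>m 2 # Qs \<in> strings (Suc n) paulis" using A Q True by (auto simp: strings_Suc)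
    ultimately show ?thesis by (rule bexI)
  next
    case False
    then obtain B where B: "B \<in> paulis" "A * B = (- 1) \<cdot>\<^sub>m (B * A)" using paulis_anticommute[OF A(2)] by auto
    have "kron_list Ps * kron_list (B # As) = (- 1) \<cdot>\<^sub>m (kron_list (B # As) * kron_list Ps)"
      using A B km[OF A(2,3) B(1) A(3)] km[OF B(1) A(3) A(2,3)] kron_smult[of "-1" _ 1 "kron_list As * kron_list As"] by simp
    moreover have "B # As \<in> strings (Suc n) paulis" using A B by (auto simp: strings_Suc)
    ultimately show ?thesis by (rule bexI)
  qed
qed auto

text \<open>The head of a string acts on the high-order digit of an index and the tail on the
  remainder, so sums of products of entries factorise.\<close>

lemma kron_completeness_step:
  fixes f :: "complex mat list \<Rightarrow> complex mat"
  assumes S: "S \<subseteq> paulis" and i: "i < 2 * 2 ^ n" "j < 2 * 2 ^ n" "k < 2 * 2 ^ n" "l < 2 * 2 ^ n"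
  shows "(\<Sum>Ps\<in>strings (Suc n) S. kron_list Ps $$ (i, j) * kron_list Ps $$ (k, l)) =
    (\<Sum>A\<in>S. A $$ (i div 2 ^ n, j div 2 ^ n) * A $$ (k div 2 ^ n, l div 2 ^ n)) *
    (\<Sum>Ps\<in>strings n S. kron_list Ps $$ (i mod 2 ^ n, j mod 2 ^ n) * kron_list Ps $$ (k mod 2 ^ n, l mod 2 ^ n))"
  unfolding sum_strings_Suc sum_product
proof (intro sum.cong refl, goal_cases)
  case (1 A Ps)
  then have "A \<in> carrier_mat 2 2" "kron_list Ps \<in> carrier_mat (2 ^ n) (2 ^ n)"
    using S by (auto intro!: paulis_carrier strings_carrier simp: strings_def)
  from kron_index[OF this] i show ?case by (simp add: mult_ac)
qed

text \<open>The tensor squares of all strings add up to \<open>2 ^ n\<close> times the swap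
  operator; equivalently, the strings form an orthogonal operator basis.\<close>

lemma strings_completeness:
  assumes "i < 2 ^ n" "j < 2 ^ n" "k < 2 ^ n" "l < 2 ^ n"
  shows "(\<Sum>Ps\<in>strings n paulis. kron_list Ps $$ (i, j) * kron_list Ps $$ (k, l)) = (if i = l \<and> j = k then 2 ^ n else 0)"
  using assms
proof (induction n arbitrary: i j k l)
  case (Suc n)
  let ?d = "2 ^ n :: nat"
  from Suc.prems have lt: "i < 2 * ?d" "j < 2 * ?d" "k < 2 * ?d" "l < 2 * ?d" by auto
  note dm = lt[THEN div_mod_lessThan_mult(1)] lt[THEN div_mod_lessThan_mult(2)]
  have eq: "a = b \<longleftrightarrow> a div ?d = b div ?d \<and> a mod ?d = b mod ?d" for a b :: nat by (metis div_mult_mod_eq)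
  show ?case
    unfolding kron_completeness_step[OF order_refl lt] Suc.IH[OF dm(5-8)] paulis_completeness[OF dm(1-4)]
    using eq[of i l] eq[of j k] by auto
qed auto

text \<open>The tensor squares of the diagonal strings add up to \<open>2 ^ n\<close> times the
  projection onto the vectors |xx>, that is, onto coinciding registers.\<close>

lemma strings_diagonal_completeness:
  assumes "i < 2 ^ n" "j < 2 ^ n" "k < 2 ^ n" "l < 2 ^ n"
  shows "(\<Sum>Ps\<in>strings n {1\<^sub>m 2, pauli_Z}. kron_list Ps $$ (i, j) * kron_list Ps $$ (k, l)) =
    (if i = j \<and> j = k \<and> k = l then 2 ^ n else 0)"
  using assms
proof (induction n arbitrary: i j k l)
  case (Suc n)
  let ?d = "2 ^ n :: nat"
  from Suc.prems have lt: "i < 2 * ?d" "j < 2 * ?d" "k < 2 * ?d" "l < 2 * ?d" by auto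
  note dm = lt[THEN div_mod_lessThan_mult(1)] lt[THEN div_mod_lessThan_mult(2)]
  have eq: "a = b \<longleftrightarrow> a div ?d = b div ?d \<and> a mod ?d = b mod ?d" for a b :: nat by (metis div_mult_mod_eq)
  have S: "{1\<^sub>m 2, pauli_Z} \<subseteq> paulis" by (auto simp: paulis_def)
  show ?case
    unfolding kron_completeness_step[OF S lt] Suc.IH[OF dm(5-8)] paulis_diagonal_completeness[OF dm(1-4)]
    using eq[of i j] eq[of j k] eq[of k l] by auto
qed auto

subsection \<open>Averages over the Clifford group\<close>

lemma square_mult_carrier [simp]:
  "A \<in> carrier_mat d d \<Longrightarrow> B \<in> carrier_mat d d \<Longrightarrow> A * B \<in> carrier_mat d d"
  by simp

lemma unitary_cancel:
  assumes "U \<in> unitary_group d" "X \<in> carrier_mat d m"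
  shows "mat_adjoint U * (U * X) = X" "U * (mat_adjoint U * X) = X"
proof -
  note u = unitary_groupD[OF assms(1)]
  show "mat_adjoint U * (U * X) = X"
    using u assms(2) assoc_mult_mat[of "mat_adjoint U" d d U d X m] by simp
  show "U * (mat_adjoint U * X) = X"
    using u assms(2) assoc_mult_mat[of U d d "mat_adjoint U" d X m] by simp
qed

lemma pauli_group_carrier: "P \<in> pauli_group n \<Longrightarrow> P \<in> carrier_mat (2 ^ n) (2 ^ n)"
  by (auto simp: pauli_group_eq strings_carrier)

lemma pauli_group_phase: "P \<in> pauli_group n \<Longrightarrow> \<i> ^ k \<cdot>\<^sub>m P \<in> pauli_group n"
  unfolding pauli_group_eq by (auto simp: power_add[symmetric]) blast

lemma strings_pauli_group: "Ps \<in> strings n paulis \<Longrightarrow> kron_list Ps \<in> pauli_group n"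
  unfolding pauli_group_eq by (auto intro!: exI[of _ "0 :: nat"] exI[of _ Ps])

lemma pauli_group_minus: "P \<in> pauli_group n \<Longrightarrow> (- 1) \<cdot>\<^sub>m P \<in> pauli_group n"
  using pauli_group_phase[of P n 2] by simp

lemma pauli_group_mult:
  assumes "P \<in> pauli_group n" "Q \<in> pauli_group n"
  shows "P * Q \<in> pauli_group n"
proof -
  obtain k l Ps Qs where P: "P = \<i> ^ k \<cdot>\<^sub>m kron_list Ps" "Ps \<in> strings n paulis"
    and Q: "Q = \<i> ^ l \<cdot>\<^sub>m kron_list Qs" "Qs \<in> strings n paulis"
    using assms by (auto simp: pauli_group_eq)
  obtain m Rs where R: "Rs \<in> strings n paulis" "kron_list Ps * kron_list Qs = \<i> ^ m \<cdot>\<^sub>m kron_list Rs"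
    using strings_mult[OF P(2) Q(2)] by auto
  have "P * Q = \<i> ^ (k + l + m) \<cdot>\<^sub>m kron_list Rs"
    using strings_carrier[OF P(2)] strings_carrier[OF Q(2)] R
    by (simp add: P Q mult_smult_distrib[of _ "2 ^ n" "2 ^ n" _ "2 ^ n"] mult_smult_assoc_mat[of _ "2 ^ n" "2 ^ n" _ "2 ^ n"] power_add mult_ac)
  then show ?thesis using R by (auto simp: pauli_group_eq)
qed

text \<open>The phases are powers of the imaginary unit, so four exponents suffice. Finiteness is
  what bounds the number of Clifford classes below.\<close>

lemma pauli_group_finite: "finite (pauli_group n)"
proof (rule finite_subset)
  show "pauli_group n \<subseteq> (\<lambda>(k, Ps). \<i> ^ k \<cdot>\<^sub>m kron_list Ps) ` ({..<4} \<times> strings n paulis)"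
  proof
    fix P assume "P \<in> pauli_group n"
    then obtain k Ps where P: "P = \<i> ^ k \<cdot>\<^sub>m kron_list Ps" "Ps \<in> strings n paulis"
      by (auto simp: pauli_group_eq)
    have "\<i> ^ k = \<i> ^ (4 * (k div 4) + k mod 4)" by simp
    also have "\<dots> = (\<i> ^ 4) ^ (k div 4) * \<i> ^ (k mod 4)" by (simp only: power_add power_mult)
    also have "\<i> ^ 4 = 1" by (simp add: power4_eq_xxxx)
    finally have "P = \<i> ^ (k mod 4) \<cdot>\<^sub>m kron_list Ps" using P by simp
    then show "P \<in> (\<lambda>(k, Ps). \<i> ^ k \<cdot>\<^sub>m kron_list Ps) ` ({..<4} \<times> strings n paulis)"
      using P(2) by (intro image_eqI[of _ _ "(k mod 4, Ps)"]) auto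
  qed
qed auto

lemma clifford_groupD:
  assumes "U \<in> clifford_group n"
  shows "U \<in> unitary_group (2 ^ n)" "U \<in> carrier_mat (2 ^ n) (2 ^ n)"
    "P \<in> pauli_group n \<Longrightarrow> U * P * mat_adjoint U \<in> pauli_group n"
  using assms by (auto simp: clifford_group_def unitary_group_def)

lemma clifford_group_mult:
  assumes "U \<in> clifford_group n" "V \<in> clifford_group n"
  shows "U * V \<in> clifford_group n"
proof -
  let ?d = "2 ^ n :: nat"
  note u = clifford_groupD[OF assms(1)] and v = clifford_groupD[OF assms(2)]
  have "U * V * P * mat_adjoint (U * V) \<in> pauli_group n" if P: "P \<in> pauli_group n" for P
  proof -
    have "U * V * P * mat_adjoint (U * V) = U * (V * P * mat_adjoint V) * mat_adjoint U"
      using u(2) v(2) pauli_group_carrier[OF P]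
      by (simp add: mat_adjoint_mult[of _ ?d ?d _ ?d] assoc_mult_mat[of _ ?d ?d _ ?d _ ?d])
    then show ?thesis using u(3)[OF v(3)[OF P]] by simp
  qed
  then show ?thesis using unitary_group_mult[OF u(1) v(1)] by (auto simp: clifford_group_def)
qed

lemma one_clifford_group: "1\<^sub>m (2 ^ n) \<in> clifford_group n"
proof -
  have "1\<^sub>m (2 ^ n) * P * mat_adjoint (1\<^sub>m (2 ^ n)) = P" if "P \<in> pauli_group n" for P
    using pauli_group_carrier[OF that] by simp
  then show ?thesis by (auto simp: clifford_group_def unitary_group_def)
qed

section \<open>The Clifford group modulo phases and its uniform average\<close>

lemma phase_rel_equiv: "equiv (clifford_group n) (phase_rel n)"
proof (rule equivI)
  show "phase_rel n \<subseteq> clifford_group n \<times> clifford_group n" by (auto simp: phase_rel_def)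
  show "refl_on (clifford_group n) (phase_rel n)"
    by (auto simp: refl_on_def phase_rel_def intro!: exI[of _ 1])
  show "sym (phase_rel n)"
  proof (rule symI)
    fix U V assume "(U, V) \<in> phase_rel n"
    then obtain z where z: "U \<in> clifford_group n" "V \<in> clifford_group n" "cmod z = 1" "V = z \<cdot>\<^sub>m U"
      by (auto simp: phase_rel_def)
    then have "z \<noteq> 0" by auto
    then have "U = inverse z \<cdot>\<^sub>m V" "cmod (inverse z) = 1" using z by (auto simp: norm_inverse)
    then show "(V, U) \<in> phase_rel n" using z unfolding phase_rel_def by blast
  qed
  show "trans (phase_rel n)"
  proof (rule transI)
    fix U V W assume "(U, V) \<in> phase_rel n" "(V, W) \<in> phase_rel n"
    then obtain z y where z: "U \<in> clifford_group n" "W \<in> clifford_group n" "cmod z = 1" "V = z \<cdot>\<^sub>m U"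
       "cmod y = 1" "W = y \<cdot>\<^sub>m V"
      by (auto simp: phase_rel_def)
    then have "W = (y * z) \<cdot>\<^sub>m U" "cmod (y * z) = 1" by (auto simp: norm_mult)
    then show "(U, W) \<in> phase_rel n" using z unfolding phase_rel_def by blast
  qed
qed

definition clifford_classes :: "nat \<Rightarrow> complex mat set set" where
  "clifford_classes n = clifford_group n // phase_rel n"

definition representative :: "'a set \<Rightarrow> 'a" where
  "representative Q = (SOME U. U \<in> Q)"

text \<open>The expectation over \<open>random_clifford\<close>, with the same choice of
  representatives. It is polymorphic because it serves both real masses and complex fourth
  moments.\<close>

definition cl_avg :: "nat \<Rightarrow> (complex mat \<Rightarrow> 'a :: real_normed_field) \<Rightarrow> 'a" where
  "cl_avg n f = (\<Sum>Q\<in>clifford_classes n. f (representative Q)) / of_nat (card (clifford_classes n))"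

lemma representative_in: "Q \<in> clifford_classes n \<Longrightarrow> representative Q \<in> Q"
  unfolding clifford_classes_def representative_def
  using in_quotient_imp_non_empty[OF phase_rel_equiv] by (metis some_in_eq)

lemma representative_clifford: "Q \<in> clifford_classes n \<Longrightarrow> representative Q \<in> clifford_group n"
  using representative_in in_quotient_imp_subset[OF phase_rel_equiv] unfolding clifford_classes_def by blast

lemma clifford_classes_eqI:
  assumes "Q \<in> clifford_classes n" "Q' \<in> clifford_classes n"
    and "cmod z = 1" "representative Q' = z \<cdot>\<^sub>m representative Q"
  shows "Q = Q'"
proof -
  have "(representative Q, representative Q') \<in> phase_rel n"
    using assms(3,4) representative_clifford[OF assms(1)] representative_clifford[OF assms(2)]
    unfolding phase_rel_def by blast
  then show ?thesis
    using quotient_eqI[OF phase_rel_equiv] assms representative_in unfolding clifford_classes_def by blast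
qed

text \<open>A matrix commuting with every Pauli string is a scalar, since by completeness averaging
  \<open>P M P\<close> over the strings gives a multiple of the identity.\<close>

lemma commuting_with_strings_scalar:
  assumes M: "M \<in> carrier_mat (2 ^ n) (2 ^ n)"
    and c: "\<And>Ps. Ps \<in> strings n paulis \<Longrightarrow> kron_list Ps * M = M * kron_list Ps"
  shows "\<exists>z. M = z \<cdot>\<^sub>m 1\<^sub>m (2 ^ n)"
proof -
  let ?d = "2 ^ n :: nat" and ?S = "strings n paulis"
  have cS: "of_nat (card ?S) \<noteq> (0 :: complex)"
    using strings_one(1)[of n] by (auto simp: card_eq_0_iff)
  have *: "of_nat (card ?S) * M $$ (i, l) = (if i = l then ?d * (\<Sum>j<?d. M $$ (j, j)) else 0)"
    if il: "i < ?d" "l < ?d" for i l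
  proof -
    have "of_nat (card ?S) * M $$ (i, l) = (\<Sum>Ps\<in>?S. M $$ (i, l))" by simp
    also have "\<dots> = (\<Sum>Ps\<in>?S. \<Sum>k<?d. \<Sum>j<?d. kron_list Ps $$ (i, j) * kron_list Ps $$ (k, l) * M $$ (j, k))"
    proof (rule sum.cong[OF refl])
      fix Ps assume Ps: "Ps \<in> ?S"
      let ?P = "kron_list Ps"
      note P = strings_carrier[OF Ps]
      have "M = M * (?P * ?P)" using M strings_square[OF Ps] by simp
      also have "\<dots> = ?P * M * ?P" using M P c[OF Ps] by (simp add: assoc_mult_mat[of _ ?d ?d _ ?d _ ?d])
      finally have "M $$ (i, l) = (?P * M * ?P) $$ (i, l)" by simp
      also have "\<dots> = (\<Sum>k<?d. (?P * M) $$ (i, k) * ?P $$ (k, l))"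
        using P M il by (intro index_mult_mat_sum) auto
      also have "\<dots> = (\<Sum>k<?d. \<Sum>j<?d. ?P $$ (i, j) * ?P $$ (k, l) * M $$ (j, k))"
      proof (rule sum.cong[OF refl])
        fix k assume "k \<in> {..<?d}"
        then have "(?P * M) $$ (i, k) = (\<Sum>j<?d. ?P $$ (i, j) * M $$ (j, k))"
          using P M il by (intro index_mult_mat_sum) auto
        then show "(?P * M) $$ (i, k) * ?P $$ (k, l) = (\<Sum>j<?d. ?P $$ (i, j) * ?P $$ (k, l) * M $$ (j, k))"
          by (simp add: sum_distrib_left mult_ac)
      qed
      finally show "M $$ (i, l) = (\<Sum>k<?d. \<Sum>j<?d. ?P $$ (i, j) * ?P $$ (k, l) * M $$ (j, k))" .
    qed
    also have "\<dots> = (\<Sum>k<?d. \<Sum>j<?d. (\<Sum>Ps\<in>?S. kron_list Ps $$ (i, j) * kron_list Ps $$ (k, l)) * M $$ (j, k))"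
      by (subst sum.swap, intro sum.cong refl, subst sum.swap) (simp only: sum_distrib_right)
    also have "\<dots> = (\<Sum>k<?d. \<Sum>j<?d. if j = k then (if i = l then ?d * M $$ (k, k) else 0) else 0)"
      using il by (intro sum.cong refl) (auto simp: strings_completeness)
    also have "\<dots> = (if i = l then ?d * (\<Sum>j<?d. M $$ (j, j)) else 0)"
      by (simp add: sum_distrib_left)
    finally show ?thesis .
  qed
  define z where "z = ?d * (\<Sum>j<?d. M $$ (j, j)) / of_nat (card ?S)"
  have "M $$ (i, l) = (if i = l then z else 0)"
    if "i < ?d" "l < ?d" for i l
  proof -
    have "M $$ (i, l) = of_nat (card ?S) * M $$ (i, l) / of_nat (card ?S)" using cS by simp
    then show ?thesis unfolding *[OF that] by (simp add: z_def)
  qed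
  then show ?thesis
    using M by (intro exI[of _ z] eq_matI) auto
qed

text \<open>A class is determined by its conjugation action on the finite Pauli group: if
  \<open>U\<close> and \<open>V\<close> act alike, then \<open>mat_adjoint U * V\<close> commutes
  with all strings, hence is a scalar, and by unitarity a phase.\<close>

lemma finite_clifford_classes: "finite (clifford_classes n)"
proof (rule inj_on_finite)
  let ?d = "2 ^ n :: nat"
  let ?act = "\<lambda>Q. \<lambda>P\<in>pauli_group n. representative Q * P * mat_adjoint (representative Q)"
  show "finite (pauli_group n \<rightarrow>\<^sub>E pauli_group n)" by (intro finite_PiE pauli_group_finite)
  show "?act ` clifford_classes n \<subseteq> pauli_group n \<rightarrow>\<^sub>E pauli_group n"
    using clifford_groupD(3)[OF representative_clifford] by auto
  show "inj_on ?act (clifford_classes n)"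
  proof (rule inj_onI)
    fix Q Q' assume Q: "Q \<in> clifford_classes n" "Q' \<in> clifford_classes n" and eq: "?act Q = ?act Q'"
    define U V where "U = representative Q" and "V = representative Q'"
    have U: "U \<in> unitary_group ?d" and V: "V \<in> unitary_group ?d"
      using clifford_groupD(1) representative_clifford Q by (auto simp: U_def V_def)
    note u = unitary_groupD[OF U] and v = unitary_groupD[OF V]
    define M where "M = mat_adjoint U * V"
    have M: "M \<in> unitary_group ?d" unfolding M_def by (intro unitary_group_mult unitary_group_adjoint U V)
    have "kron_list Ps * M = M * kron_list Ps" if Ps: "Ps \<in> strings n paulis" for Ps
    proof -
      let ?P = "kron_list Ps"
      note P = strings_carrier[OF Ps]
      have "U * ?P * mat_adjoint U = V * ?P * mat_adjoint V"
        using fun_cong[OF eq, of ?P] strings_pauli_group[OF Ps] by (simp add: U_def V_def)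
      then have "mat_adjoint U * (U * ?P * mat_adjoint U) * V = mat_adjoint U * (V * ?P * mat_adjoint V) * V" by simp
      then show ?thesis
        using P u(1) v(1,3) unitary_cancel(1)[OF U, of _ ?d]
        by (simp add: M_def assoc_mult_mat[of _ ?d ?d _ ?d _ ?d])
    qed
    from commuting_with_strings_scalar[OF unitary_groupD(1)[OF M] this]
    obtain z where z: "M = z \<cdot>\<^sub>m 1\<^sub>m ?d" by auto
    have "(\<Sum>k<?d. cnj (M $$ (k, 0)) * M $$ (k, 0)) = 1"
      using unitary_col_orthonormal[OF M, of 0 0] by simp
    moreover have "(\<Sum>k<?d. cnj (M $$ (k, 0)) * M $$ (k, 0)) = (\<Sum>k<?d. if k = 0 then cnj z * z else 0)"
      by (rule sum.cong) (auto simp: z)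
    ultimately have "cnj z * z = 1" by simp
    then have "cmod z = 1"
      using complex_mod_mult_cnj[of z] by (simp add: mult.commute power2_eq_1_iff) (smt (verit) norm_ge_zero)
    moreover have "V = z \<cdot>\<^sub>m U"
    proof -
      have "V = U * M" using unitary_cancel(2)[OF U v(1)] by (simp add: M_def)
      also have "\<dots> = z \<cdot>\<^sub>m U" using u by (simp add: z mult_smult_distrib[of _ ?d ?d _ ?d])
      finally show ?thesis .
    qed
    ultimately show "Q = Q'" using clifford_classes_eqI[OF Q] by (simp add: U_def V_def)
  qed
qed

lemma clifford_classes_nonempty: "clifford_classes n \<noteq> {}"
  using one_clifford_group[of n] quotientI[of _ "clifford_group n" "phase_rel n"] unfolding clifford_classes_def by blast

lemma card_clifford_classes_pos: "0 < card (clifford_classes n)"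
  using finite_clifford_classes clifford_classes_nonempty by (simp add: card_gt_0_iff)

lemma cl_avg_cong: "(\<And>U. U \<in> clifford_group n \<Longrightarrow> f U = g U) \<Longrightarrow> cl_avg n f = cl_avg n g"
  unfolding cl_avg_def by (auto intro!: sum.cong arg_cong2[of _ _ _ _ "(/)"] representative_clifford)

lemma cl_avg_sum: "cl_avg n (\<lambda>U. \<Sum>i\<in>I. f i U) = (\<Sum>i\<in>I. cl_avg n (f i))"
  unfolding cl_avg_def by (subst sum.swap) (simp add: sum_divide_distrib)

lemma cl_avg_cmult: "cl_avg n (\<lambda>U. c * f U) = c * cl_avg n f"
  unfolding cl_avg_def by (simp add: sum_distrib_left[symmetric])

lemma cl_avg_add: "cl_avg n (\<lambda>U. f U + g U) = cl_avg n f + cl_avg n g"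
  unfolding cl_avg_def by (simp add: sum.distrib add_divide_distrib)

lemma cl_avg_const: "cl_avg n (\<lambda>U. c) = c"
  unfolding cl_avg_def using card_clifford_classes_pos[of n] by simp

lemma cl_avg_of_real: "cl_avg n (\<lambda>U. complex_of_real (f U)) = of_real (cl_avg n f)"
  unfolding cl_avg_def by simp

lemma cl_avg_mono: "(\<And>U. U \<in> clifford_group n \<Longrightarrow> f U \<le> g U) \<Longrightarrow> cl_avg n f \<le> (cl_avg n g :: real)"
  unfolding cl_avg_def by (intro divide_right_mono sum_mono) (auto intro!: representative_clifford)

text \<open>Left multiplication by \<open>G\<close> is an injective, hence bijective, map of the
  finite set of classes. The representative of the class of \<open>G * U\<close> agrees with
  \<open>G * U\<close> only up to a phase, which is why \<open>f\<close> has to be phase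
  invariant.\<close>

lemma cl_avg_left_mult:
  assumes G: "G \<in> clifford_group n"
    and f: "\<And>U z. U \<in> clifford_group n \<Longrightarrow> cmod z = 1 \<Longrightarrow> f (z \<cdot>\<^sub>m U) = f U"
  shows "cl_avg n (\<lambda>U. f (G * U)) = cl_avg n f"
proof -
  let ?d = "2 ^ n :: nat"
  define m where "m Q = phase_rel n `` {G * representative Q}" for Q
  have GQ: "G * representative Q \<in> clifford_group n" if "Q \<in> clifford_classes n" for Q
    using clifford_group_mult[OF G representative_clifford[OF that]] .
  have mQ: "m Q \<in> clifford_classes n" if "Q \<in> clifford_classes n" for Q
    using GQ[OF that] unfolding m_def clifford_classes_def by (rule quotientI)
  have fm: "f (representative (m Q)) = f (G * representative Q)" if Q: "Q \<in> clifford_classes n" for Q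
  proof -
    have "representative (m Q) \<in> m Q" by (rule representative_in[OF mQ[OF Q]])
    then obtain z where "cmod z = 1" "representative (m Q) = z \<cdot>\<^sub>m (G * representative Q)"
      by (auto simp: m_def phase_rel_def)
    then show ?thesis using f[OF GQ[OF Q]] by simp
  qed
  have inj: "inj_on m (clifford_classes n)"
  proof (rule inj_onI)
    fix Q Q' assume Q: "Q \<in> clifford_classes n" "Q' \<in> clifford_classes n" and eq: "m Q = m Q'"
    let ?U = "representative Q" and ?V = "representative Q'"
    have "(G * ?U, G * ?V) \<in> phase_rel n"
      using eq_equiv_class[OF _ phase_rel_equiv] eq GQ Q unfolding m_def by blast
    then obtain z where z: "cmod z = 1" "G * ?V = z \<cdot>\<^sub>m (G * ?U)" by (auto simp: phase_rel_def)
    note g = unitary_groupD[OF clifford_groupD(1)[OF G]]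
    note u = clifford_groupD(2)[OF representative_clifford[OF Q(1)]]
    note v = clifford_groupD(2)[OF representative_clifford[OF Q(2)]]
    have "?V = mat_adjoint G * (G * ?V)"
      using unitary_cancel(1)[OF clifford_groupD(1)[OF G] v] by simp
    also have "\<dots> = mat_adjoint G * (z \<cdot>\<^sub>m (G * ?U))" by (simp only: z)
    also have "\<dots> = z \<cdot>\<^sub>m (mat_adjoint G * (G * ?U))"
      using g u by (intro mult_smult_distrib[of _ ?d ?d _ ?d]) auto
    also have "mat_adjoint G * (G * ?U) = ?U"
      by (rule unitary_cancel(1)[OF clifford_groupD(1)[OF G] u])
    finally show "Q = Q'" by (rule clifford_classes_eqI[OF Q z(1)])
  qed
  have "m ` clifford_classes n = clifford_classes n"
    using mQ by (intro endo_inj_surj finite_clifford_classes inj) auto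
  then have "(\<Sum>Q\<in>clifford_classes n. f (representative Q)) = (\<Sum>Q\<in>m ` clifford_classes n. f (representative Q))" by simp
  also have "\<dots> = (\<Sum>Q\<in>clifford_classes n. f (G * representative Q))"
    by (subst sum.reindex[OF inj]) (auto simp: fm)
  finally show ?thesis unfolding cl_avg_def by simp
qed

lemma square_mult_assoc:
  "A \<in> carrier_mat d d \<Longrightarrow> B \<in> carrier_mat d d \<Longrightarrow> C \<in> carrier_mat d d \<Longrightarrow> A * B * C = A * (B * C)"
  by (rule assoc_mult_mat)

lemma square_mult_smult:
  fixes A :: "complex mat"
  assumes "A \<in> carrier_mat d d" "B \<in> carrier_mat d d"
  shows "(c \<cdot>\<^sub>m A) * B = c \<cdot>\<^sub>m (A * B)" "A * (c \<cdot>\<^sub>m B) = c \<cdot>\<^sub>m (A * B)"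
  using assms by (auto intro: mult_smult_assoc_mat mult_smult_distrib)

text \<open>For anticommuting Hermitian Pauli strings \<open>A\<close>, \<open>B\<close> the matrix \<open>(A + B) / \<surd>2\<close> is a Clifford
  unitary that exchanges them.\<close>

locale anticommuting_strings =
  fixes n :: nat and Ps Qs :: "complex mat list" and A B G :: "complex mat" and d :: nat
  assumes Ps: "Ps \<in> strings n paulis" and Qs: "Qs \<in> strings n paulis"
    and anti: "kron_list Ps * kron_list Qs = (- 1) \<cdot>\<^sub>m (kron_list Qs * kron_list Ps)"
  defines "A \<equiv> kron_list Ps" and "B \<equiv> kron_list Qs" and "d \<equiv> 2 ^ n"
    and "G \<equiv> of_real (1 / sqrt 2) \<cdot>\<^sub>m (kron_list Ps + kron_list Qs)"
begin

lemma carriers [simp]: "A \<in> carrier_mat d d" "B \<in> carrier_mat d d" "G \<in> carrier_mat d d"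
  using strings_carrier[OF Ps] strings_carrier[OF Qs] by (auto simp: A_def B_def d_def G_def)

lemma dims [simp]: "dim_row A = d" "dim_col A = d" "dim_row B = d" "dim_col B = d"
  using carriers(1,2)[THEN carrier_matD(1)] carriers(1,2)[THEN carrier_matD(2)] by auto

lemma squares: "A * A = 1\<^sub>m d" "B * B = 1\<^sub>m d"
  using strings_square[OF Ps] strings_square[OF Qs] by (auto simp: A_def B_def d_def)

lemma BA: "B * A = (- 1) \<cdot>\<^sub>m (A * B)"
  using anti by (simp add: A_def B_def)

lemma G_eq: "G = of_real (1 / sqrt 2) \<cdot>\<^sub>m (A + B)"
  by (simp add: G_def A_def B_def)

text \<open>The coefficients \<open>a\<close> and \<open>b\<close> will be the signs that a third
  string picks up when it is moved past \<open>A\<close> and \<open>B\<close>.\<close>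

lemma sum_mult: "(A + B) * (a \<cdot>\<^sub>m A + b \<cdot>\<^sub>m B) = (a + b) \<cdot>\<^sub>m 1\<^sub>m d + (b - a) \<cdot>\<^sub>m (A * B)"
proof -
  have "(A + B) * (a \<cdot>\<^sub>m A + b \<cdot>\<^sub>m B) = (A * (a \<cdot>\<^sub>m A) + B * (a \<cdot>\<^sub>m A)) + (A * (b \<cdot>\<^sub>m B) + B * (b \<cdot>\<^sub>m B))"
    by (subst mult_add_distrib_mat[of _ d d _ d]) (auto simp: add_mult_distrib_mat[of _ d d _ _ d])
  also have "\<dots> = (a \<cdot>\<^sub>m 1\<^sub>m d + a \<cdot>\<^sub>m ((- 1) \<cdot>\<^sub>m (A * B))) + (b \<cdot>\<^sub>m (A * B) + b \<cdot>\<^sub>m 1\<^sub>m d)"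
    by (simp only: square_mult_smult[of _ d] carriers squares BA)
  also have "\<dots> = (a + b) \<cdot>\<^sub>m 1\<^sub>m d + (b - a) \<cdot>\<^sub>m (A * B)"
  proof (rule eq_matI, goal_cases)
    case (1 i j)
    then have "i < d" "j < d" using carriers by auto
    then show ?case by (auto simp: algebra_simps simp del: index_mult_mat(1))
  qed auto
  finally show ?thesis .
qed

lemma G_adjoint: "mat_adjoint G = G"
proof -
  have "mat_adjoint (A + B) = A + B"
  proof (rule eq_matI, goal_cases)
    case (1 i j)
    then have ij: "i < d" "j < d" using carriers by auto
    have "mat_adjoint A $$ (i, j) = A $$ (i, j)" "mat_adjoint B $$ (i, j) = B $$ (i, j)"
      using strings_adjoint[OF Ps] strings_adjoint[OF Qs] by (auto simp: A_def B_def)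
    then show ?case using ij by simp
  qed auto
  then show ?thesis unfolding G_eq mat_adjoint_smult by simp
qed

text \<open>When \<open>a\<close> and \<open>b\<close> are signs, equal ones leave only the multiple
  of \<open>S\<close> and opposite ones only the multiple of \<open>A * B * S\<close>. Either way a
  Pauli operator is mapped to a Pauli operator, which makes \<open>G\<close> Clifford.\<close>

lemma conjugate_string:
  assumes S: "S \<in> carrier_mat d d" and e: "S * A = a \<cdot>\<^sub>m (A * S)" "S * B = b \<cdot>\<^sub>m (B * S)"
  shows "G * S * G = ((a + b) / 2) \<cdot>\<^sub>m S + ((b - a) / 2) \<cdot>\<^sub>m (A * B * S)"
proof -
  have "G * S * G = (1 / 2) \<cdot>\<^sub>m ((A + B) * (S * (A + B)))"
    unfolding G_eq using S
    by (simp add: square_mult_smult[of _ d] square_mult_assoc[of _ d] of_real_mult[symmetric] del: of_real_mult)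
  also have "S * (A + B) = (a \<cdot>\<^sub>m A + b \<cdot>\<^sub>m B) * S"
    using S e by (simp add: mult_add_distrib_mat[of _ d d _ d] add_mult_distrib_mat[of _ d d _ _ d] square_mult_smult[of _ d])
  also have "(A + B) * \<dots> = ((a + b) \<cdot>\<^sub>m 1\<^sub>m d + (b - a) \<cdot>\<^sub>m (A * B)) * S"
    using S by (subst square_mult_assoc[of _ d, symmetric]) (auto simp: sum_mult)
  also have "\<dots> = (a + b) \<cdot>\<^sub>m S + (b - a) \<cdot>\<^sub>m (A * B * S)"
    using S by (simp add: add_mult_distrib_mat[of _ d d _ _ d] square_mult_smult[of _ d])
  finally show ?thesis
    using S by (simp add: add_smult_distrib_left_mat[of _ d d])
qed

lemma G_unitary: "G \<in> unitary_group d"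
proof (rule unitary_groupI)
  have "mat_adjoint G * G = (1 / 2) \<cdot>\<^sub>m ((A + B) * (A + B))"
    unfolding G_adjoint unfolding G_eq
    by (simp add: square_mult_smult[of _ d] of_real_mult[symmetric] del: of_real_mult)
  also have "(A + B) * (A + B) = 2 \<cdot>\<^sub>m 1\<^sub>m d"
    using sum_mult[of 1 1] by (auto intro!: eq_matI)
  finally show "mat_adjoint G * G = 1\<^sub>m d" by simp
qed simp

lemma G_clifford: "G \<in> clifford_group n"
proof -
  have "G * P * mat_adjoint G \<in> pauli_group n" if P0: "P \<in> pauli_group n" for P
  proof -
    obtain k Ss where P: "P = \<i> ^ k \<cdot>\<^sub>m kron_list Ss" and Ss: "Ss \<in> strings n paulis"
      using P0 unfolding pauli_group_eq by blast
    define S where "S = kron_list Ss"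
    have S: "S \<in> carrier_mat d d" using strings_carrier[OF Ss] by (simp add: S_def d_def)
    have pg: "A \<in> pauli_group n" "B \<in> pauli_group n" "S \<in> pauli_group n"
      using strings_pauli_group Ps Qs Ss by (auto simp: A_def B_def S_def)
    obtain a where a: "a \<in> {1, - 1}" "S * A = a \<cdot>\<^sub>m (A * S)"
      using strings_commute[OF Ss Ps] unfolding S_def A_def by (elim bexE)
    obtain b where b: "b \<in> {1, - 1}" "S * B = b \<cdot>\<^sub>m (B * S)"
      using strings_commute[OF Ss Qs] unfolding S_def B_def by (elim bexE)
    have ABS: "A * B * S \<in> pauli_group n" by (intro pauli_group_mult pg)
    have GSG: "G * S * G = ((a + b) / 2) \<cdot>\<^sub>m S + ((b - a) / 2) \<cdot>\<^sub>m (A * B * S)"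
      by (rule conjugate_string[OF S a(2) b(2)])
    consider "G * S * G = S" | "G * S * G = (- 1) \<cdot>\<^sub>m S" | "G * S * G = A * B * S" | "G * S * G = (- 1) \<cdot>\<^sub>m (A * B * S)"
    proof -
      have z: "X + 0 \<cdot>\<^sub>m Y = X" "0 \<cdot>\<^sub>m Y + X = X" if "X \<in> carrier_mat d d" "Y \<in> carrier_mat d d" for X Y :: "complex mat"
        using that by (auto intro!: eq_matI)
      have ABSc: "A * B * S \<in> carrier_mat d d" using S by simp
      show ?thesis using a(1) b(1) GSG that z S ABSc by auto
    qed
    then have "G * S * G \<in> pauli_group n"
      by cases (use pg(3) ABS pauli_group_minus in \<open>simp_all only:\<close>)
    then have "\<i> ^ k \<cdot>\<^sub>m (G * S * G) \<in> pauli_group n" by (rule pauli_group_phase)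
    also have "\<i> ^ k \<cdot>\<^sub>m (G * S * G) = G * P * mat_adjoint G"
      using S unfolding G_adjoint P S_def[symmetric] by (simp add: square_mult_smult[of _ d])
    finally show ?thesis .
  qed
  then show ?thesis using G_unitary by (auto simp: clifford_group_def d_def)
qed

text \<open>The case of \<open>S\<close> equal to \<open>A\<close> in the conjugation formula:
  \<open>A\<close> commutes with itself and anticommutes with \<open>B\<close>, so only the term
  with \<open>A * B * A\<close>, which is minus \<open>B\<close>, survives.\<close>

lemma G_exchange: "mat_adjoint G * A * G = B"
proof -
  have AB: "A * B = (- 1) \<cdot>\<^sub>m (B * A)" by (simp add: BA)
  have "G * A * G = ((1 + - 1) / 2) \<cdot>\<^sub>m A + ((- 1 - 1) / 2) \<cdot>\<^sub>m (A * B * A)"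
    by (rule conjugate_string) (auto simp: AB)
  also have "A * B * A = (- 1) \<cdot>\<^sub>m B"
    by (simp add: AB square_mult_smult[of _ d] square_mult_assoc[of _ d] squares)
  also have "((1 + - 1) / 2) \<cdot>\<^sub>m A + ((- 1 - 1) / 2) \<cdot>\<^sub>m ((- 1) \<cdot>\<^sub>m B) = B"
    by (rule eq_matI) (use carriers in auto)
  finally show ?thesis by (simp add: G_adjoint)
qed

end

section \<open>The Clifford group as a 2-design\<close>

abbreviation conj_pair :: "complex mat \<Rightarrow> complex mat \<Rightarrow> nat \<Rightarrow> nat \<Rightarrow> nat \<Rightarrow> nat \<Rightarrow> complex" where
  "conj_pair U P i j k l \<equiv> (mat_adjoint U * P * U) $$ (i, j) * (mat_adjoint U * P * U) $$ (k, l)"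

abbreviation row_quartic :: "complex mat \<Rightarrow> nat \<Rightarrow> nat \<Rightarrow> nat \<Rightarrow> nat \<Rightarrow> nat \<Rightarrow> complex" where
  "row_quartic U x i j k l \<equiv> cnj (U $$ (x, i)) * U $$ (x, j) * cnj (U $$ (x, k)) * U $$ (x, l)"

text \<open>An entry of the Clifford average of Q \<otimes> Q, where Q is \<open>P\<close>
  conjugated by the random unitary.\<close>

definition cl_moment :: "nat \<Rightarrow> complex mat \<Rightarrow> nat \<Rightarrow> nat \<Rightarrow> nat \<Rightarrow> nat \<Rightarrow> complex" where
  "cl_moment n P i j k l = cl_avg n (\<lambda>U. conj_pair U P i j k l)"

text \<open>Replacing \<open>U\<close> by \<open>G * U\<close> leaves the average unchanged and
  turns the first string into the second, because \<open>G\<close> exchanges them.\<close>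

lemma cl_moment_anticommuting:
  assumes "Ps \<in> strings n paulis" "Qs \<in> strings n paulis"
    and "kron_list Ps * kron_list Qs = (- 1) \<cdot>\<^sub>m (kron_list Qs * kron_list Ps)"
  shows "cl_moment n (kron_list Ps) = cl_moment n (kron_list Qs)"
proof (intro ext)
  fix i j k l
  define A B G where "A = kron_list Ps" and "B = kron_list Qs"
    and "G = complex_of_real (1 / sqrt 2) \<cdot>\<^sub>m (kron_list Ps + kron_list Qs)"
  interpret anticommuting_strings n Ps Qs A B G "2 ^ n"
    by unfold_locales (use assms in \<open>auto simp: A_def B_def G_def\<close>)
  define f where "f U = conj_pair U A i j k l" for U
  have f: "f (z \<cdot>\<^sub>m U) = f U" if U: "U \<in> clifford_group n" and z: "cmod z = 1" for U z
  proof -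
    note u = clifford_groupD(2)[OF U]
    have "mat_adjoint (z \<cdot>\<^sub>m U) * A * (z \<cdot>\<^sub>m U) = (z * cnj z) \<cdot>\<^sub>m (mat_adjoint U * A * U)"
      using u by (simp add: mat_adjoint_smult square_mult_smult[of _ "2 ^ n"])
    also have "z * cnj z = 1" using z complex_norm_square[of z] by simp
    finally show ?thesis by (simp add: f_def)
  qed
  have "f (G * U) = conj_pair U B i j k l"
    if U: "U \<in> clifford_group n" for U
  proof -
    note u = clifford_groupD(2)[OF U]
    have "mat_adjoint (G * U) * A * (G * U) = mat_adjoint U * (mat_adjoint G * A * G) * U"
      using u by (simp add: mat_adjoint_mult[of _ "2 ^ n" "2 ^ n" _ "2 ^ n"] square_mult_assoc[of _ "2 ^ n"])
    then show ?thesis unfolding f_def by (simp only: G_exchange)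
  qed
  then have "cl_moment n B i j k l = cl_avg n (\<lambda>U. f (G * U))"
    unfolding cl_moment_def by (intro cl_avg_cong) simp
  also have "\<dots> = cl_avg n f" by (rule cl_avg_left_mult[OF G_clifford f])
  also have "\<dots> = cl_moment n A i j k l" by (simp add: cl_moment_def f_def[abs_def])
  finally show "cl_moment n (kron_list Ps) i j k l = cl_moment n (kron_list Qs) i j k l"
    by (simp add: A_def B_def)
qed

text \<open>Choose anticommuting partners \<open>Ss\<close> of \<open>Ps\<close> and
  \<open>Ts\<close> of \<open>Rs\<close>. If neither serves both, then \<open>Ss\<close> commutes
  with \<open>Rs\<close> and \<open>Ts\<close> with \<open>Ps\<close>, and the product of the
  partners anticommutes with both.\<close>

lemma common_anticommuting_string:
  assumes P: "Ps \<in> strings n paulis" "Ps \<noteq> replicate n (1\<^sub>m 2)"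
    and R: "Rs \<in> strings n paulis" "Rs \<noteq> replicate n (1\<^sub>m 2)"
  obtains Qs where "Qs \<in> strings n paulis"
    "kron_list Ps * kron_list Qs = (- 1) \<cdot>\<^sub>m (kron_list Qs * kron_list Ps)"
    "kron_list Rs * kron_list Qs = (- 1) \<cdot>\<^sub>m (kron_list Qs * kron_list Rs)"
proof -
  let ?d = "2 ^ n :: nat"
  let ?anti = "\<lambda>Ps Qs. kron_list Ps * kron_list Qs = (- 1) \<cdot>\<^sub>m (kron_list Qs * kron_list Ps)"
  let ?com = "\<lambda>Ps Qs. kron_list Ps * kron_list Qs = kron_list Qs * kron_list Ps"
  have dich: "?anti Xs Ys \<or> ?com Xs Ys" if "Xs \<in> strings n paulis" "Ys \<in> strings n paulis" for Xs Ys
    using strings_commute[OF that] by auto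
  obtain Ss where S: "Ss \<in> strings n paulis" "?anti Ps Ss" using strings_anticommute[OF P] by blast
  obtain Ts where T: "Ts \<in> strings n paulis" "?anti Rs Ts" using strings_anticommute[OF R] by blast
  show ?thesis
  proof (cases "?anti Rs Ss \<or> ?anti Ps Ts")
    case True
    then show ?thesis using that S T by blast
  next
    case False
    then have c: "?com Rs Ss" "?com Ps Ts" using dich P R S T by blast+
    define p r s t where "p = kron_list Ps" and "r = kron_list Rs" and "s = kron_list Ss" and "t = kron_list Ts"
    have [simp]: "p \<in> carrier_mat ?d ?d" "r \<in> carrier_mat ?d ?d" "s \<in> carrier_mat ?d ?d" "t \<in> carrier_mat ?d ?d"
      using strings_carrier P R S T by (auto simp: p_def r_def s_def t_def)
    have e: "p * s = (- 1) \<cdot>\<^sub>m (s * p)" "r * t = (- 1) \<cdot>\<^sub>m (t * r)" "r * s = s * r" "p * t = t * p"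
      using S T c by (simp_all add: p_def r_def s_def t_def)
    obtain k Qs where Q: "Qs \<in> strings n paulis" "s * t = \<i> ^ k \<cdot>\<^sub>m kron_list Qs"
      using strings_mult[OF S(1) T(1)] by (auto simp: s_def t_def)
    define q where "q = kron_list Qs"
    have [simp]: "q \<in> carrier_mat ?d ?d" using strings_carrier[OF Q(1)] by (simp add: q_def)
    \<comment> \<open>The phase between the product and the string \<open>q\<close> does not affect
      commutation relations.\<close>
    have qst: "q = inverse (\<i> ^ k) \<cdot>\<^sub>m (s * t)" using Q by (simp add: q_def)
    have "p * (s * t) = p * s * t" by (simp add: square_mult_assoc[of _ ?d])
    also have "\<dots> = (- 1) \<cdot>\<^sub>m (s * (p * t))" unfolding e(1) by (simp add: square_mult_smult[of _ ?d] square_mult_assoc[of _ ?d])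
    also have "\<dots> = (- 1) \<cdot>\<^sub>m (s * t * p)" unfolding e(4) by (simp add: square_mult_assoc[of _ ?d])
    finally have 1: "p * q = (- 1) \<cdot>\<^sub>m (q * p)" unfolding qst by (simp add: square_mult_smult[of _ ?d])
    have "r * (s * t) = r * s * t" by (simp add: square_mult_assoc[of _ ?d])
    also have "\<dots> = s * (r * t)" unfolding e(3) by (simp add: square_mult_assoc[of _ ?d])
    also have "\<dots> = (- 1) \<cdot>\<^sub>m (s * t * r)" unfolding e(2) by (simp add: square_mult_smult[of _ ?d] square_mult_assoc[of _ ?d])
    finally have 2: "r * q = (- 1) \<cdot>\<^sub>m (q * r)" unfolding qst by (simp add: square_mult_smult[of _ ?d])
    show ?thesis using that[OF Q(1)] 1 2 by (simp add: p_def r_def q_def)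
  qed
qed

lemma cl_moment_transitive:
  assumes "Ps \<in> strings n paulis" "Ps \<noteq> replicate n (1\<^sub>m 2)"
    and "Rs \<in> strings n paulis" "Rs \<noteq> replicate n (1\<^sub>m 2)"
  shows "cl_moment n (kron_list Ps) = cl_moment n (kron_list Rs)"
proof -
  obtain Qs where "Qs \<in> strings n paulis"
    "kron_list Ps * kron_list Qs = (- 1) \<cdot>\<^sub>m (kron_list Qs * kron_list Ps)"
    "kron_list Rs * kron_list Qs = (- 1) \<cdot>\<^sub>m (kron_list Qs * kron_list Rs)"
    using common_anticommuting_string[OF assms] by blast
  then show ?thesis using cl_moment_anticommuting assms by metis
qed

lemma conjugation_index:
  assumes "U \<in> carrier_mat d d" "P \<in> carrier_mat d d" "i < d" "j < d"
  shows "(mat_adjoint U * P * U) $$ (i, j) = (\<Sum>x<d. \<Sum>y<d. cnj (U $$ (x, i)) * P $$ (x, y) * U $$ (y, j))"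
proof -
  have "(mat_adjoint U * P * U) $$ (i, j) = (\<Sum>y<d. (mat_adjoint U * P) $$ (i, y) * U $$ (y, j))"
    using assms by (intro index_mult_mat_sum) auto
  also have "\<dots> = (\<Sum>y<d. \<Sum>x<d. cnj (U $$ (x, i)) * P $$ (x, y) * U $$ (y, j))"
    using assms by (intro sum.cong refl, subst index_mult_mat_sum[of _ d d _ d]) (auto simp: sum_distrib_right)
  finally show ?thesis by (subst sum.swap)
qed

lemma sum_product2:
  fixes f g :: "'a \<Rightarrow> 'a \<Rightarrow> 'b :: comm_semiring_0"
  shows "(\<Sum>x\<in>A. \<Sum>y\<in>A. f x y) * (\<Sum>z\<in>A. \<Sum>w\<in>A. g z w) =
    (\<Sum>x\<in>A. \<Sum>y\<in>A. \<Sum>z\<in>A. \<Sum>w\<in>A. f x y * g z w)"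
  by (simp only: sum_distrib_right) (simp only: sum_distrib_left)

lemma sum_swap4:
  "(\<Sum>p\<in>S. \<Sum>x\<in>A. \<Sum>y\<in>A. \<Sum>z\<in>A. \<Sum>w\<in>A. f p x y z w) =
    (\<Sum>x\<in>A. \<Sum>y\<in>A. \<Sum>z\<in>A. \<Sum>w\<in>A. \<Sum>p\<in>S. f p x y z w)"
  by (rule trans[OF sum.swap], rule sum.cong[OF refl])+ (rule refl)

lemma sum_strings_conjugation:
  assumes "U \<in> carrier_mat d d" "\<And>Ps. Ps \<in> S \<Longrightarrow> kron_list Ps \<in> carrier_mat d d"
    and "i < d" "j < d" "k < d" "l < d"
  shows "(\<Sum>Ps\<in>S. conj_pair U (kron_list Ps) i j k l) =
    (\<Sum>x<d. \<Sum>y<d. \<Sum>z<d. \<Sum>w<d. cnj (U $$ (x, i)) * U $$ (y, j) * cnj (U $$ (z, k)) * U $$ (w, l) *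
      (\<Sum>Ps\<in>S. kron_list Ps $$ (x, y) * kron_list Ps $$ (z, w)))"
proof -
  have "(\<Sum>Ps\<in>S. conj_pair U (kron_list Ps) i j k l) =
    (\<Sum>Ps\<in>S. \<Sum>x<d. \<Sum>y<d. \<Sum>z<d. \<Sum>w<d. cnj (U $$ (x, i)) * U $$ (y, j) * cnj (U $$ (z, k)) * U $$ (w, l) *
      (kron_list Ps $$ (x, y) * kron_list Ps $$ (z, w)))"
    using assms by (intro sum.cong refl)
      (simp add: conjugation_index sum_product2 mult_ac del: index_mult_mat(1))
  also have "\<dots> = (\<Sum>x<d. \<Sum>y<d. \<Sum>z<d. \<Sum>w<d. \<Sum>Ps\<in>S. cnj (U $$ (x, i)) * U $$ (y, j) * cnj (U $$ (z, k)) * U $$ (w, l) *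
      (kron_list Ps $$ (x, y) * kron_list Ps $$ (z, w)))"
    by (rule sum_swap4)
  finally show ?thesis by (simp only: sum_distrib_left)
qed

text \<open>The tensor squares of all strings sum to a multiple of the swap, which is invariant
  under conjugation by U \<otimes> U. The identity therefore holds for each unitary, without any
  averaging.\<close>

lemma unitary_string_average:
  assumes U: "U \<in> unitary_group (2 ^ n)" and ij: "i < 2 ^ n" "j < 2 ^ n" "k < 2 ^ n" "l < 2 ^ n"
  shows "(\<Sum>Ps\<in>strings n paulis. conj_pair U (kron_list Ps) i j k l)
    = (if i = l \<and> j = k then 2 ^ n else 0)"
proof -
  let ?d = "2 ^ n :: nat"
  note u = unitary_groupD[OF U]
  have "(\<Sum>Ps\<in>strings n paulis. conj_pair U (kron_list Ps) i j k l)
    = (\<Sum>x<?d. \<Sum>y<?d. \<Sum>z<?d. \<Sum>w<?d. cnj (U $$ (x, i)) * U $$ (y, j) * cnj (U $$ (z, k)) * U $$ (w, l) *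
      (\<Sum>Ps\<in>strings n paulis. kron_list Ps $$ (x, y) * kron_list Ps $$ (z, w)))"
    by (rule sum_strings_conjugation[OF u(1) _ ij]) (rule strings_carrier)
  also have "\<dots> = (\<Sum>x<?d. \<Sum>y<?d. \<Sum>z<?d. \<Sum>w<?d. cnj (U $$ (x, i)) * U $$ (y, j) * cnj (U $$ (z, k)) * U $$ (w, l) *
      (if x = w \<and> y = z then 2 ^ n else 0))"
    by (intro sum.cong refl) (simp add: strings_completeness)
  also have "\<dots> = (\<Sum>x<?d. \<Sum>y<?d. \<Sum>z<?d. if z = y then cnj (U $$ (x, i)) * U $$ (y, j) * cnj (U $$ (y, k)) * U $$ (x, l) * 2 ^ n else 0)"
  proof (intro sum.cong refl, goal_cases)
    case (1 x y z)
    have "(\<Sum>w<?d. cnj (U $$ (x, i)) * U $$ (y, j) * cnj (U $$ (z, k)) * U $$ (w, l) * (if x = w \<and> y = z then 2 ^ n else 0))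
      = (\<Sum>w<?d. if w = x then (if z = y then cnj (U $$ (x, i)) * U $$ (y, j) * cnj (U $$ (y, k)) * U $$ (x, l) * 2 ^ n else 0) else 0)"
      by (rule sum.cong) auto
    then show ?case using 1 by simp
  qed
  also have "\<dots> = (\<Sum>x<?d. \<Sum>y<?d. 2 ^ n * ((cnj (U $$ (x, i)) * U $$ (x, l)) * (cnj (U $$ (y, k)) * U $$ (y, j))))"
    by (intro sum.cong refl) (simp add: mult_ac)
  also have "\<dots> = 2 ^ n * ((\<Sum>x<?d. cnj (U $$ (x, i)) * U $$ (x, l)) * (\<Sum>y<?d. cnj (U $$ (y, k)) * U $$ (y, j)))"
    by (simp only: sum_product) (simp only: sum_distrib_left)
  also have "\<dots> = (if i = l \<and> j = k then 2 ^ n else 0)"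
    using ij by (auto simp: unitary_col_orthonormal[OF U])
  finally show ?thesis .
qed

lemma cl_moment_one:
  assumes "i < 2 ^ n" "j < 2 ^ n" "k < 2 ^ n" "l < 2 ^ n"
  shows "cl_moment n (1\<^sub>m (2 ^ n)) i j k l = (if i = j \<and> k = l then 1 else 0)"
proof -
  have "cl_moment n (1\<^sub>m (2 ^ n)) i j k l = cl_avg n (\<lambda>U. if i = j \<and> k = l then 1 else 0)"
    unfolding cl_moment_def
  proof (rule cl_avg_cong)
    fix U assume "U \<in> clifford_group n"
    note u = unitary_groupD[OF clifford_groupD(1)[OF this]]
    have "mat_adjoint U * 1\<^sub>m (2 ^ n) * U = 1\<^sub>m (2 ^ n)" using u by simp
    then show "conj_pair U (1\<^sub>m (2 ^ n)) i j k l =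
       (if i = j \<and> k = l then 1 else 0)" using assms by (simp del: index_mult_mat(1))
  qed
  then show ?thesis by (simp add: cl_avg_const)
qed

text \<open>The total over all strings and the contribution of the identity are both known, and the
  other \<open>4 ^ n - 1\<close> strings share the remainder equally.\<close>

lemma cl_moment_string:
  assumes Qs: "Qs \<in> strings n paulis" "Qs \<noteq> replicate n (1\<^sub>m 2)"
    and ij: "i < 2 ^ n" "j < 2 ^ n" "k < 2 ^ n" "l < 2 ^ n"
  shows "(4 ^ n - 1) * cl_moment n (kron_list Qs) i j k l =
    (if i = l \<and> j = k then 2 ^ n else 0) - (if i = j \<and> k = l then 1 else 0)"
proof -
  let ?S = "strings n paulis" and ?I = "replicate n (1\<^sub>m 2) :: complex mat list"
  have "card paulis = 4" using pauli_distinct unfolding paulis_def by simp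
  then have card: "of_nat (card (?S - {?I})) = (4 ^ n - 1 :: complex)"
    using strings_one(1)[of n] by (simp add: card_Diff_singleton card_strings of_nat_diff)
  have "(\<Sum>Ps\<in>?S. cl_moment n (kron_list Ps) i j k l) = (if i = l \<and> j = k then 2 ^ n else 0)"
    unfolding cl_moment_def cl_avg_sum[symmetric]
    by (subst cl_avg_cong[where g = "\<lambda>U. if i = l \<and> j = k then 2 ^ n else 0"])
       (auto simp: unitary_string_average[OF clifford_groupD(1) ij] cl_avg_const simp del: index_mult_mat(1))
  moreover have "(\<Sum>Ps\<in>?S. cl_moment n (kron_list Ps) i j k l) =
     cl_moment n (kron_list ?I) i j k l + (\<Sum>Ps\<in>?S - {?I}. cl_moment n (kron_list Ps) i j k l)"
    using strings_one(1)[of n] by (intro sum.remove) auto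
  moreover have "(\<Sum>Ps\<in>?S - {?I}. cl_moment n (kron_list Ps) i j k l) = (\<Sum>Ps\<in>?S - {?I}. cl_moment n (kron_list Qs) i j k l)"
    using cl_moment_transitive[OF _ _ Qs] by (intro sum.cong refl) auto
  ultimately show ?thesis
    using cl_moment_one[OF ij] strings_one(2)[of n] card by (simp add: algebra_simps)
qed

lemma sum_diagonal3:
  fixes F :: "'a \<Rightarrow> 'a \<Rightarrow> 'a \<Rightarrow> complex"
  assumes "finite A" "x \<in> A"
  shows "(\<Sum>y\<in>A. \<Sum>z\<in>A. \<Sum>w\<in>A. F y z w * (if x = y \<and> y = z \<and> z = w then c else 0)) = c * F x x x"
proof -
  have "(\<Sum>w\<in>A. F y z w * (if x = y \<and> y = z \<and> z = w then c else 0)) =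
      (if z = x then if y = x then c * F x x x else 0 else 0)" for y z
  proof (cases "y = x \<and> z = x")
    case True
    have "(\<Sum>w\<in>A. F x x w * (if x = x \<and> x = x \<and> x = w then c else 0)) = (\<Sum>w\<in>A. if w = x then c * F x x x else 0)"
      by (intro sum.cong) auto
    also have "\<dots> = c * F x x x" using assms by simp
    finally show ?thesis by (simp only: True refl if_True)
  next
    case False
    then have "(\<Sum>w\<in>A. F y z w * (if x = y \<and> y = z \<and> z = w then c else 0)) = 0"
      by (intro sum.neutral) auto
    then show ?thesis using False by (auto simp only: if_False if_True split: if_splits)
  qed
  then show ?thesis using assms by simp
qed

text \<open>The sum over \<open>x\<close> is, up to the factor \<open>2 ^ n\<close>, the sum of
  \<open>conj_pair\<close> over the diagonal strings: one identity term and \<open>2 ^ n - 1\<close>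
  equal terms. The outcome is the Haar value, identity plus swap divided by d + 1.\<close>

lemma clifford_fourth_moment:
  assumes ij: "i < 2 ^ n" "j < 2 ^ n" "k < 2 ^ n" "l < 2 ^ n"
  shows "(2 ^ n + 1) * cl_avg n (\<lambda>U. \<Sum>x<2 ^ n. row_quartic U x i j k l)
    = (if i = j \<and> k = l then 1 else 0) + (if i = l \<and> j = k then 1 else 0)"
proof -
  let ?d = "2 ^ n :: nat" and ?Z = "strings n {1\<^sub>m 2, pauli_Z}" and ?I = "replicate n (1\<^sub>m 2) :: complex mat list"
  define p q :: complex where "p = (if i = j \<and> k = l then 1 else 0)" and "q = (if i = l \<and> j = k then 1 else 0)"
  define T where "T = (\<Sum>Ps\<in>?Z. cl_moment n (kron_list Ps) i j k l)"
  have sub: "?Z \<subseteq> strings n paulis" by (auto simp: strings_def paulis_def)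
  have IZ: "?I \<in> ?Z" by (auto simp: strings_def)
  have fZ: "finite ?Z" by simp
  have "(\<Sum>Ps\<in>?Z. conj_pair U (kron_list Ps) i j k l) =
    2 ^ n * (\<Sum>x<?d. row_quartic U x i j k l)"
    if U: "U \<in> clifford_group n" for U
  proof -
    have "(\<Sum>Ps\<in>?Z. conj_pair U (kron_list Ps) i j k l)
      = (\<Sum>x<?d. \<Sum>y<?d. \<Sum>z<?d. \<Sum>w<?d. cnj (U $$ (x, i)) * U $$ (y, j) * cnj (U $$ (z, k)) * U $$ (w, l) *
        (\<Sum>Ps\<in>?Z. kron_list Ps $$ (x, y) * kron_list Ps $$ (z, w)))"
      by (rule sum_strings_conjugation[OF clifford_groupD(2)[OF U] _ ij]) (use sub in \<open>auto intro: strings_carrier\<close>)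
    also have "\<dots> = (\<Sum>x<?d. \<Sum>y<?d. \<Sum>z<?d. \<Sum>w<?d. cnj (U $$ (x, i)) * U $$ (y, j) * cnj (U $$ (z, k)) * U $$ (w, l) *
        (if x = y \<and> y = z \<and> z = w then 2 ^ n else 0))"
      by (intro sum.cong refl) (simp add: strings_diagonal_completeness)
    also have "\<dots> = (\<Sum>x<?d. 2 ^ n * row_quartic U x i j k l)"
      by (intro sum.cong refl, subst sum_diagonal3) auto
    finally show ?thesis by (simp only: sum_distrib_left)
  qed
  then have T1: "T = 2 ^ n * cl_avg n (\<lambda>U. \<Sum>x<?d. row_quartic U x i j k l)"
    unfolding T_def cl_moment_def cl_avg_sum[symmetric] cl_avg_cmult[symmetric] by (rule cl_avg_cong)
  have card: "of_nat (card (?Z - {?I})) = (2 ^ n - 1 :: complex)"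
    using IZ pauli_distinct(3) by (simp add: card_Diff_singleton card_strings of_nat_diff)
  \<comment> \<open>Used with D = \<open>2 ^ n\<close>: since D D - 1 = (D - 1) (D + 1), a common
    factor D - 1 is exposed for cancellation.\<close>
  have factor: "(D - 1) * ((D + 1) * x) = (D - 1) * (D * (y + z))"
    if "(D * D - 1) * x = (D * D - 1) * y + (D - 1) * (D * z - y)" for D x y z :: complex
  proof -
    have "(D - 1) * ((D + 1) * x) = (D * D - 1) * x" by (simp add: algebra_simps)
    also note that
    also have "(D * D - 1) * y + (D - 1) * (D * z - y) = (D - 1) * (D * (y + z))" by (simp add: algebra_simps)
    finally show ?thesis .
  qed
  have four: "(4 ^ n :: complex) = 2 ^ n * 2 ^ n" by (simp flip: power_mult_distrib)
  have "T = cl_moment n (kron_list ?I) i j k l + (\<Sum>Ps\<in>?Z - {?I}. cl_moment n (kron_list Ps) i j k l)"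
    unfolding T_def using IZ fZ by (intro sum.remove) auto
  then have "(4 ^ n - 1) * T = (4 ^ n - 1) * cl_moment n (kron_list ?I) i j k l +
      (\<Sum>Ps\<in>?Z - {?I}. (4 ^ n - 1) * cl_moment n (kron_list Ps) i j k l)"
    by (simp add: distrib_left sum_distrib_left)
  also have "(\<Sum>Ps\<in>?Z - {?I}. (4 ^ n - 1) * cl_moment n (kron_list Ps) i j k l) = (2 ^ n - 1) * (2 ^ n * q - p)"
    using sub by (subst sum.cong[OF refl cl_moment_string[OF _ _ ij]]) (auto simp: card p_def q_def)
  also have "cl_moment n (kron_list ?I) i j k l = p"
    using cl_moment_one[OF ij] strings_one(2)[of n] by (simp add: p_def)
  finally have "(2 ^ n * 2 ^ n - 1) * T = (2 ^ n * 2 ^ n - 1) * p + (2 ^ n - 1) * (2 ^ n * q - p)"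
    by (simp only: four)
  then have "(2 ^ n - 1) * ((2 ^ n + 1) * T) = (2 ^ n - 1) * (2 ^ n * (p + q))" by (rule factor)
  \<comment> \<open>For \<open>n = 0\<close> the factor \<open>2 ^ n - 1\<close> vanishes and cannot
    be cancelled, so this case is computed directly.\<close>
  moreover have "(2 ^ n + 1) * T = 2 ^ n * (p + q)" if n: "n = 0"
  proof -
    have "i = 0" "j = 0" "k = 0" "l = 0" using ij n by auto
    then show ?thesis using n cl_moment_one[of 0 0 0 0 0] by (simp add: T_def p_def q_def)
  qed
  moreover have "(2 ^ n - 1 :: complex) \<noteq> 0" if "n \<noteq> 0"
  proof
    assume "(2 ^ n - 1 :: complex) = 0"
    then have "of_nat (2 ^ n) = (of_nat 1 :: complex)" by simp
    then show False using that by (simp only: of_nat_eq_iff) simp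
  qed
  ultimately have "(2 ^ n + 1) * T = 2 ^ n * (p + q)"
    by (cases "n = 0") simp_all
  then have "2 ^ n * ((2 ^ n + 1) * cl_avg n (\<lambda>U. \<Sum>x<?d. row_quartic U x i j k l))
     = 2 ^ n * (p + q)"
    unfolding T1 by (simp only: mult.left_commute)
  then show ?thesis by (simp add: p_def q_def)
qed

text \<open>The left side is the mean weight of equal outcomes after U \<otimes> U acts on the
  two-register vector \<open>W\<close>. The fourth moment gives the squared norm of \<open>W\<close>
  plus the expectation of the swap, which is at most the same squared norm; the resulting
  denominator d + 1 is relaxed to d.\<close>

lemma clifford_pair_collision:
  fixes W :: "nat \<Rightarrow> nat \<Rightarrow> complex"
  shows "cl_avg n (\<lambda>U. \<Sum>x<2 ^ n. (cmod (\<Sum>a<2 ^ n. \<Sum>b<2 ^ n. U $$ (x, a) * U $$ (x, b) * W a b))\<^sup>2)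
    \<le> 2 / 2 ^ n * (\<Sum>a<2 ^ n. \<Sum>b<2 ^ n. (cmod (W a b))\<^sup>2)"
    (is "?L \<le> _ * ?N")
proof -
  let ?d = "2 ^ n :: nat"
  let ?M = "\<lambda>i j k l. cl_avg n (\<lambda>U. \<Sum>x<?d. row_quartic U x i j k l)"
  have "complex_of_real ?L = cl_avg n (\<lambda>U. \<Sum>a<?d. \<Sum>b<?d. \<Sum>a'<?d. \<Sum>b'<?d. (W a b * cnj (W a' b')) *
     (\<Sum>x<?d. row_quartic U x a' a b' b))"
    unfolding cl_avg_of_real[symmetric]
  proof (rule cl_avg_cong)
    fix U
    have "complex_of_real (\<Sum>x<?d. (cmod (\<Sum>a<?d. \<Sum>b<?d. U $$ (x, a) * U $$ (x, b) * W a b))\<^sup>2) =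
      (\<Sum>x<?d. (\<Sum>a<?d. \<Sum>b<?d. U $$ (x, a) * U $$ (x, b) * W a b) * (\<Sum>a<?d. \<Sum>b<?d. cnj (U $$ (x, a) * U $$ (x, b) * W a b)))"
      unfolding of_real_sum complex_norm_square cnj_sum ..
    also have "\<dots> = (\<Sum>x<?d. \<Sum>a<?d. \<Sum>b<?d. \<Sum>a'<?d. \<Sum>b'<?d. (W a b * cnj (W a' b')) *
       row_quartic U x a' a b' b)"
      unfolding sum_product2 by (intro sum.cong refl) (simp add: mult_ac)
    also have "\<dots> = (\<Sum>a<?d. \<Sum>b<?d. \<Sum>a'<?d. \<Sum>b'<?d. \<Sum>x<?d. (W a b * cnj (W a' b')) *
       row_quartic U x a' a b' b)"
      by (rule sum_swap4)
    finally show "complex_of_real (\<Sum>x<?d. (cmod (\<Sum>a<?d. \<Sum>b<?d. U $$ (x, a) * U $$ (x, b) * W a b))\<^sup>2) =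
      (\<Sum>a<?d. \<Sum>b<?d. \<Sum>a'<?d. \<Sum>b'<?d. (W a b * cnj (W a' b')) *
       (\<Sum>x<?d. row_quartic U x a' a b' b))"
      by (simp only: sum_distrib_left)
  qed
  also have "\<dots> = (\<Sum>a<?d. \<Sum>b<?d. \<Sum>a'<?d. \<Sum>b'<?d. (W a b * cnj (W a' b')) * ?M a' a b' b)"
    by (simp only: cl_avg_sum cl_avg_cmult)
  finally have "(2 ^ n + 1) * complex_of_real ?L = (2 ^ n + 1) * \<dots>" by simp
  also have "\<dots> = (\<Sum>a<?d. \<Sum>b<?d. \<Sum>a'<?d. \<Sum>b'<?d. (W a b * cnj (W a' b')) * ((2 ^ n + 1) * ?M a' a b' b))"
    by (simp only: sum_distrib_left mult.left_commute)
  also have "\<dots> = (\<Sum>a<?d. \<Sum>b<?d. \<Sum>a'<?d. \<Sum>b'<?d.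
      (if b' = b then if a' = a then W a b * cnj (W a b) else 0 else 0) + (if b' = a then if a' = b then W a b * cnj (W b a) else 0 else 0))"
  proof (intro sum.cong refl, goal_cases)
    case (1 a b a' b')
    then show ?case using clifford_fourth_moment[of a' n a b' b] by simp
  qed
  also have "\<dots> = (\<Sum>a<?d. \<Sum>b<?d. W a b * cnj (W a b)) + (\<Sum>a<?d. \<Sum>b<?d. W a b * cnj (W b a))"
    by (simp add: sum.distrib)
  also have "\<dots> = of_real ?N + (\<Sum>a<?d. \<Sum>b<?d. W a b * cnj (W b a))"
    by (simp only: of_real_sum complex_norm_square)
  finally have cx: "(2 ^ n + 1) * complex_of_real ?L = of_real ?N + (\<Sum>a<?d. \<Sum>b<?d. W a b * cnj (W b a))" .
  have "complex_of_real ((2 ^ n + 1) * ?L) = (2 ^ n + 1) * complex_of_real ?L"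
    unfolding of_real_mult by simp
  from arg_cong[OF trans[OF this cx], of Re]
  have eq: "(2 ^ n + 1) * ?L = ?N + (\<Sum>a<?d. \<Sum>b<?d. Re (W a b * cnj (W b a)))"
    by (simp only: Re_sum plus_complex.sel Re_complex_of_real)
  have "(\<Sum>a<?d. \<Sum>b<?d. Re (W a b * cnj (W b a))) \<le> (\<Sum>a<?d. \<Sum>b<?d. ((cmod (W a b))\<^sup>2 + (cmod (W b a))\<^sup>2) / 2)"
  proof (intro sum_mono)
    fix a b
    have "Re (W a b * cnj (W b a)) \<le> cmod (W a b) * cmod (W b a)"
      using complex_Re_le_cmod[of "W a b * cnj (W b a)"] by (simp add: norm_mult)
    then show "Re (W a b * cnj (W b a)) \<le> ((cmod (W a b))\<^sup>2 + (cmod (W b a))\<^sup>2) / 2"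
      using sum_squares_bound[of "cmod (W a b)" "cmod (W b a)"] by simp
  qed
  also have "\<dots> = (?N + (\<Sum>a<?d. \<Sum>b<?d. (cmod (W b a))\<^sup>2)) / 2"
    by (simp add: sum.distrib sum_divide_distrib add_divide_distrib)
  also have "(\<Sum>a<?d. \<Sum>b<?d. (cmod (W b a))\<^sup>2) = ?N" by (rule sum.swap)
  finally have "(2 ^ n + 1) * ?L \<le> 2 * ?N" using eq by simp
  moreover have "0 \<le> ?L" unfolding cl_avg_def by (intro divide_nonneg_nonneg sum_nonneg) auto
  ultimately have "2 ^ n * ?L \<le> 2 * ?N" by (simp add: algebra_simps)
  then show ?thesis by (simp add: field_simps)
qed

subsection \<open>Tensor powers as kernels on index functions\<close>

text \<open>Tuples are extensional functions on an arbitrary index set, so that two coordinates can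
  be split off without renumbering the others.\<close>

definition idx :: "'k set \<Rightarrow> nat \<Rightarrow> ('k \<Rightarrow> nat) set" where
  "idx I d = I \<rightarrow>\<^sub>E {..<d}"

text \<open>The matrix entries of the tensor power of \<open>U\<close> with one factor for each
  element of \<open>I\<close>.\<close>

definition tker :: "'k set \<Rightarrow> complex mat \<Rightarrow> ('k \<Rightarrow> nat) \<Rightarrow> ('k \<Rightarrow> nat) \<Rightarrow> complex" where
  "tker I U x y = (\<Prod>k\<in>I. U $$ (x k, y k))"

lemma finite_idx [simp]: "finite I \<Longrightarrow> finite (idx I d)"
  by (simp add: idx_def finite_PiE)

lemma idx_lt: "x \<in> idx I d \<Longrightarrow> k \<in> I \<Longrightarrow> x k < d"
  by (auto simp: idx_def)

lemma idx_eqI: "x \<in> idx I d \<Longrightarrow> y \<in> idx I d \<Longrightarrow> (\<And>k. k \<in> I \<Longrightarrow> x k = y k) \<Longrightarrow> x = y"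
  unfolding idx_def by (rule PiE_ext)

lemma tker_mult:
  assumes "finite I" "U \<in> carrier_mat d d" "V \<in> carrier_mat d d" "x \<in> idx I d" "z \<in> idx I d"
  shows "tker I (U * V) x z = (\<Sum>y\<in>idx I d. tker I U x y * tker I V y z)"
proof -
  have "tker I (U * V) x z = (\<Prod>k\<in>I. \<Sum>j<d. U $$ (x k, j) * V $$ (j, z k))"
    unfolding tker_def using assms idx_lt[of x I d] idx_lt[of z I d]
    by (intro prod.cong refl index_mult_mat_sum) auto
  also have "\<dots> = (\<Sum>y\<in>idx I d. \<Prod>k\<in>I. U $$ (x k, y k) * V $$ (y k, z k))"
    unfolding idx_def by (rule prod_sum_PiE) (use assms in auto)
  finally show ?thesis by (simp add: tker_def prod.distrib)
qed

lemma tker_one: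
  assumes "finite I" "x \<in> idx I d" "z \<in> idx I d"
  shows "tker I (1\<^sub>m d) x z = (if x = z then 1 else 0)"
proof (cases "x = z")
  case False
  then obtain k where "k \<in> I" "x k \<noteq> z k" using idx_eqI assms by metis
  then show ?thesis unfolding tker_def
    using assms idx_lt[of x I d k] idx_lt[of z I d k] False by (auto intro!: prod_zero bexI[of _ k])
next
  case True
  then show ?thesis unfolding tker_def using assms idx_lt[of x I d] by (auto intro!: prod.neutral)
qed

lemma tker_adjoint:
  assumes "U \<in> carrier_mat d d" "x \<in> idx I d" "z \<in> idx I d"
  shows "tker I (mat_adjoint U) x z = cnj (tker I U z x)"
  unfolding tker_def cnj_prod using assms idx_lt[of x I d] idx_lt[of z I d]
  by (intro prod.cong refl) auto

lemma tker_transpose: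
  assumes "U \<in> carrier_mat d d" "x \<in> idx I d" "z \<in> idx I d"
  shows "tker I (transpose_mat U) x z = tker I U z x"
  unfolding tker_def using assms idx_lt[of x I d] idx_lt[of z I d]
  by (intro prod.cong refl) auto

lemma tker_orthonormal:
  assumes "finite I" and U: "U \<in> unitary_group d" and x: "x \<in> idx I d" and z: "z \<in> idx I d"
  shows "(\<Sum>y\<in>idx I d. cnj (tker I U y x) * tker I U y z) = (if x = z then 1 else 0)"
proof -
  note u = unitary_groupD[OF U]
  have "(\<Sum>y\<in>idx I d. cnj (tker I U y x) * tker I U y z) = (\<Sum>y\<in>idx I d. tker I (mat_adjoint U) x y * tker I U y z)"
    using u x by (intro sum.cong refl) (simp add: tker_adjoint)
  also have "\<dots> = tker I (mat_adjoint U * U) x z"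
    using assms(1) u x z by (intro tker_mult[symmetric]) auto
  finally show ?thesis using u tker_one[OF assms(1) x z] by simp
qed

text \<open>Stated for general index sets because it serves both tensor kernels and the change to an
  orthonormal basis in \<open>coupling_parseval\<close>.\<close>

lemma orthonormal_kernel_isometry:
  fixes K :: "'a \<Rightarrow> 'b \<Rightarrow> complex"
  assumes "finite B" and K: "\<And>y z. y \<in> B \<Longrightarrow> z \<in> B \<Longrightarrow> (\<Sum>x\<in>A. cnj (K x y) * K x z) = (if y = z then 1 else 0)"
  shows "(\<Sum>x\<in>A. (cmod (\<Sum>y\<in>B. K x y * v y))\<^sup>2) = (\<Sum>y\<in>B. (cmod (v y))\<^sup>2)"
proof -
  have "complex_of_real (\<Sum>x\<in>A. (cmod (\<Sum>y\<in>B. K x y * v y))\<^sup>2) =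
     (\<Sum>x\<in>A. (\<Sum>z\<in>B. K x z * v z) * (\<Sum>y\<in>B. cnj (K x y * v y)))"
    unfolding of_real_sum complex_norm_square cnj_sum ..
  also have "\<dots> = (\<Sum>x\<in>A. \<Sum>z\<in>B. \<Sum>y\<in>B. (v z * cnj (v y)) * (cnj (K x y) * K x z))"
    unfolding sum_product by (intro sum.cong refl) (simp add: mult_ac)
  also have "\<dots> = (\<Sum>z\<in>B. \<Sum>y\<in>B. (v z * cnj (v y)) * (\<Sum>x\<in>A. cnj (K x y) * K x z))"
    by (subst sum.swap, intro sum.cong refl, subst sum.swap) (simp only: sum_distrib_left)
  also have "\<dots> = (\<Sum>z\<in>B. \<Sum>y\<in>B. if y = z then v z * cnj (v z) else 0)"
    by (intro sum.cong refl) (auto simp: K)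
  also have "\<dots> = of_real (\<Sum>z\<in>B. (cmod (v z))\<^sup>2)"
    using assms(1) unfolding of_real_sum complex_norm_square by (intro sum.cong refl) simp
  finally show ?thesis by (simp only: of_real_eq_iff)
qed

lemmas tker_isometry = orthonormal_kernel_isometry[OF finite_idx tker_orthonormal]

lemma sum_idx_insert:
  assumes "i \<notin> I"
  shows "(\<Sum>x\<in>idx (insert i I) d. f x) = (\<Sum>a<d. \<Sum>z\<in>idx I d. f (z(i := a)))"
proof -
  have inj: "inj_on (\<lambda>(a, z). z(i := a)) ({..<d} \<times> idx I d)"
    unfolding idx_def using inj_combinator[OF assms, of "\<lambda>_. {..<d}"] by (simp add: split_def inj_on_def)
  show ?thesis
    unfolding idx_def PiE_insert_eq
    by (subst sum.reindex) (use inj in \<open>auto simp: idx_def sum.cartesian_product split_def\<close>)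
qed

lemma tker_insert:
  assumes "finite I" "i \<notin> I"
  shows "tker (insert i I) U (x(i := a)) (y(i := b)) = U $$ (a, b) * tker I U x y"
proof -
  have "(\<Prod>k\<in>I. U $$ ((x(i := a)) k, (y(i := b)) k)) = (\<Prod>k\<in>I. U $$ (x k, y k))"
    using assms by (intro prod.cong refl) auto
  then show ?thesis using assms by (simp add: tker_def)
qed

lemma sum_rotate3: "(\<Sum>a\<in>A. \<Sum>b\<in>B. \<Sum>c\<in>C. f a b c) = (\<Sum>c\<in>C. \<Sum>a\<in>A. \<Sum>b\<in>B. f a b c)"
proof -
  have "(\<Sum>a\<in>A. \<Sum>b\<in>B. \<Sum>c\<in>C. f a b c) = (\<Sum>a\<in>A. \<Sum>c\<in>C. \<Sum>b\<in>B. f a b c)"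
    by (intro sum.cong refl sum.swap)
  then show ?thesis by (simp only: sum.swap[of _ C A])
qed

text \<open>The coordinates \<open>i\<close> and \<open>j\<close> are split off. The same
  \<open>U\<close> acts on the others, so they are not independent of the pair; but for each fixed
  \<open>U\<close> their kernel is an isometry and drops out once their outcomes are summed. What
  remains is the pair bound for each value \<open>w\<close> of the other coordinates.\<close>

lemma clifford_coincidence:
  assumes I: "finite I" "i \<in> I" "j \<in> I" "i \<noteq> j"
  shows "cl_avg n (\<lambda>U. \<Sum>x\<in>{x \<in> idx I (2 ^ n). x i = x j}. (cmod (\<Sum>y\<in>idx I (2 ^ n). tker I U x y * v y))\<^sup>2)
    \<le> 2 / 2 ^ n * (\<Sum>y\<in>idx I (2 ^ n). (cmod (v y))\<^sup>2)"
proof -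
  let ?d = "2 ^ n :: nat"
  define R where "R = I - {i, j}"
  have R: "finite R" "i \<notin> insert j R" "j \<notin> R" "I = insert i (insert j R)" using I by (auto simp: R_def)
  have fR: "finite (insert j R)" using R by simp
  let ?e = "\<lambda>w b c. w(j := c, i := b)"
  have split: "(\<Sum>x\<in>idx I ?d. f x) = (\<Sum>a<?d. \<Sum>b<?d. \<Sum>z\<in>idx R ?d. f (?e z a b))" for f :: "_ \<Rightarrow> 'z :: comm_monoid_add"
    unfolding R(4) sum_idx_insert[OF R(2)] sum_idx_insert[OF R(3)] ..
  have split_ker: "tker I U (?e x a b) (?e y a' b') = U $$ (a, a') * U $$ (b, b') * tker R U x y" for U x y a b a' b'
    unfolding R(4) tker_insert[OF fR R(2)] tker_insert[OF R(1,3)] by simp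
  have "(\<Sum>x\<in>{x \<in> idx I ?d. x i = x j}. (cmod (\<Sum>y\<in>idx I ?d. tker I U x y * v y))\<^sup>2) =
     (\<Sum>w\<in>idx R ?d. \<Sum>a<?d. (cmod (\<Sum>b<?d. \<Sum>c<?d. U $$ (a, b) * U $$ (a, c) * v (?e w b c)))\<^sup>2)"
     if U: "U \<in> clifford_group n" for U
  proof -
    let ?g = "\<lambda>a w. \<Sum>b<?d. \<Sum>c<?d. U $$ (a, b) * U $$ (a, c) * v (?e w b c)"
    have inner: "(\<Sum>y\<in>idx I ?d. tker I U (?e z a a) y * v y) = (\<Sum>w\<in>idx R ?d. tker R U z w * ?g a w)" for a z
    proof -
      have "(\<Sum>y\<in>idx I ?d. tker I U (?e z a a) y * v y) =
          (\<Sum>b<?d. \<Sum>c<?d. \<Sum>w\<in>idx R ?d. tker R U z w * (U $$ (a, b) * U $$ (a, c) * v (?e w b c)))"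
        unfolding split split_ker by (intro sum.cong refl) (simp add: mult_ac)
      also have "\<dots> = (\<Sum>w\<in>idx R ?d. \<Sum>b<?d. \<Sum>c<?d. tker R U z w * (U $$ (a, b) * U $$ (a, c) * v (?e w b c)))"
        by (rule sum_rotate3)
      finally show ?thesis by (simp only: sum_distrib_left)
    qed
    have "(\<Sum>x\<in>{x \<in> idx I ?d. x i = x j}. (cmod (\<Sum>y\<in>idx I ?d. tker I U x y * v y))\<^sup>2) =
      (\<Sum>x\<in>idx I ?d. if x i = x j then (cmod (\<Sum>y\<in>idx I ?d. tker I U x y * v y))\<^sup>2 else 0)"
      using I by (intro sum.inter_filter) simp
    also have "\<dots> = (\<Sum>a<?d. \<Sum>b<?d. if b = a then \<Sum>z\<in>idx R ?d. (cmod (\<Sum>y\<in>idx I ?d. tker I U (?e z a a) y * v y))\<^sup>2 else 0)"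
      unfolding split[of "\<lambda>x. if x i = x j then _ x else 0"] using I(4)
      by (intro sum.cong refl) auto
    also have "\<dots> = (\<Sum>a<?d. \<Sum>z\<in>idx R ?d. (cmod (\<Sum>w\<in>idx R ?d. tker R U z w * ?g a w))\<^sup>2)"
      unfolding inner by simp
    also have "\<dots> = (\<Sum>a<?d. \<Sum>w\<in>idx R ?d. (cmod (?g a w))\<^sup>2)"
      by (intro sum.cong refl tker_isometry R clifford_groupD(1)[OF U])
    also have "\<dots> = (\<Sum>w\<in>idx R ?d. \<Sum>a<?d. (cmod (?g a w))\<^sup>2)" by (rule sum.swap)
    finally show ?thesis .
  qed
  then have "cl_avg n (\<lambda>U. \<Sum>x\<in>{x \<in> idx I ?d. x i = x j}. (cmod (\<Sum>y\<in>idx I ?d. tker I U x y * v y))\<^sup>2) =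
      (\<Sum>w\<in>idx R ?d. cl_avg n (\<lambda>U. \<Sum>a<?d. (cmod (\<Sum>b<?d. \<Sum>c<?d. U $$ (a, b) * U $$ (a, c) * v (?e w b c)))\<^sup>2))"
    unfolding cl_avg_sum[symmetric, where I = "idx R ?d"] by (rule cl_avg_cong)
  also have "\<dots> \<le> (\<Sum>w\<in>idx R ?d. 2 / 2 ^ n * (\<Sum>b<?d. \<Sum>c<?d. (cmod (v (?e w b c)))\<^sup>2))"
    by (intro sum_mono clifford_pair_collision)
  also have "\<dots> = 2 / 2 ^ n * (\<Sum>w\<in>idx R ?d. \<Sum>b<?d. \<Sum>c<?d. (cmod (v (?e w b c)))\<^sup>2)"
    by (simp only: sum_distrib_left)
  also have "(\<Sum>w\<in>idx R ?d. \<Sum>b<?d. \<Sum>c<?d. (cmod (v (?e w b c)))\<^sup>2) = (\<Sum>y\<in>idx I ?d. (cmod (v y))\<^sup>2)"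
    unfolding split by (rule sum_rotate3[symmetric])
  finally show ?thesis .
qed

section \<open>Weight of tuples with a repeated entry\<close>

definition inj_idx :: "'k set \<Rightarrow> nat \<Rightarrow> ('k \<Rightarrow> nat) set" where
  "inj_idx I d = {x \<in> idx I d. inj_on x I}"

lemma inj_idx_subset: "inj_idx I d \<subseteq> idx I d"
  by (auto simp: inj_idx_def)

lemma finite_inj_idx [simp]: "finite I \<Longrightarrow> finite (inj_idx I d)"
  by (simp add: inj_idx_def)

text \<open>At most t^2 ordered pairs of coordinates, each coinciding with weight at most 2 /
  d.\<close>

definition collision_rate :: "nat \<Rightarrow> nat \<Rightarrow> real" where
  "collision_rate t d = 2 * (real t)\<^sup>2 / real d"

lemma sum_UN_le:
  fixes f :: "'a \<Rightarrow> real"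
  assumes "finite J" "\<And>p. p \<in> J \<Longrightarrow> finite (A p)" "\<And>x. 0 \<le> f x"
  shows "sum f (\<Union>p\<in>J. A p) \<le> (\<Sum>p\<in>J. sum f (A p))"
  using assms(1,2)
proof (induction J rule: finite_induct)
  case (insert p J)
  have "sum f (A p \<union> (\<Union>p\<in>J. A p)) \<le> sum f (A p) + sum f (\<Union>p\<in>J. A p)"
    using insert assms(3) by (subst sum.union_inter[symmetric]) (auto intro: sum_nonneg)
  with insert show ?case by (force simp: add_mono)
qed simp

text \<open>A non-injective tuple has a coinciding pair of coordinates, so this is the union bound
  over ordered pairs.\<close>

lemma clifford_collision:
  assumes I: "finite I"
  shows "cl_avg n (\<lambda>U. \<Sum>x\<in>idx I (2 ^ n) - inj_idx I (2 ^ n). (cmod (\<Sum>y\<in>idx I (2 ^ n). tker I U x y * v y))\<^sup>2)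
    \<le> collision_rate (card I) (2 ^ n) * (\<Sum>y\<in>idx I (2 ^ n). (cmod (v y))\<^sup>2)"
proof -
  let ?d = "2 ^ n :: nat"
  define J where "J = {(i, j). i \<in> I \<and> j \<in> I \<and> i \<noteq> j}"
  have J: "finite J" "J \<subseteq> I \<times> I" using I by (auto simp: J_def intro: finite_subset[of _ "I \<times> I"])
  have cJ: "real (card J) \<le> (real (card I))\<^sup>2"
    using card_mono[OF _ J(2)] I by (simp add: card_cartesian_product power2_eq_square flip: of_nat_mult)
  let ?F = "\<lambda>U x. (cmod (\<Sum>y\<in>idx I ?d. tker I U x y * v y))\<^sup>2" and ?N = "\<Sum>y\<in>idx I ?d. (cmod (v y))\<^sup>2"
  have "cl_avg n (\<lambda>U. \<Sum>x\<in>idx I ?d - inj_idx I ?d. ?F U x)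
     \<le> cl_avg n (\<lambda>U. \<Sum>p\<in>J. \<Sum>x\<in>{x \<in> idx I ?d. x (fst p) = x (snd p)}. ?F U x)"
  proof (rule cl_avg_mono)
    fix U
    have "(\<Sum>x\<in>idx I ?d - inj_idx I ?d. ?F U x) \<le> (\<Sum>x\<in>(\<Union>p\<in>J. {x \<in> idx I ?d. x (fst p) = x (snd p)}). ?F U x)"
      using I J by (intro sum_mono2) (auto simp: inj_idx_def inj_on_def J_def)
    also have "\<dots> \<le> (\<Sum>p\<in>J. \<Sum>x\<in>{x \<in> idx I ?d. x (fst p) = x (snd p)}. ?F U x)"
      using I J by (intro sum_UN_le) auto
    finally show "(\<Sum>x\<in>idx I ?d - inj_idx I ?d. ?F U x) \<le> (\<Sum>p\<in>J. \<Sum>x\<in>{x \<in> idx I ?d. x (fst p) = x (snd p)}. ?F U x)" .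
  qed
  also have "\<dots> = (\<Sum>p\<in>J. cl_avg n (\<lambda>U. \<Sum>x\<in>{x \<in> idx I ?d. x (fst p) = x (snd p)}. ?F U x))"
    by (rule cl_avg_sum)
  also have "\<dots> \<le> (\<Sum>p\<in>J. 2 / 2 ^ n * ?N)"
    by (intro sum_mono clifford_coincidence I) (auto simp: J_def)
  also have "\<dots> = real (card J) * (2 / 2 ^ n * ?N)" by simp
  also have "\<dots> \<le> (real (card I))\<^sup>2 * (2 / 2 ^ n * ?N)"
    by (intro mult_right_mono cJ mult_nonneg_nonneg sum_nonneg) auto
  finally show ?thesis by (simp add: collision_rate_def mult_ac)
qed

text \<open>Least significant digit first. The head factor of \<open>tensor_pow (Suc t) A\<close>
  owns the highest digit and so becomes coordinate \<open>t\<close>, while the lower coordinates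
  keep their names in the recursion.\<close>

definition digits :: "nat \<Rightarrow> nat \<Rightarrow> nat \<Rightarrow> nat \<Rightarrow> nat" where
  "digits d t i = (\<lambda>k\<in>{..<t}. i div d ^ k mod d)"

lemma digits_idx: "d > 0 \<Longrightarrow> digits d t i \<in> idx {..<t} d"
  by (auto simp: digits_def idx_def)

lemma digits_Suc:
  assumes "i < d ^ Suc t"
  shows "digits d (Suc t) i = (digits d t (i mod d ^ t))(t := i div d ^ t)"
proof
  fix k
  have lt: "i div d ^ t < d" using assms by (simp add: less_mult_imp_div_less)
  show "digits d (Suc t) i k = ((digits d t (i mod d ^ t))(t := i div d ^ t)) k"
  proof (cases "k < t")
    case True
    then have e: "d ^ t = d ^ k * (d * d ^ (t - Suc k))"
      by (metis Suc_leI le_add_diff_inverse mult.assoc power_Suc2 power_add)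
    have dk: "d ^ k > 0" using lt by auto
    have "i mod d ^ t div d ^ k = i div d ^ k mod (d * d ^ (t - Suc k))"
      unfolding e using dk by (simp add: mod_mult2_eq)
    then have "i mod d ^ t div d ^ k mod d = i div d ^ k mod (d * d ^ (t - Suc k)) mod d" by simp
    also have "\<dots> = i div d ^ k mod d" by (simp add: mod_mod_cancel)
    finally show ?thesis using True by (simp add: digits_def)
  qed (use lt in \<open>auto simp: digits_def\<close>)
qed

lemma bij_betw_digits:
  assumes "d > 0"
  shows "bij_betw (digits d t) {..<d ^ t} (idx {..<t} d)"
proof (rule bij_betw_imageI)
  show inj: "inj_on (digits d t) {..<d ^ t}"
  proof (rule inj_onI)
    fix i j assume "i \<in> {..<d ^ t}" "j \<in> {..<d ^ t}" "digits d t i = digits d t j"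
    then show "i = j"
    proof (induction t arbitrary: i j)
      case (Suc t)
      have lt: "i < d ^ Suc t" "j < d ^ Suc t" using Suc.prems by auto
      have eq: "(digits d t (i mod d ^ t))(t := i div d ^ t) = (digits d t (j mod d ^ t))(t := j div d ^ t)"
        using Suc.prems(3) lt by (simp only: digits_Suc)
      have "i div d ^ t = j div d ^ t" using fun_cong[OF eq, of t] by simp
      moreover have "digits d t (i mod d ^ t) = digits d t (j mod d ^ t)"
      proof
        fix k show "digits d t (i mod d ^ t) k = digits d t (j mod d ^ t) k"
          using fun_cong[OF eq, of k] by (cases "k = t") (auto simp: digits_def)
      qed
      then have "i mod d ^ t = j mod d ^ t" using assms by (intro Suc.IH) auto
      ultimately show ?case by (metis div_mult_mod_eq)
    qed simp
  qed
  show "digits d t ` {..<d ^ t} = idx {..<t} d"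
  proof (rule card_subset_eq)
    show "card (digits d t ` {..<d ^ t}) = card (idx {..<t} d)"
      unfolding card_image[OF inj] by (simp add: idx_def card_PiE)
  qed (use digits_idx[OF assms] in auto)
qed

lemma tensor_pow_carrier: "A \<in> carrier_mat d d \<Longrightarrow> tensor_pow t A \<in> carrier_mat (d ^ t) (d ^ t)"
  unfolding tensor_pow_def by (induction t) (auto intro: kron_carrier)

lemma tensor_pow_index:
  assumes A: "A \<in> carrier_mat d d" and "i < d ^ t" "j < d ^ t"
  shows "tensor_pow t A $$ (i, j) = tker {..<t} A (digits d t i) (digits d t j)"
  using assms(2,3)
proof (induction t arbitrary: i j)
  case (Suc t)
  have "d > 0" using Suc.prems by (cases d) auto
  then have m: "i mod d ^ t < d ^ t" "j mod d ^ t < d ^ t" by auto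
  have "tensor_pow (Suc t) A = kron A (tensor_pow t A)" by (simp add: tensor_pow_def)
  then have "tensor_pow (Suc t) A $$ (i, j) = A $$ (i div d ^ t, j div d ^ t) * tensor_pow t A $$ (i mod d ^ t, j mod d ^ t)"
    using Suc.prems by (simp add: kron_index[OF A tensor_pow_carrier[OF A]])
  also have "\<dots> = tker {..<Suc t} A (digits d (Suc t) i) (digits d (Suc t) j)"
    unfolding Suc.IH[OF m] digits_Suc[OF Suc.prems(1)] digits_Suc[OF Suc.prems(2)] lessThan_Suc
    by (rule tker_insert[symmetric]) auto
  finally show ?case .
qed (auto simp: tensor_pow_def tker_def)

subsection \<open>Second moments of permutation and sign averages\<close>

text \<open>The pairing of a tensor power with an array of coefficients. Every amplitude <u, R psi>
  has this form with \<open>G\<close> built from u and psi, so both moments are averages of squared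
  moduli of \<open>amp\<close>.\<close>

definition amp :: "'k set \<Rightarrow> nat \<Rightarrow> complex mat \<Rightarrow> (('k \<Rightarrow> nat) \<Rightarrow> ('k \<Rightarrow> nat) \<Rightarrow> complex) \<Rightarrow> complex" where
  "amp I d U G = (\<Sum>y\<in>idx I d. \<Sum>x\<in>idx I d. tker I U y x * G y x)"

lemma amp_mult_right:
  assumes "finite I" "U \<in> carrier_mat d d" "V \<in> carrier_mat d d"
  shows "amp I d (U * V) G = amp I d U (\<lambda>y w. \<Sum>x\<in>idx I d. tker I V w x * G y x)"
proof -
  have "amp I d (U * V) G = (\<Sum>y\<in>idx I d. \<Sum>x\<in>idx I d. \<Sum>w\<in>idx I d. tker I U y w * (tker I V w x * G y x))"
    unfolding amp_def by (intro sum.cong refl) (simp add: tker_mult[OF assms] sum_distrib_right mult.assoc)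
  also have "\<dots> = (\<Sum>y\<in>idx I d. \<Sum>w\<in>idx I d. \<Sum>x\<in>idx I d. tker I U y w * (tker I V w x * G y x))"
    by (intro sum.cong refl sum.swap)
  finally show ?thesis by (simp only: amp_def sum_distrib_left)
qed

text \<open>Together with \<open>amp_mult_right\<close> this lets the amplitude of a product be read
  as a function of either factor, the other one being absorbed in the coefficients.\<close>

lemma amp_mult_left:
  assumes "finite I" "U \<in> carrier_mat d d" "V \<in> carrier_mat d d"
  shows "amp I d (U * V) G = amp I d V (\<lambda>w x. \<Sum>y\<in>idx I d. tker I U y w * G y x)"
proof -
  have "amp I d (U * V) G = (\<Sum>y\<in>idx I d. \<Sum>x\<in>idx I d. \<Sum>w\<in>idx I d. tker I V w x * (tker I U y w * G y x))"
    unfolding amp_def by (intro sum.cong refl) (simp add: tker_mult[OF assms] sum_distrib_left mult_ac)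
  also have "\<dots> = (\<Sum>w\<in>idx I d. \<Sum>y\<in>idx I d. \<Sum>x\<in>idx I d. tker I V w x * (tker I U y w * G y x))"
    by (rule sum_rotate3)
  also have "\<dots> = (\<Sum>w\<in>idx I d. \<Sum>x\<in>idx I d. \<Sum>y\<in>idx I d. tker I V w x * (tker I U y w * G y x))"
    by (intro sum.cong refl sum.swap)
  finally show ?thesis by (simp only: amp_def sum_distrib_left)
qed

section \<open>Action of permutations and signs on tuples\<close>

definition perms :: "'k set \<Rightarrow> ('k \<Rightarrow> 'k) set" where
  "perms I = {\<sigma>. \<sigma> permutes I}"

definition signs :: "nat \<Rightarrow> (nat \<Rightarrow> nat) set" where
  "signs d = {..<d} \<rightarrow>\<^sub>E {0, 1}"

definition relabel :: "'k set \<Rightarrow> (nat \<Rightarrow> nat) \<Rightarrow> ('k \<Rightarrow> nat) \<Rightarrow> ('k \<Rightarrow> nat)" where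
  "relabel I \<pi> x = (\<lambda>k\<in>I. \<pi> (x k))"

definition sgn_idx :: "'k set \<Rightarrow> (nat \<Rightarrow> nat) \<Rightarrow> ('k \<Rightarrow> nat) \<Rightarrow> complex" where
  "sgn_idx I f x = (\<Prod>k\<in>I. (- 1) ^ f (x k))"

lemma finite_perms [simp]: "finite I \<Longrightarrow> finite (perms I)"
  by (simp add: perms_def finite_permutations)

lemma card_perms: "finite I \<Longrightarrow> card (perms I) = fact (card I)"
  by (simp add: perms_def card_permutations)

lemma finite_signs [simp]: "finite (signs d)"
  by (simp add: signs_def finite_PiE)

lemma card_signs: "card (signs d) = 2 ^ d"
  by (simp add: signs_def card_PiE numeral_2_eq_2)

lemma permutes_lessThan_lt: "\<pi> permutes {..<d} \<Longrightarrow> j < d \<Longrightarrow> \<pi> j < (d :: nat)"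
  using permutes_in_image[of \<pi> "{..<d}" j] by simp

lemma pf_carrier: "perm_op d \<pi> * sign_op d f \<in> carrier_mat d d"
  by (simp add: perm_op_def sign_op_def)

lemma pf_index:
  assumes "i < d" "j < d"
  shows "(perm_op d \<pi> * sign_op d f) $$ (i, j) = (if i = \<pi> j then (- 1) ^ f j else 0)"
proof -
  have "(perm_op d \<pi> * sign_op d f) $$ (i, j) = (\<Sum>k<d. perm_op d \<pi> $$ (i, k) * sign_op d f $$ (k, j))"
    using assms by (intro index_mult_mat_sum) (auto simp: perm_op_def sign_op_def)
  also have "\<dots> = (\<Sum>k<d. if k = j then (if i = \<pi> j then (- 1) ^ f j else 0) else 0)"
    using assms by (intro sum.cong refl) (auto simp: perm_op_def sign_op_def)
  finally show ?thesis using assms by simp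
qed

lemma pf_unitary:
  assumes "\<pi> permutes {..<d}"
  shows "perm_op d \<pi> * sign_op d f \<in> unitary_group d"
proof (rule unitary_groupI[OF pf_carrier], rule eq_matI)
  let ?U = "perm_op d \<pi> * sign_op d f"
  have c: "?U \<in> carrier_mat d d" by (rule pf_carrier)
  fix i j assume "i < dim_row (1\<^sub>m d :: complex mat)" "j < dim_col (1\<^sub>m d :: complex mat)"
  then have ij: "i < d" "j < d" by auto
  have "(mat_adjoint ?U * ?U) $$ (i, j) = (\<Sum>k<d. cnj (?U $$ (k, i)) * ?U $$ (k, j))"
    using c ij by (subst index_mult_mat_sum[of _ d d _ d]) (auto simp: carrier_matD[OF c] simp del: index_mult_mat)
  also have "\<dots> = (\<Sum>k<d. if k = \<pi> i then (if i = j then 1 else 0) else 0)"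
    using ij inj_eq[OF permutes_inj[OF assms]]
    by (intro sum.cong refl) (auto simp: pf_index simp del: index_mult_mat(1) simp flip: power_add power_mult_distrib)
  also have "\<dots> = (1\<^sub>m d :: complex mat) $$ (i, j)"
    using ij permutes_lessThan_lt[OF assms ij(1)] by simp
  finally show "(mat_adjoint ?U * ?U) $$ (i, j) = (1\<^sub>m d :: complex mat) $$ (i, j)" .
qed (auto simp: sign_op_def)

lemma relabel_idx: "\<pi> permutes {..<d} \<Longrightarrow> x \<in> idx I d \<Longrightarrow> relabel I \<pi> x \<in> idx I d"
proof -
  assume p: "\<pi> permutes {..<d}" and x: "x \<in> idx I d"
  have "\<pi> (x k) \<in> {..<d}" if "k \<in> I" for k using permutes_lessThan_lt[OF p idx_lt[OF x that]] by simp
  then show ?thesis by (simp add: relabel_def idx_def)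
qed

lemma tker_pf:
  assumes "finite I" "\<pi> permutes {..<d}" "x \<in> idx I d" "y \<in> idx I d"
  shows "tker I (perm_op d \<pi> * sign_op d f) y x = (if y = relabel I \<pi> x then sgn_idx I f x else 0)"
proof -
  have "tker I (perm_op d \<pi> * sign_op d f) y x = (\<Prod>k\<in>I. if y k = \<pi> (x k) then (- 1) ^ f (x k) else 0)"
    unfolding tker_def by (intro prod.cong refl pf_index idx_lt[OF assms(3)] idx_lt[OF assms(4)])
  also have "\<dots> = (if y = relabel I \<pi> x then sgn_idx I f x else 0)"
  proof (cases "y = relabel I \<pi> x")
    case True
    then show ?thesis by (auto simp: sgn_idx_def relabel_def intro!: prod.cong)
  next
    case False
    then obtain k where "k \<in> I" "y k \<noteq> relabel I \<pi> x k"
      using idx_eqI[OF assms(4) relabel_idx[OF assms(2,3)]] by blast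
    then show ?thesis using assms(1) False by (auto simp: relabel_def intro!: prod_zero)
  qed
  finally show ?thesis .
qed

lemma amp_pf:
  assumes "finite I" "\<pi> permutes {..<d}"
  shows "amp I d (perm_op d \<pi> * sign_op d f) G = (\<Sum>x\<in>idx I d. sgn_idx I f x * G (relabel I \<pi> x) x)"
proof -
  have "amp I d (perm_op d \<pi> * sign_op d f) G =
     (\<Sum>y\<in>idx I d. \<Sum>x\<in>idx I d. if y = relabel I \<pi> x then sgn_idx I f x * G (relabel I \<pi> x) x else 0)"
    unfolding amp_def using assms by (intro sum.cong refl) (auto simp: tker_pf)
  also have "\<dots> = (\<Sum>x\<in>idx I d. \<Sum>y\<in>idx I d. if y = relabel I \<pi> x then sgn_idx I f x * G (relabel I \<pi> x) x else 0)"
    by (rule sum.swap)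
  also have "\<dots> = (\<Sum>x\<in>idx I d. sgn_idx I f x * G (relabel I \<pi> x) x)"
    using assms by (intro sum.cong refl) (simp add: relabel_idx)
  finally show ?thesis .
qed

text \<open>On an injective tuple no value repeats, so the sign depends on the image alone and not
  on the order of the entries.\<close>

lemma sgn_idx_inj:
  assumes "finite I" "x \<in> inj_idx I d"
  shows "sgn_idx I f x = (\<Prod>j<d. if j \<in> x ` I then (- 1) ^ f j else 1)"
proof -
  have x: "inj_on x I" "x ` I \<subseteq> {..<d}" using assms by (auto simp: inj_idx_def idx_def)
  have "sgn_idx I f x = (\<Prod>j\<in>x ` I. (- 1) ^ f j)"
    unfolding sgn_idx_def by (simp add: prod.reindex[OF x(1)])
  also have "x ` I = {j \<in> {..<d}. j \<in> x ` I}" using x by auto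
  finally show ?thesis by (subst (asm) prod.inter_filter) auto
qed

text \<open>The sum factorises over the values \<open>j\<close>. A value lying in exactly one of the
  two images contributes 1 + (-1) = 0, every other value contributes 2.\<close>

lemma sum_signs:
  assumes "finite I" "x \<in> inj_idx I d" "x' \<in> inj_idx I d"
  shows "(\<Sum>f\<in>signs d. sgn_idx I f x * sgn_idx I f x') = (if x' ` I = x ` I then 2 ^ d else 0)"
proof -
  define g :: "nat \<Rightarrow> nat \<Rightarrow> complex" where
    "g j b = (if j \<in> x ` I then (- 1) ^ b else 1) * (if j \<in> x' ` I then (- 1) ^ b else 1)" for j b
  have "(\<Sum>f\<in>signs d. sgn_idx I f x * sgn_idx I f x') = (\<Sum>f\<in>signs d. \<Prod>j<d. g j (f j))"
    by (simp add: sgn_idx_inj[OF assms(1,2)] sgn_idx_inj[OF assms(1,3)] prod.distrib g_def)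
  also have "\<dots> = (\<Prod>j<d. \<Sum>b\<in>{0, 1}. g j b)"
    unfolding signs_def by (rule prod_sum_PiE[symmetric]) auto
  also have "\<dots> = (\<Prod>j<d. if j \<in> x ` I \<longleftrightarrow> j \<in> x' ` I then 2 else 0)"
    by (intro prod.cong refl) (auto simp: g_def)
  also have "\<dots> = (if x' ` I = x ` I then 2 ^ d else 0)"
  proof (cases "x' ` I = x ` I")
    case False
    have "x ` I \<subseteq> {..<d}" "x' ` I \<subseteq> {..<d}" using assms by (auto simp: inj_idx_def idx_def)
    with False obtain j where "j < d" "\<not> (j \<in> x ` I \<longleftrightarrow> j \<in> x' ` I)" by blast
    then have "(\<Prod>j<d. if j \<in> x ` I \<longleftrightarrow> j \<in> x' ` I then 2 else (0 :: complex)) = 0"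
      by (intro prod_zero) auto
    then show ?thesis using False by simp
  qed simp
  finally show ?thesis .
qed

lemma permute_inj_idx:
  assumes "x \<in> inj_idx I d" "\<sigma> \<in> perms I"
  shows "x \<circ> \<sigma> \<in> inj_idx I d" "(x \<circ> \<sigma>) ` I = x ` I"
proof -
  have s: "\<sigma> permutes I" using assms by (simp add: perms_def)
  have im: "\<sigma> ` I = I" by (rule permutes_image[OF s])
  have "x (\<sigma> k) < d" if "k \<in> I" for k using assms(1) that im by (auto simp: inj_idx_def idx_def)
  moreover have "x (\<sigma> k) = undefined" if "k \<notin> I" for k
    using assms(1) that permutes_not_in[OF s that] by (auto simp: inj_idx_def idx_def)
  ultimately have "x \<circ> \<sigma> \<in> idx I d" by (auto simp: idx_def)
  moreover have "inj_on (x \<circ> \<sigma>) I"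
    using assms(1) im permutes_inj_on[OF s] by (intro comp_inj_on) (auto simp: inj_idx_def)
  ultimately show "x \<circ> \<sigma> \<in> inj_idx I d" by (simp add: inj_idx_def)
  show "(x \<circ> \<sigma>) ` I = x ` I" by (metis im image_comp)
qed

text \<open>The sign average pairs injective tuples with equal image; this parametrises the partners
  of \<open>x\<close> by coordinate permutations.\<close>

lemma bij_betw_permute_idx:
  assumes "finite I" "x \<in> inj_idx I d"
  shows "bij_betw (\<lambda>\<sigma>. x \<circ> \<sigma>) (perms I) {x' \<in> inj_idx I d. x' ` I = x ` I}"
proof (rule bij_betw_imageI)
  have x: "inj_on x I" using assms by (simp add: inj_idx_def)
  show "inj_on (\<lambda>\<sigma>. x \<circ> \<sigma>) (perms I)"
  proof (rule inj_onI)
    fix \<sigma> \<tau> assume st: "\<sigma> \<in> perms I" "\<tau> \<in> perms I" "x \<circ> \<sigma> = x \<circ> \<tau>"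
    show "\<sigma> = \<tau>"
    proof
      fix k
      show "\<sigma> k = \<tau> k"
      proof (cases "k \<in> I")
        case True
        then have "\<sigma> k \<in> I" "\<tau> k \<in> I" using st by (auto simp: perms_def permutes_in_image)
        then show ?thesis using x fun_cong[OF st(3), of k] by (auto simp: inj_on_def)
      qed (use st in \<open>auto simp: perms_def permutes_not_in\<close>)
    qed
  qed
  show "(\<lambda>\<sigma>. x \<circ> \<sigma>) ` perms I = {x' \<in> inj_idx I d. x' ` I = x ` I}"
  proof (intro equalityI subsetI)
    fix x' assume "x' \<in> {x' \<in> inj_idx I d. x' ` I = x ` I}"
    then have x': "x' \<in> inj_idx I d" "x' ` I = x ` I" by auto
    define \<sigma> where "\<sigma> k = (if k \<in> I then inv_into I x (x' k) else k)" for k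
    have xs: "x (\<sigma> k) = x' k" "\<sigma> k \<in> I" if "k \<in> I" for k
      using that x'(2) f_inv_into_f[of "x' k" x I] inv_into_into[of "x' k" x I] by (auto simp: \<sigma>_def)
    have inj: "inj_on \<sigma> I"
      using x' xs(1) by (auto simp: inj_on_def inj_idx_def) metis
    have "\<sigma> ` I = I" using xs(2) inj assms(1) by (intro endo_inj_surj) auto
    then have "\<sigma> permutes I" using inj by (intro bij_imp_permutes) (auto simp: bij_betw_def \<sigma>_def)
    moreover have "x' = x \<circ> \<sigma>"
    proof
      fix k show "x' k = (x \<circ> \<sigma>) k"
        using xs(1)[of k] x'(1) assms(2) by (cases "k \<in> I") (auto simp: inj_idx_def idx_def \<sigma>_def PiE_def extensional_def)
    qed
    ultimately show "x' \<in> (\<lambda>\<sigma>. x \<circ> \<sigma>) ` perms I" by (auto simp: perms_def)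
  next
    fix x' assume "x' \<in> (\<lambda>\<sigma>. x \<circ> \<sigma>) ` perms I"
    then obtain \<sigma> where "\<sigma> \<in> perms I" "x' = x \<circ> \<sigma>" by blast
    then show "x' \<in> {x' \<in> inj_idx I d. x' ` I = x ` I}" using permute_inj_idx[OF assms(2)] by blast
  qed
qed

lemma relabel_permute:
  assumes "\<sigma> \<in> perms I"
  shows "relabel I \<pi> (x \<circ> \<sigma>) = relabel I \<pi> x \<circ> \<sigma>"
proof
  fix k
  have s: "\<sigma> permutes I" using assms by (simp add: perms_def)
  show "relabel I \<pi> (x \<circ> \<sigma>) k = (relabel I \<pi> x \<circ> \<sigma>) k"
    using permutes_in_image[OF s, of k] permutes_not_in[OF s, of k] by (auto simp: relabel_def)
qed

lemma relabel_inj_idx: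
  assumes "\<pi> permutes {..<d}" "x \<in> inj_idx I d"
  shows "relabel I \<pi> x \<in> inj_idx I d"
  using assms relabel_idx[of \<pi> d x I] inj_eq[OF permutes_inj[OF assms(1)]]
  by (auto simp: inj_idx_def inj_on_def relabel_def)

lemma relabel_comp: "relabel I \<pi> (relabel I \<rho> x) = relabel I (\<pi> \<circ> \<rho>) x"
  by (auto simp: relabel_def)

lemma relabel_id: "x \<in> idx I d \<Longrightarrow> relabel I id x = x"
  by (auto simp: relabel_def idx_def fun_eq_iff)

text \<open>The map between the images extends to a permutation by any bijection of their
  complements, which have equal size.\<close>

lemma relabel_transitive:
  assumes "x \<in> inj_idx I d" "x' \<in> inj_idx I d"
  shows "\<exists>\<rho>. \<rho> permutes {..<d} \<and> relabel I \<rho> x = x'"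
proof -
  have x: "inj_on x I" "x ` I \<subseteq> {..<d}" and x': "inj_on x' I" "x' ` I \<subseteq> {..<d}" "x' \<in> idx I d"
    using assms by (auto simp: inj_idx_def idx_def)
  let ?A = "{..<d} - x ` I" and ?B = "{..<d} - x' ` I"
  have fin: "finite (x ` I)" "finite (x' ` I)" using x x' finite_subset by blast+
  have b1: "bij_betw (x' \<circ> inv_into I x) (x ` I) (x' ` I)"
    using x x' by (intro bij_betw_trans[OF bij_betw_inv_into[OF bij_betw_imageI]]) (auto simp: bij_betw_def)
  have "card ?A = card ?B"
    using x x' fin bij_betw_same_card[OF b1] by (simp add: card_Diff_subset)
  then obtain g where g: "bij_betw g ?A ?B" using finite_same_card_bij[of ?A ?B] by auto
  define \<rho> where "\<rho> j = (if j \<in> x ` I then (x' \<circ> inv_into I x) j else if j < d then g j else j)" for j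
  have "bij_betw \<rho> (x ` I \<union> ?A) (x' ` I \<union> ?B)"
  proof (rule bij_betw_combine)
    show "bij_betw \<rho> (x ` I) (x' ` I)" using b1 by (rule bij_betw_cong[THEN iffD1, rotated]) (simp add: \<rho>_def)
    show "bij_betw \<rho> ?A ?B" using g by (rule bij_betw_cong[THEN iffD1, rotated]) (simp add: \<rho>_def)
  qed auto
  moreover have "x ` I \<union> ?A = {..<d}" "x' ` I \<union> ?B = {..<d}" using x x' by auto
  ultimately have "\<rho> permutes {..<d}" using x by (intro bij_imp_permutes) (auto simp: \<rho>_def)
  moreover have "relabel I \<rho> x = x'"
    using x x'(3) by (intro ext) (auto simp: relabel_def \<rho>_def idx_def)
  ultimately show ?thesis by blast
qed

lemma sum_relabel_inj_idx:
  assumes "finite I" "\<pi> permutes {..<d}"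
  shows "(\<Sum>z\<in>inj_idx I d. F (relabel I \<pi> z)) = (\<Sum>z\<in>inj_idx I d. F z)"
proof (rule sum.reindex_bij_witness[of _ "relabel I (inv_into UNIV \<pi>)" "relabel I \<pi>"])
  fix z assume z: "z \<in> inj_idx I d"
  then have zi: "z \<in> idx I d" by (simp add: inj_idx_def)
  show "relabel I (inv_into UNIV \<pi>) (relabel I \<pi> z) = z" "relabel I \<pi> (relabel I (inv_into UNIV \<pi>) z) = z"
    unfolding relabel_comp permutes_inv_o[OF assms(2)] by (rule relabel_id[OF zi])+
  show "relabel I \<pi> z \<in> inj_idx I d" "relabel I (inv_into UNIV \<pi>) z \<in> inj_idx I d"
    using relabel_inj_idx assms(2) permutes_inv z by blast+
qed simp

text \<open>By transitivity the sum over relabellings is the same for every injective tuple. Summing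
  it over all of them and exchanging the sums leaves one full sum over \<open>z\<close> for each
  permutation.\<close>

lemma sum_perms_relabel:
  fixes F :: "_ \<Rightarrow> complex"
  assumes I: "finite I" and x: "x \<in> inj_idx I d"
  shows "of_nat (card (inj_idx I d)) * (\<Sum>\<pi>\<in>perms {..<d}. F (relabel I \<pi> x)) = fact d * (\<Sum>z\<in>inj_idx I d. F z)"
proof -
  let ?A = "\<lambda>x. \<Sum>\<pi>\<in>perms {..<d}. F (relabel I \<pi> x)"
  have "?A x' = ?A x" if x': "x' \<in> inj_idx I d" for x'
  proof -
    obtain \<rho> where r: "\<rho> permutes {..<d}" "relabel I \<rho> x = x'" using relabel_transitive[OF x x'] by blast
    have "?A x' = (\<Sum>\<pi>\<in>perms {..<d}. F (relabel I (\<pi> \<circ> \<rho>) x))" by (simp add: relabel_comp flip: r(2))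
    also have "\<dots> = ?A x"
    proof (rule sum.reindex_bij_witness[of _ "\<lambda>\<pi>. \<pi> \<circ> inv_into UNIV \<rho>" "\<lambda>\<pi>. \<pi> \<circ> \<rho>"])
      fix \<pi> assume p: "\<pi> \<in> perms {..<d}"
      show "\<pi> \<circ> \<rho> \<circ> inv_into UNIV \<rho> = \<pi>" "\<pi> \<circ> inv_into UNIV \<rho> \<circ> \<rho> = \<pi>"
        by (simp_all add: comp_assoc permutes_inv_o[OF r(1)])
      show "\<pi> \<circ> \<rho> \<in> perms {..<d}" "\<pi> \<circ> inv_into UNIV \<rho> \<in> perms {..<d}"
        using p r(1) permutes_compose permutes_inv unfolding perms_def by blast+
    qed simp
    finally show ?thesis .
  qed
  then have "of_nat (card (inj_idx I d)) * ?A x = (\<Sum>x'\<in>inj_idx I d. ?A x')" by simp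
  also have "\<dots> = (\<Sum>\<pi>\<in>perms {..<d}. \<Sum>x'\<in>inj_idx I d. F (relabel I \<pi> x'))" by (rule sum.swap)
  also have "\<dots> = (\<Sum>\<pi>\<in>perms {..<d}. \<Sum>z\<in>inj_idx I d. F z)"
    by (rule sum.cong[OF refl], rule sum_relabel_inj_idx[OF I]) (simp add: perms_def)
  also have "\<dots> = fact d * (\<Sum>z\<in>inj_idx I d. F z)" by (simp add: card_perms)
  finally show ?thesis .
qed

lemma sum_permute_inj_idx:
  assumes "\<tau> \<in> perms I"
  shows "(\<Sum>x\<in>inj_idx I d. F (x \<circ> \<tau>)) = (\<Sum>x\<in>inj_idx I d. F x)"
proof (rule sum.reindex_bij_witness[of _ "\<lambda>x. x \<circ> inv_into UNIV \<tau>" "\<lambda>x. x \<circ> \<tau>"])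
  have t: "\<tau> permutes I" using assms by (simp add: perms_def)
  fix x assume x: "x \<in> inj_idx I d"
  show "x \<circ> \<tau> \<circ> inv_into UNIV \<tau> = x" "x \<circ> inv_into UNIV \<tau> \<circ> \<tau> = x" by (simp_all add: comp_assoc permutes_inv_o[OF t])
  show "x \<circ> \<tau> \<in> inj_idx I d" "x \<circ> inv_into UNIV \<tau> \<in> inj_idx I d"
    using permute_inj_idx(1)[OF x] permutes_inv[OF t] t by (auto simp: perms_def)
qed simp

text \<open>Symmetrisation of \<open>G\<close> under simultaneous permutation of output and input
  coordinates, left unnormalised; the factorial is carried by \<open>pf_weight\<close>.\<close>

definition hsum :: "'k set \<Rightarrow> (('k \<Rightarrow> nat) \<Rightarrow> ('k \<Rightarrow> nat) \<Rightarrow> complex) \<Rightarrow> ('k \<Rightarrow> nat) \<Rightarrow> ('k \<Rightarrow> nat) \<Rightarrow> complex" where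
  "hsum I G z x = (\<Sum>\<sigma>\<in>perms I. G (z \<circ> \<sigma>) (x \<circ> \<sigma>))"

definition pf_avg :: "nat \<Rightarrow> (complex mat \<Rightarrow> real) \<Rightarrow> real" where
  "pf_avg d F = (\<Sum>\<pi>\<in>perms {..<d}. \<Sum>f\<in>signs d. F (perm_op d \<pi> * sign_op d f)) / (fact d * 2 ^ d)"

definition pf_weight :: "'k set \<Rightarrow> nat \<Rightarrow> real" where
  "pf_weight I d = 1 / (fact (card I) * real (card (inj_idx I d)))"

abbreviation perm_corr :: "'k set \<Rightarrow> (('k \<Rightarrow> nat) \<Rightarrow> ('k \<Rightarrow> nat) \<Rightarrow> complex) \<Rightarrow> ('k \<Rightarrow> nat) \<Rightarrow> ('k \<Rightarrow> nat) \<Rightarrow> complex" where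
  "perm_corr I G z x \<equiv> \<Sum>\<sigma>\<in>perms I. G z x * cnj (G (z \<circ> \<sigma>) (x \<circ> \<sigma>))"

text \<open>The square expands into pairs of permutations. Writing the second as the first composed
  with a third, the first is absorbed in the sums over \<open>x\<close> and \<open>z\<close>. The
  gain is a form with nonnegative terms, which may be enlarged by dropping the restriction on
  \<open>z\<close>.\<close>

lemma sum_hsum_square:
  assumes "finite I"
  shows "(\<Sum>x\<in>inj_idx I d. \<Sum>z\<in>inj_idx I d. hsum I G z x * cnj (hsum I G z x)) =
    fact (card I) * (\<Sum>x\<in>inj_idx I d. \<Sum>z\<in>inj_idx I d. perm_corr I G z x)"
proof -
  let ?L = "inj_idx I d"
  have "hsum I G z x * cnj (hsum I G z x) = (\<Sum>\<tau>\<in>perms I. perm_corr I G (z \<circ> \<tau>) (x \<circ> \<tau>))" for z x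
  proof -
    have "hsum I G z x * cnj (hsum I G z x) =
       (\<Sum>\<tau>\<in>perms I. \<Sum>\<sigma>\<in>perms I. G (z \<circ> \<tau>) (x \<circ> \<tau>) * cnj (G (z \<circ> \<sigma>) (x \<circ> \<sigma>)))"
      unfolding hsum_def cnj_sum sum_product ..
    also have "\<dots> = (\<Sum>\<tau>\<in>perms I. perm_corr I G (z \<circ> \<tau>) (x \<circ> \<tau>))"
    proof (rule sum.cong[OF refl])
      fix \<tau> assume "\<tau> \<in> perms I"
      then have t: "\<tau> permutes I" by (simp add: perms_def)
      show "(\<Sum>\<sigma>\<in>perms I. G (z \<circ> \<tau>) (x \<circ> \<tau>) * cnj (G (z \<circ> \<sigma>) (x \<circ> \<sigma>))) = perm_corr I G (z \<circ> \<tau>) (x \<circ> \<tau>)"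
      proof (rule sum.reindex_bij_witness[of _ "\<lambda>\<sigma>. \<tau> \<circ> \<sigma>" "\<lambda>\<sigma>. inv_into UNIV \<tau> \<circ> \<sigma>"])
        fix \<sigma> assume s: "\<sigma> \<in> perms I"
        show c: "\<tau> \<circ> (inv_into UNIV \<tau> \<circ> \<sigma>) = \<sigma>" and "inv_into UNIV \<tau> \<circ> (\<tau> \<circ> \<sigma>) = \<sigma>"
          by (simp_all add: permutes_inv_o[OF t] flip: comp_assoc)
        show "\<tau> \<circ> \<sigma> \<in> perms I" "inv_into UNIV \<tau> \<circ> \<sigma> \<in> perms I"
          using s t permutes_compose permutes_inv unfolding perms_def by blast+
        show "G (z \<circ> \<tau>) (x \<circ> \<tau>) * cnj (G (z \<circ> \<tau> \<circ> (inv_into UNIV \<tau> \<circ> \<sigma>)) (x \<circ> \<tau> \<circ> (inv_into UNIV \<tau> \<circ> \<sigma>)))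
          = G (z \<circ> \<tau>) (x \<circ> \<tau>) * cnj (G (z \<circ> \<sigma>) (x \<circ> \<sigma>))"
          unfolding comp_assoc c ..
      qed
    qed
    finally show ?thesis .
  qed
  then have "(\<Sum>x\<in>?L. \<Sum>z\<in>?L. hsum I G z x * cnj (hsum I G z x)) =
      (\<Sum>x\<in>?L. \<Sum>z\<in>?L. \<Sum>\<tau>\<in>perms I. perm_corr I G (z \<circ> \<tau>) (x \<circ> \<tau>))" by simp
  also have "\<dots> = (\<Sum>\<tau>\<in>perms I. \<Sum>x\<in>?L. \<Sum>z\<in>?L. perm_corr I G (z \<circ> \<tau>) (x \<circ> \<tau>))"
    by (rule sum_rotate3)
  also have "\<dots> = (\<Sum>\<tau>\<in>perms I. \<Sum>x\<in>?L. \<Sum>z\<in>?L. perm_corr I G z x)"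
  proof (rule sum.cong[OF refl])
    fix \<tau> assume t: "\<tau> \<in> perms I"
    have "(\<Sum>x\<in>?L. \<Sum>z\<in>?L. perm_corr I G (z \<circ> \<tau>) (x \<circ> \<tau>)) = (\<Sum>x\<in>?L. \<Sum>z\<in>?L. perm_corr I G z (x \<circ> \<tau>))"
    proof (rule sum.cong[OF refl])
      fix x
      show "(\<Sum>z\<in>?L. perm_corr I G (z \<circ> \<tau>) (x \<circ> \<tau>)) = (\<Sum>z\<in>?L. perm_corr I G z (x \<circ> \<tau>))"
        by (rule sum_permute_inj_idx[OF t, where F = "\<lambda>z. perm_corr I G z (x \<circ> \<tau>)"])
    qed
    also have "\<dots> = (\<Sum>x\<in>?L. \<Sum>z\<in>?L. perm_corr I G z x)"
      by (rule sum_permute_inj_idx[OF t, where F = "\<lambda>x. \<Sum>z\<in>?L. perm_corr I G z x"])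
    finally show "(\<Sum>x\<in>?L. \<Sum>z\<in>?L. perm_corr I G (z \<circ> \<tau>) (x \<circ> \<tau>)) = (\<Sum>x\<in>?L. \<Sum>z\<in>?L. perm_corr I G z x)" .
  qed
  finally show ?thesis using assms by (simp add: card_perms)
qed

text \<open>Averaging over the signs pairs \<open>x\<close> only with its permutations, and averaging over the
  relabellings makes the injective index functions \<open>z\<close> uniform.\<close>

lemma pf_second_moment:
  assumes I: "finite I" and G: "\<And>y x. x \<in> idx I d \<Longrightarrow> x \<notin> inj_idx I d \<Longrightarrow> G y x = 0"
  shows "pf_avg d (\<lambda>U. (cmod (amp I d U G))\<^sup>2) =
    pf_weight I d * (\<Sum>x\<in>inj_idx I d. \<Sum>z\<in>inj_idx I d. (cmod (hsum I G z x))\<^sup>2)"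
proof -
  let ?L = "inj_idx I d"
  let ?S = "\<Sum>x\<in>?L. \<Sum>z\<in>?L. perm_corr I G z x"
  have signs: "(\<Sum>f\<in>signs d. complex_of_real ((cmod (amp I d (perm_op d \<pi> * sign_op d f) G))\<^sup>2)) =
      2 ^ d * (\<Sum>x\<in>?L. perm_corr I G (relabel I \<pi> x) x)"
    if p: "\<pi> permutes {..<d}" for \<pi>
  proof -
    let ?g = "\<lambda>x. G (relabel I \<pi> x) x"
    \<comment> \<open>Restricting to injective tuples is essential for the pairing by images: on
      other tuples the signs of repeated values cancel in pairs.\<close>
    have a: "amp I d (perm_op d \<pi> * sign_op d f) G = (\<Sum>x\<in>?L. sgn_idx I f x * ?g x)" for f
      unfolding amp_pf[OF I p] using I G by (intro sum.mono_neutral_right inj_idx_subset) auto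
    have cs: "cnj (sgn_idx I f x) = sgn_idx I f x" for f x by (simp add: sgn_idx_def)
    have "(\<Sum>f\<in>signs d. complex_of_real ((cmod (amp I d (perm_op d \<pi> * sign_op d f) G))\<^sup>2)) =
       (\<Sum>f\<in>signs d. \<Sum>x\<in>?L. \<Sum>x'\<in>?L. (?g x * cnj (?g x')) * (sgn_idx I f x * sgn_idx I f x'))"
      unfolding complex_norm_square a cnj_sum sum_product by (intro sum.cong refl) (simp add: cs mult_ac)
    also have "\<dots> = (\<Sum>x\<in>?L. \<Sum>x'\<in>?L. \<Sum>f\<in>signs d. (?g x * cnj (?g x')) * (sgn_idx I f x * sgn_idx I f x'))"
      by (rule sum_rotate3[symmetric])
    also have "\<dots> = (\<Sum>x\<in>?L. \<Sum>x'\<in>?L. if x' ` I = x ` I then 2 ^ d * (?g x * cnj (?g x')) else 0)"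
      by (intro sum.cong refl) (simp add: sum_signs[OF I] flip: sum_distrib_left)
    also have "\<dots> = (\<Sum>x\<in>?L. \<Sum>x'\<in>{x' \<in> ?L. x' ` I = x ` I}. 2 ^ d * (?g x * cnj (?g x')))"
      using I by (intro sum.cong[OF refl] sum.inter_filter[symmetric]) auto
    also have "\<dots> = (\<Sum>x\<in>?L. \<Sum>\<sigma>\<in>perms I. 2 ^ d * (?g x * cnj (?g (x \<circ> \<sigma>))))"
      by (rule sum.cong[OF refl], rule sum.reindex_bij_betw[symmetric], rule bij_betw_permute_idx[OF I])
    also have "\<dots> = (\<Sum>x\<in>?L. \<Sum>\<sigma>\<in>perms I. 2 ^ d * (G (relabel I \<pi> x) x * cnj (G (relabel I \<pi> x \<circ> \<sigma>) (x \<circ> \<sigma>))))"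
      by (intro sum.cong refl) (simp add: relabel_permute)
    finally show ?thesis by (simp only: sum_distrib_left)
  qed
  have S: "of_nat (card ?L) * (\<Sum>\<pi>\<in>perms {..<d}. \<Sum>x\<in>?L. perm_corr I G (relabel I \<pi> x) x)
      = fact d * ?S"
  proof -
    have "of_nat (card ?L) * (\<Sum>\<pi>\<in>perms {..<d}. \<Sum>x\<in>?L. perm_corr I G (relabel I \<pi> x) x)
      = (\<Sum>x\<in>?L. of_nat (card ?L) * (\<Sum>\<pi>\<in>perms {..<d}. perm_corr I G (relabel I \<pi> x) x))"
      by (subst sum.swap) (rule sum_distrib_left)
    also have "\<dots> = (\<Sum>x\<in>?L. fact d * (\<Sum>z\<in>?L. perm_corr I G z x))"
    proof (rule sum.cong[OF refl])
      fix x assume x: "x \<in> ?L"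
      show "of_nat (card ?L) * (\<Sum>\<pi>\<in>perms {..<d}. perm_corr I G (relabel I \<pi> x) x)
          = fact d * (\<Sum>z\<in>?L. perm_corr I G z x)"
        by (rule sum_perms_relabel[OF I x, where F = "\<lambda>z. perm_corr I G z x"])
    qed
    finally show ?thesis by (simp only: sum_distrib_left)
  qed
  have "complex_of_real (pf_avg d (\<lambda>U. (cmod (amp I d U G))\<^sup>2)) =
     (\<Sum>\<pi>\<in>perms {..<d}. \<Sum>f\<in>signs d. complex_of_real ((cmod (amp I d (perm_op d \<pi> * sign_op d f) G))\<^sup>2)) / (fact d * 2 ^ d)"
    unfolding pf_avg_def by simp
  also have "(\<Sum>\<pi>\<in>perms {..<d}. \<Sum>f\<in>signs d. complex_of_real ((cmod (amp I d (perm_op d \<pi> * sign_op d f) G))\<^sup>2)) =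
     2 ^ d * (\<Sum>\<pi>\<in>perms {..<d}. \<Sum>x\<in>?L. perm_corr I G (relabel I \<pi> x) x)"
    by (subst sum_distrib_left, rule sum.cong[OF refl], rule signs) (simp add: perms_def)
  finally have 1: "complex_of_real (pf_avg d (\<lambda>U. (cmod (amp I d U G))\<^sup>2)) =
     (\<Sum>\<pi>\<in>perms {..<d}. \<Sum>x\<in>?L. perm_corr I G (relabel I \<pi> x) x) / fact d"
    by simp
  have "complex_of_real (pf_avg d (\<lambda>U. (cmod (amp I d U G))\<^sup>2)) = ?S / of_nat (card ?L)"
  \<comment> \<open>With more coordinates than values there is no injective tuple, and both sides
    are empty sums.\<close>
  proof (cases "card ?L = 0")
    case True
    then have "?L = {}" using I by simp
    then show ?thesis unfolding 1 by simp
  next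
    case False
    then show ?thesis unfolding 1 using S by (simp add: field_simps)
  qed
  also have "?S = (\<Sum>x\<in>?L. \<Sum>z\<in>?L. hsum I G z x * cnj (hsum I G z x)) / fact (card I)"
    unfolding sum_hsum_square[OF I] by simp
  also have "\<dots> / of_nat (card ?L) = complex_of_real (pf_weight I d * (\<Sum>x\<in>?L. \<Sum>z\<in>?L. (cmod (hsum I G z x))\<^sup>2))"
    unfolding of_real_mult of_real_sum complex_norm_square pf_weight_def by simp
  finally show ?thesis by (simp only: of_real_eq_iff)
qed

subsection \<open>Haar second moments\<close>

lemma unitary_entry_norm_le:
  assumes "U \<in> unitary_group d" "i < d" "j < d"
  shows "cmod (U $$ (i, j)) \<le> 1"
proof -
  have "complex_of_real (\<Sum>k<d. (cmod (U $$ (k, j)))\<^sup>2) = (\<Sum>k<d. cnj (U $$ (k, j)) * U $$ (k, j))"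
    unfolding of_real_sum complex_norm_square by (simp add: mult.commute)
  also have "\<dots> = complex_of_real 1" using unitary_col_orthonormal[OF assms(1,3,3)] by simp
  finally have "(\<Sum>k<d. (cmod (U $$ (k, j)))\<^sup>2) = 1" by (simp only: of_real_eq_iff)
  moreover have "(cmod (U $$ (i, j)))\<^sup>2 \<le> (\<Sum>k<d. (cmod (U $$ (k, j)))\<^sup>2)"
    using assms by (intro member_le_sum) auto
  ultimately have "(cmod (U $$ (i, j)))\<^sup>2 \<le> 1\<^sup>2" by simp
  then show ?thesis by (rule power2_le_imp_le) simp
qed

lemma tker_norm_le:
  assumes "U \<in> unitary_group d" "x \<in> idx I d" "y \<in> idx I d"
  shows "cmod (tker I U x y) \<le> 1"
  unfolding tker_def prod_norm[symmetric]
  by (intro prod_le_1)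
    (auto intro!: unitary_entry_norm_le[OF assms(1)] idx_lt[OF assms(2)] idx_lt[OF assms(3)])

text \<open>The condition \<open>measurable_cong_unitary\<close> takes care of functions that are only controlled
  on the unitary group: it holds both for discrete measures and for measures living on the
  group.\<close>

locale unitary_law = prob_space \<nu> for \<nu> :: "complex mat measure" and d :: nat +
  assumes entry_measurable: "i < d \<Longrightarrow> j < d \<Longrightarrow> (\<lambda>U. U $$ (i, j)) \<in> borel_measurable \<nu>"
    and AE_unitary: "AE U in \<nu>. U \<in> unitary_group d"
    and measurable_cong_unitary:
      "\<And>f g :: complex mat \<Rightarrow> complex. (\<And>U. U \<in> unitary_group d \<Longrightarrow> f U = g U) \<Longrightarrow>
        g \<in> borel_measurable \<nu> \<Longrightarrow> f \<in> borel_measurable \<nu>"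
begin

lemma integral_cong_unitary:
  fixes f g :: "complex mat \<Rightarrow> complex"
  assumes "\<And>U. U \<in> unitary_group d \<Longrightarrow> f U = g U" "g \<in> borel_measurable \<nu>"
  shows "integral\<^sup>L \<nu> f = integral\<^sup>L \<nu> g"
  using assms measurable_cong_unitary[OF assms] AE_unitary by (intro integral_cong_AE) auto

lemma tker_measurable:
  "x \<in> idx I d \<Longrightarrow> y \<in> idx I d \<Longrightarrow> (\<lambda>U. tker I U x y) \<in> borel_measurable \<nu>"
  unfolding tker_def by (intro borel_measurable_prod entry_measurable) (auto intro: idx_lt)

lemma amp_measurable: "(\<lambda>U. amp I d U G) \<in> borel_measurable \<nu>"
  unfolding amp_def by (intro borel_measurable_sum borel_measurable_times tker_measurable) auto

lemma integrable_bounded: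
  fixes f :: "complex mat \<Rightarrow> 'b :: {banach, second_countable_topology}"
  assumes "f \<in> borel_measurable \<nu>" "\<And>U. U \<in> unitary_group d \<Longrightarrow> norm (f U) \<le> B"
  shows "integrable \<nu> f"
  using AE_unitary assms by (intro integrable_const_bound[of _ B]) auto

lemma amp_norm_le:
  assumes "U \<in> unitary_group d"
  shows "cmod (amp I d U G) \<le> (\<Sum>y\<in>idx I d. \<Sum>x\<in>idx I d. cmod (G y x))"
  unfolding amp_def using tker_norm_le[OF assms]
  by (intro order_trans[OF norm_sum] sum_mono) (auto simp: norm_mult intro!: mult_left_le_one_le)

lemma integrable_amp_mult: "integrable \<nu> (\<lambda>U. amp I d U G * cnj (amp I d U G'))"
proof (rule integrable_bounded)
  show "(\<lambda>U. amp I d U G * cnj (amp I d U G')) \<in> borel_measurable \<nu>"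
    by (intro borel_measurable_times amp_measurable
        measurable_compose[OF amp_measurable borel_measurable_continuous_onI] continuous_intros)
  fix U assume "U \<in> unitary_group d"
  from amp_norm_le[OF this, of I G] amp_norm_le[OF this, of I G']
  show "cmod (amp I d U G * cnj (amp I d U G')) \<le>
     (\<Sum>y\<in>idx I d. \<Sum>x\<in>idx I d. cmod (G y x)) * (\<Sum>y\<in>idx I d. \<Sum>x\<in>idx I d. cmod (G' y x))"
    unfolding norm_mult complex_mod_cnj by (intro mult_mono sum_nonneg) auto
qed

lemma integrable_amp: "integrable \<nu> (\<lambda>U. (cmod (amp I d U G))\<^sup>2)"
proof -
  have "integrable \<nu> (\<lambda>U. Re (amp I d U G * cnj (amp I d U G)))"
    by (intro integrable_Re integrable_amp_mult)
  then show ?thesis by (simp add: complex_norm_square[symmetric] del: of_real_power flip: of_real_power)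
qed

text \<open>An expression such as the amplitude of \<open>U * V\<close> can be rewritten only where
  the dimensions of \<open>U\<close> are known, hence the agreement on unitaries alone.\<close>

lemma integral_amp_cong:
  assumes "\<And>U. U \<in> unitary_group d \<Longrightarrow> h U = amp I d U G"
  shows "(\<integral>U. (cmod (h U))\<^sup>2 \<partial>\<nu>) = (\<integral>U. (cmod (amp I d U G))\<^sup>2 \<partial>\<nu>)"
proof (rule integral_cong_AE)
  show "AE U in \<nu>. (cmod (h U))\<^sup>2 = (cmod (amp I d U G))\<^sup>2"
    using AE_unitary by eventually_elim (simp add: assms)
  have "h \<in> borel_measurable \<nu>"
    using amp_measurable by (rule measurable_cong_unitary[rotated]) (rule assms)
  then show "(\<lambda>U. (cmod (h U))\<^sup>2) \<in> borel_measurable \<nu>" by measurable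
qed (rule borel_measurable_integrable[OF integrable_amp])

end

lemma haar_unitary_law:
  assumes "haar_prob_measure d \<mu>"
  shows "unitary_law \<mu> d"
proof -
  let ?M = "\<Pi>\<^sub>M p\<in>{..<d} \<times> {..<d}. borel :: complex measure"
  let ?f = "\<lambda>U::complex mat. \<lambda>p\<in>{..<d} \<times> {..<d}. U $$ p"
  have s: "sets \<mu> = sets (unitary_borel d)" using assms by (simp add: haar_prob_measure_def)
  have sp: "space \<mu> = unitary_group d"
    using sets_eq_imp_space_eq[OF s] by (simp add: unitary_borel_def)
  interpret prob_space \<mu> using assms by (simp add: haar_prob_measure_def)
  have "?f \<in> unitary_group d \<rightarrow> space ?M" by (auto simp: space_PiM)
  then have f: "?f \<in> \<mu> \<rightarrow>\<^sub>M ?M"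
    unfolding measurable_cong_sets[OF s refl] unitary_borel_def by (rule measurable_vimage_algebra1)
  show ?thesis
  proof
    fix i j assume "i < d" "j < d"
    then have "(\<lambda>U. ?f U (i, j)) \<in> borel_measurable \<mu>"
      by (intro measurable_compose[OF f] measurable_component_singleton) auto
    then show "(\<lambda>U. U $$ (i, j)) \<in> borel_measurable \<mu>" using \<open>i < d\<close> \<open>j < d\<close> by simp
  next
    show "AE U in \<mu>. U \<in> unitary_group d" using AE_space[of \<mu>] by (simp add: sp)
  next
    fix f g :: "complex mat \<Rightarrow> complex"
    assume "\<And>U. U \<in> unitary_group d \<Longrightarrow> f U = g U" "g \<in> borel_measurable \<mu>"
    then show "f \<in> borel_measurable \<mu>" by (subst measurable_cong[of \<mu> f g]) (auto simp: sp)
  qed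
qed

lemma pmf_unitary_law:
  assumes "set_pmf p \<subseteq> unitary_group d"
  shows "unitary_law (measure_pmf p) d"
  using assms by unfold_locales (auto simp: AE_measure_pmf_iff)

text \<open>Invariance is given as an equality of \<open>distr\<close>. To use it under an integral
  the translation must be measurable, which follows entry by entry because the entries generate the
  Borel structure.\<close>

lemma haar_mult_right:
  assumes h: "haar_prob_measure d \<mu>" and V: "V \<in> unitary_group d" and F: "F \<in> borel_measurable \<mu>"
  shows "(\<integral>U. F (U * V) \<partial>\<mu>) = (\<integral>U. F U \<partial>\<mu> :: real)"
proof -
  interpret unitary_law \<mu> d by (rule haar_unitary_law[OF h])
  let ?M = "\<Pi>\<^sub>M p\<in>{..<d} \<times> {..<d}. borel :: complex measure"
  let ?f = "\<lambda>U::complex mat. \<lambda>p\<in>{..<d} \<times> {..<d}. U $$ p"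
  have s: "sets \<mu> = sets (unitary_borel d)" using h by (simp add: haar_prob_measure_def)
  have sp: "space \<mu> = unitary_group d"
    using sets_eq_imp_space_eq[OF s] by (simp add: unitary_borel_def)
  have "(\<lambda>U. (U * V) $$ p) \<in> borel_measurable \<mu>" if p: "p \<in> {..<d} \<times> {..<d}" for p
  proof -
    obtain i j where ij: "p = (i, j)" "i < d" "j < d" using p by auto
    have "(\<lambda>U. \<Sum>k<d. U $$ (i, k) * V $$ (k, j)) \<in> borel_measurable \<mu>"
      using ij by (intro borel_measurable_sum borel_measurable_times entry_measurable) auto
    then show ?thesis
    proof (rule measurable_cong_unitary[rotated])
      fix U assume "U \<in> unitary_group d"
      then show "(U * V) $$ p = (\<Sum>k<d. U $$ (i, k) * V $$ (k, j))"
        unfolding ij(1) using ij(2,3) unitary_groupD(1) V by (intro index_mult_mat_sum) auto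
    qed
  qed
  then have "(\<lambda>U. ?f (U * V)) \<in> \<mu> \<rightarrow>\<^sub>M ?M" by (intro measurable_restrict) auto
  moreover have "(\<lambda>U. U * V) \<in> space \<mu> \<rightarrow> unitary_group d"
    using V unitary_group_mult by (auto simp: sp)
  ultimately have "(\<lambda>U. U * V) \<in> \<mu> \<rightarrow>\<^sub>M unitary_borel d"
    unfolding unitary_borel_def by (intro measurable_vimage_algebra2)
  then have m: "(\<lambda>U. U * V) \<in> \<mu> \<rightarrow>\<^sub>M \<mu>" using measurable_cong_sets[OF refl s] by blast
  have "(\<integral>U. F (U * V) \<partial>\<mu>) = (\<integral>U. F U \<partial>distr \<mu> \<mu> (\<lambda>U. U * V))"
    by (rule integral_distr[OF m F, symmetric])
  also have "distr \<mu> \<mu> (\<lambda>U. U * V) = \<mu>" using h V by (simp add: haar_prob_measure_def)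
  finally show ?thesis .
qed

lemma integral_cl_avg:
  fixes F :: "complex mat \<Rightarrow> complex mat \<Rightarrow> real"
  assumes "\<And>C. C \<in> clifford_group n \<Longrightarrow> integrable \<nu> (F C)"
  shows "(\<integral>U. cl_avg n (\<lambda>C. F C U) \<partial>\<nu>) = cl_avg n (\<lambda>C. \<integral>U. F C U \<partial>\<nu>)"
    and "integrable \<nu> (\<lambda>U. cl_avg n (\<lambda>C. F C U))"
  unfolding cl_avg_def using assms representative_clifford
  by (auto intro!: Bochner_Integration.integral_sum)

lemma integral_pf_avg:
  fixes F :: "complex mat \<Rightarrow> complex mat \<Rightarrow> real"
  assumes "\<And>R. R \<in> unitary_group d \<Longrightarrow> integrable \<nu> (F R)"
  shows "(\<integral>U. pf_avg d (\<lambda>R. F R U) \<partial>\<nu>) = pf_avg d (\<lambda>R. \<integral>U. F R U \<partial>\<nu>)"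
proof -
  have i: "integrable \<nu> (F (perm_op d \<pi> * sign_op d f))" if "\<pi> \<in> perms {..<d}" for \<pi> f
    using assms pf_unitary that by (auto simp: perms_def)
  show ?thesis unfolding pf_avg_def using i by simp
qed

lemma pf_avg_cong: "(\<And>R. R \<in> unitary_group d \<Longrightarrow> F R = F' R) \<Longrightarrow> pf_avg d F = pf_avg d F'"
  unfolding pf_avg_def using pf_unitary
  by (intro arg_cong2[of _ _ _ _ "(/)"] sum.cong refl) (auto simp: perms_def)

lemma pf_avg_const: "pf_avg d (\<lambda>R. c) = c"
  unfolding pf_avg_def by (simp add: card_perms card_signs)

lemma pf_avg_mono: "(\<And>R. R \<in> unitary_group d \<Longrightarrow> F R \<le> F' R) \<Longrightarrow> pf_avg d F \<le> pf_avg d F'"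
  unfolding pf_avg_def using pf_unitary
  by (intro divide_right_mono sum_mono) (auto simp: perms_def)

text \<open>A tensor power commutes with permutations of its factors, so acting on the output slot
  and symmetrising may be exchanged.\<close>

lemma hsum_left_action:
  assumes I: "finite I"
  shows "hsum I (\<lambda>w x. \<Sum>y\<in>idx I d. tker I U y w * G y x) z x = (\<Sum>w\<in>idx I d. tker I U w z * hsum I G w x)"
proof -
  have "(\<Sum>y\<in>idx I d. tker I U y (z \<circ> \<sigma>) * G y (x \<circ> \<sigma>)) = (\<Sum>w\<in>idx I d. tker I U w z * G (w \<circ> \<sigma>) (x \<circ> \<sigma>))"
    if "\<sigma> \<in> perms I" for \<sigma>
  proof (rule sum.reindex_bij_witness[of _ "\<lambda>w. w \<circ> \<sigma>" "\<lambda>y. y \<circ> inv_into UNIV \<sigma>"])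
    have s: "\<sigma> permutes I" and s': "inv_into UNIV \<sigma> permutes I"
      using that permutes_inv by (auto simp: perms_def)
    have closed: "y \<circ> \<tau> \<in> idx I d" if "y \<in> idx I d" "\<tau> permutes I" for y \<tau>
      using that permutes_in_image[OF that(2)] permutes_not_in[OF that(2)]
      by (auto simp: idx_def PiE_def extensional_def)
    fix y assume y: "y \<in> idx I d"
    show c: "y \<circ> inv_into UNIV \<sigma> \<circ> \<sigma> = y" and "y \<circ> \<sigma> \<circ> inv_into UNIV \<sigma> = y"
      by (simp_all add: comp_assoc permutes_inv_o[OF s])
    show "y \<circ> inv_into UNIV \<sigma> \<in> idx I d" "y \<circ> \<sigma> \<in> idx I d" using closed[OF y] s s' by auto
    have "tker I U (y \<circ> inv_into UNIV \<sigma>) z = (\<Prod>k\<in>I. U $$ ((y \<circ> inv_into UNIV \<sigma>) (\<sigma> k), z (\<sigma> k)))"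
      unfolding tker_def by (rule prod.reindex_bij_betw[symmetric]) (rule permutes_imp_bij[OF s])
    also have "\<dots> = tker I U y (z \<circ> \<sigma>)"
      unfolding tker_def using fun_cong[OF c] by simp
    finally show "tker I U (y \<circ> inv_into UNIV \<sigma>) z * G (y \<circ> inv_into UNIV \<sigma> \<circ> \<sigma>) (x \<circ> \<sigma>) =
      tker I U y (z \<circ> \<sigma>) * G y (x \<circ> \<sigma>)" unfolding c by simp
  qed
  then have "hsum I (\<lambda>w x. \<Sum>y\<in>idx I d. tker I U y w * G y x) z x =
     (\<Sum>\<sigma>\<in>perms I. \<Sum>w\<in>idx I d. tker I U w z * G (w \<circ> \<sigma>) (x \<circ> \<sigma>))"
    unfolding hsum_def by (rule sum.cong[OF refl])
  then show ?thesis unfolding hsum_def by (subst (asm) sum.swap) (simp only: sum_distrib_left)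
qed

text \<open>Coefficients supported at one input tuple turn a column sum into an amplitude, which
  provides its integrability.\<close>

lemma amp_single_column:
  assumes "finite I" "z \<in> idx I d"
  shows "amp I d U (\<lambda>y x. if x = z then h y else 0) = (\<Sum>w\<in>idx I d. tker I U w z * h w)"
  unfolding amp_def
proof (rule sum.cong[OF refl])
  fix y
  have "(\<Sum>x\<in>idx I d. tker I U y x * (if x = z then h y else 0)) = (\<Sum>x\<in>idx I d. if x = z then tker I U y z * h y else 0)"
    by (rule sum.cong) auto
  then show "(\<Sum>x\<in>idx I d. tker I U y x * (if x = z then h y else 0)) = tker I U y z * h y"
    using assms by simp
qed

lemma transposed_isometry:
  assumes "finite I" "U \<in> unitary_group d"
  shows "(\<Sum>z\<in>idx I d. (cmod (\<Sum>w\<in>idx I d. tker I U w z * h w))\<^sup>2) = (\<Sum>w\<in>idx I d. (cmod (h w))\<^sup>2)"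
proof -
  have "(\<Sum>z\<in>idx I d. (cmod (\<Sum>w\<in>idx I d. tker I U w z * h w))\<^sup>2) =
     (\<Sum>z\<in>idx I d. (cmod (\<Sum>w\<in>idx I d. tker I (transpose_mat U) z w * h w))\<^sup>2)"
    using unitary_groupD(1)[OF assms(2)] by (intro sum.cong refl) (simp add: tker_transpose)
  then show ?thesis using tker_isometry[OF assms(1,1) unitary_group_transpose[OF assms(2)]] by simp
qed

section \<open>Haar moments against the sum over all tuples\<close>

locale haar_law =
  fixes \<mu> :: "complex mat measure" and n :: nat
  assumes haar: "haar_prob_measure (2 ^ n) \<mu>"
begin

sublocale unitary_law \<mu> "2 ^ n" by (rule haar_unitary_law[OF haar])

lemma integrable_column_sum:
  assumes "finite I" "z \<in> idx I (2 ^ n)"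
  shows "integrable \<mu> (\<lambda>U. (cmod (\<Sum>w\<in>idx I (2 ^ n). tker I U w z * h w))\<^sup>2)"
  using integrable_amp[of I "\<lambda>y x. if x = z then h y else 0"] amp_single_column[OF assms] by simp

lemma haar_amp_mult_right:
  assumes "V \<in> unitary_group (2 ^ n)"
  shows "(\<integral>U. (cmod (amp I (2 ^ n) (U * V) G))\<^sup>2 \<partial>\<mu>) = (\<integral>U. (cmod (amp I (2 ^ n) U G))\<^sup>2 \<partial>\<mu>)"
  using borel_measurable_integrable[OF integrable_amp] by (rule haar_mult_right[OF haar assms])

text \<open>Here \<open>z\<close> is the second slot of the kernel, so \<open>U\<close> is
  multiplied on the right by a transposed Clifford \<open>C\<close>. For fixed \<open>U\<close> the
  column sums then become the action of \<open>C\<close> on a vector with the same norm as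
  \<open>h\<close>, and the Clifford collision bound applies before the integration over
  \<open>U\<close>.\<close>

lemma haar_column_collision:
  assumes I: "finite I"
  shows "(\<integral>U. (\<Sum>z\<in>idx I (2 ^ n) - inj_idx I (2 ^ n). (cmod (\<Sum>w\<in>idx I (2 ^ n). tker I U w z * h w))\<^sup>2) \<partial>\<mu>)
    \<le> collision_rate (card I) (2 ^ n) * (\<Sum>w\<in>idx I (2 ^ n). (cmod (h w))\<^sup>2)"
proof -
  let ?X = "idx I (2 ^ n)" and ?L = "inj_idx I (2 ^ n)"
  let ?F = "\<lambda>U. \<Sum>z\<in>?X - ?L. (cmod (\<Sum>w\<in>?X. tker I U w z * h w))\<^sup>2"
  let ?R = "collision_rate (card I) (2 ^ n) * (\<Sum>w\<in>?X. (cmod (h w))\<^sup>2)"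
  have Fi: "integrable \<mu> ?F" using I by (intro Bochner_Integration.integrable_sum integrable_column_sum) auto
  have step: "?F (U * transpose_mat C) = (\<Sum>z\<in>?X - ?L. (cmod (\<Sum>v\<in>?X. tker I C z v * (\<Sum>w\<in>?X. tker I U w v * h w)))\<^sup>2)"
    if U: "U \<in> unitary_group (2 ^ n)" and C: "C \<in> clifford_group n" for U C
  proof (rule sum.cong[OF refl])
    fix z assume z: "z \<in> ?X - ?L"
    note c = clifford_groupD(2)[OF C] and u = unitary_groupD(1)[OF U]
    have "(\<Sum>w\<in>?X. tker I (U * transpose_mat C) w z * h w) = (\<Sum>w\<in>?X. \<Sum>v\<in>?X. tker I C z v * (tker I U w v * h w))"
    proof (rule sum.cong[OF refl])
      fix w assume w: "w \<in> ?X"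
      have "tker I (U * transpose_mat C) w z = (\<Sum>v\<in>?X. tker I U w v * tker I (transpose_mat C) v z)"
        using I u c w z by (intro tker_mult) auto
      also have "\<dots> = (\<Sum>v\<in>?X. tker I U w v * tker I C z v)"
        using c z by (intro sum.cong refl) (simp add: tker_transpose)
      finally show "tker I (U * transpose_mat C) w z * h w = (\<Sum>v\<in>?X. tker I C z v * (tker I U w v * h w))"
        by (simp add: sum_distrib_left mult_ac)
    qed
    also have "\<dots> = (\<Sum>v\<in>?X. tker I C z v * (\<Sum>w\<in>?X. tker I U w v * h w))"
      by (subst sum.swap) (simp only: sum_distrib_left)
    finally show "(cmod (\<Sum>w\<in>?X. tker I (U * transpose_mat C) w z * h w))\<^sup>2 =
      (cmod (\<Sum>v\<in>?X. tker I C z v * (\<Sum>w\<in>?X. tker I U w v * h w)))\<^sup>2" by simp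
  qed
  have trC: "transpose_mat C \<in> unitary_group (2 ^ n)" if "C \<in> clifford_group n" for C
    using clifford_groupD(1)[OF that] by (rule unitary_group_transpose)
  have FCi: "integrable \<mu> (\<lambda>U. ?F (U * transpose_mat C))" if C: "C \<in> clifford_group n" for C
  proof -
    have i: "integrable \<mu> (\<lambda>U. (cmod (amp I (2 ^ n) (U * transpose_mat C) G))\<^sup>2)" for G
    proof (rule integrable_bounded)
      have "(\<lambda>U. amp I (2 ^ n) (U * transpose_mat C) G) \<in> borel_measurable \<mu>"
        using amp_measurable
        by (rule measurable_cong_unitary[rotated])
           (rule amp_mult_right[OF I unitary_groupD(1) unitary_groupD(1)[OF trC[OF C]]])
      then show "(\<lambda>U. (cmod (amp I (2 ^ n) (U * transpose_mat C) G))\<^sup>2) \<in> borel_measurable \<mu>" by measurable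
      fix U assume "U \<in> unitary_group (2 ^ n)"
      from amp_norm_le[OF unitary_group_mult[OF this trC[OF C]], of I G]
      show "norm ((cmod (amp I (2 ^ n) (U * transpose_mat C) G))\<^sup>2) \<le> (\<Sum>y\<in>?X. \<Sum>x\<in>?X. cmod (G y x))\<^sup>2"
        by (simp add: power_mono)
    qed
    show ?thesis
    proof (intro Bochner_Integration.integrable_sum)
      fix z assume "z \<in> ?X - ?L"
      then show "integrable \<mu> (\<lambda>U. (cmod (\<Sum>w\<in>?X. tker I (U * transpose_mat C) w z * h w))\<^sup>2)"
        using i[of "\<lambda>y x. if x = z then h y else 0"] by (simp add: amp_single_column[OF I])
    qed
  qed
  \<comment> \<open>By invariance each translate has the same integral, so a Clifford average may be
    inserted.\<close>
  have "(\<integral>U. ?F U \<partial>\<mu>) = cl_avg n (\<lambda>C. \<integral>U. ?F U \<partial>\<mu>)" by (simp add: cl_avg_const)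
  also have "\<dots> = cl_avg n (\<lambda>C. \<integral>U. ?F (U * transpose_mat C) \<partial>\<mu>)"
    using borel_measurable_integrable[OF Fi]
    by (intro cl_avg_cong haar_mult_right[OF haar, symmetric] trC)
  also have "\<dots> = (\<integral>U. cl_avg n (\<lambda>C. ?F (U * transpose_mat C)) \<partial>\<mu>)"
    using FCi by (intro integral_cl_avg(1)[symmetric])
  also have "\<dots> \<le> (\<integral>U. ?R \<partial>\<mu>)"
  proof (rule integral_mono_AE)
    show "integrable \<mu> (\<lambda>U. cl_avg n (\<lambda>C. ?F (U * transpose_mat C)))"
      using FCi by (intro integral_cl_avg(2))
    show "AE U in \<mu>. cl_avg n (\<lambda>C. ?F (U * transpose_mat C)) \<le> ?R"
      using AE_unitary
    proof eventually_elim
      case (elim U)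
      have "cl_avg n (\<lambda>C. ?F (U * transpose_mat C)) =
         cl_avg n (\<lambda>C. \<Sum>z\<in>?X - ?L. (cmod (\<Sum>v\<in>?X. tker I C z v * (\<Sum>w\<in>?X. tker I U w v * h w)))\<^sup>2)"
        by (rule cl_avg_cong) (rule step[OF elim])
      also have "\<dots> \<le> collision_rate (card I) (2 ^ n) * (\<Sum>v\<in>?X. (cmod (\<Sum>w\<in>?X. tker I U w v * h w))\<^sup>2)"
        by (rule clifford_collision[OF I])
      also have "\<dots> = ?R" by (simp only: transposed_isometry[OF I elim])
      finally show ?case .
    qed
  qed simp
  finally show ?thesis by (simp add: prob_space)
qed

text \<open>The P F formula with \<open>z\<close> running over all tuples. Unlike the sum over
  injective \<open>z\<close>, this sum is preserved when a unitary acts on \<open>z\<close>.\<close>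

definition full_moment :: "'k set \<Rightarrow> (('k \<Rightarrow> nat) \<Rightarrow> ('k \<Rightarrow> nat) \<Rightarrow> complex) \<Rightarrow> real" where
  "full_moment I G = pf_weight I (2 ^ n) * (\<Sum>x\<in>inj_idx I (2 ^ n). \<Sum>z\<in>idx I (2 ^ n). (cmod (hsum I G z x))\<^sup>2)"

lemma pf_weight_nonneg: "0 \<le> pf_weight I d"
  by (simp add: pf_weight_def)

lemma pf_le_full_moment:
  assumes "finite I" "\<And>y x. x \<in> idx I (2 ^ n) \<Longrightarrow> x \<notin> inj_idx I (2 ^ n) \<Longrightarrow> G y x = 0"
  shows "pf_avg (2 ^ n) (\<lambda>U. (cmod (amp I (2 ^ n) U G))\<^sup>2) \<le> full_moment I G"
proof -
  have "pf_avg (2 ^ n) (\<lambda>U. (cmod (amp I (2 ^ n) U G))\<^sup>2) =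
    pf_weight I (2 ^ n) * (\<Sum>x\<in>inj_idx I (2 ^ n). \<Sum>z\<in>inj_idx I (2 ^ n). (cmod (hsum I G z x))\<^sup>2)"
    by (rule pf_second_moment[OF assms(1)]) (rule assms(2))
  also have "\<dots> \<le> full_moment I G"
    unfolding full_moment_def using assms(1)
    by (intro mult_left_mono sum_mono sum_mono2 pf_weight_nonneg inj_idx_subset) auto
  finally show ?thesis .
qed

text \<open>By invariance one may insert a random permutation and sign operator on the right; it turns
  the Haar moment into a sum over injective \<open>z\<close> that differs from the full sum only by collisions.\<close>

lemma haar_amp_bounds:
  assumes I: "finite I" and G: "\<And>y x. x \<in> idx I (2 ^ n) \<Longrightarrow> x \<notin> inj_idx I (2 ^ n) \<Longrightarrow> G y x = 0"
  shows "(\<integral>U. (cmod (amp I (2 ^ n) U G))\<^sup>2 \<partial>\<mu>) \<le> full_moment I G"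
    and "(1 - collision_rate (card I) (2 ^ n)) * full_moment I G \<le> (\<integral>U. (cmod (amp I (2 ^ n) U G))\<^sup>2 \<partial>\<mu>)"
proof -
  let ?d = "2 ^ n :: nat"
  let ?X = "idx I ?d" and ?L = "inj_idx I ?d" and ?\<kappa> = "pf_weight I ?d" and ?\<delta> = "collision_rate (card I) ?d"
  let ?g = "\<lambda>U z x. (cmod (\<Sum>w\<in>?X. tker I U w z * hsum I G w x))\<^sup>2"
  let ?UG = "\<lambda>U w x. \<Sum>y\<in>?X. tker I U y w * G y x"
  let ?b = "\<integral>U. (cmod (amp I ?d U G))\<^sup>2 \<partial>\<mu>"
  have gi: "integrable \<mu> (\<lambda>U. ?g U z x)" if "z \<in> ?X" for z x
    using that by (intro integrable_column_sum I)
  have "?b = pf_avg ?d (\<lambda>R. ?b)" by (simp add: pf_avg_const)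
  also have "\<dots> = pf_avg ?d (\<lambda>R. \<integral>U. (cmod (amp I ?d (U * R) G))\<^sup>2 \<partial>\<mu>)"
    by (intro pf_avg_cong haar_amp_mult_right[symmetric])
  also have "\<dots> = pf_avg ?d (\<lambda>R. \<integral>U. (cmod (amp I ?d U (\<lambda>y w. \<Sum>x\<in>?X. tker I R w x * G y x)))\<^sup>2 \<partial>\<mu>)"
    by (intro pf_avg_cong integral_amp_cong amp_mult_right[OF I] unitary_groupD(1))
  also have "\<dots> = (\<integral>U. pf_avg ?d (\<lambda>R. (cmod (amp I ?d U (\<lambda>y w. \<Sum>x\<in>?X. tker I R w x * G y x)))\<^sup>2) \<partial>\<mu>)"
    by (rule integral_pf_avg[symmetric]) (rule integrable_amp)
  also have "\<dots> = (\<integral>U. ?\<kappa> * (\<Sum>x\<in>?L. \<Sum>z\<in>?L. ?g U z x) \<partial>\<mu>)"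
  proof (rule integral_cong_AE)
    show "(\<lambda>U. pf_avg ?d (\<lambda>R. (cmod (amp I ?d U (\<lambda>y w. \<Sum>x\<in>?X. tker I R w x * G y x)))\<^sup>2)) \<in> borel_measurable \<mu>"
      unfolding pf_avg_def
      by (intro borel_measurable_divide borel_measurable_sum borel_measurable_const
          borel_measurable_integrable[OF integrable_amp])
    show "(\<lambda>U. ?\<kappa> * (\<Sum>x\<in>?L. \<Sum>z\<in>?L. ?g U z x)) \<in> borel_measurable \<mu>"
      using inj_idx_subset[of I ?d]
      by (intro borel_measurable_times borel_measurable_sum borel_measurable_const
          borel_measurable_integrable[OF gi]) auto
    show "AE U in \<mu>. pf_avg ?d (\<lambda>R. (cmod (amp I ?d U (\<lambda>y w. \<Sum>x\<in>?X. tker I R w x * G y x)))\<^sup>2) =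
        ?\<kappa> * (\<Sum>x\<in>?L. \<Sum>z\<in>?L. ?g U z x)"
      using AE_unitary
    proof eventually_elim
      case (elim U)
      \<comment> \<open>The amplitude of \<open>U * R\<close> is now read as a function of
        \<open>R\<close>. The coefficients \<open>?UG U\<close> still vanish at non-injective
        inputs, because \<open>U\<close> acts on the output slot only, so the second moment formula
        applies for each \<open>U\<close>.\<close>
      have "amp I ?d U (\<lambda>y w. \<Sum>x\<in>?X. tker I R w x * G y x) = amp I ?d R (?UG U)" if "R \<in> unitary_group ?d" for R
        using amp_mult_right[OF I unitary_groupD(1)[OF elim] unitary_groupD(1)[OF that]]
          amp_mult_left[OF I unitary_groupD(1)[OF elim] unitary_groupD(1)[OF that]] by metis
      then have "pf_avg ?d (\<lambda>R. (cmod (amp I ?d U (\<lambda>y w. \<Sum>x\<in>?X. tker I R w x * G y x)))\<^sup>2) =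
        pf_avg ?d (\<lambda>R. (cmod (amp I ?d R (?UG U)))\<^sup>2)" by (intro pf_avg_cong) simp
      also have "\<dots> = ?\<kappa> * (\<Sum>x\<in>?L. \<Sum>z\<in>?L. (cmod (hsum I (?UG U) z x))\<^sup>2)"
        by (rule pf_second_moment[OF I]) (simp add: G)
      finally show ?case by (simp only: hsum_left_action[OF I])
    qed
  qed
  also have "\<dots> = ?\<kappa> * (\<Sum>x\<in>?L. \<Sum>z\<in>?L. \<integral>U. ?g U z x \<partial>\<mu>)"
  proof -
    have "z \<in> ?X" if "z \<in> ?L" for z using that inj_idx_subset by blast
    then show ?thesis using gi by simp
  qed
  finally have b: "?b = ?\<kappa> * (\<Sum>x\<in>?L. \<Sum>z\<in>?L. \<integral>U. ?g U z x \<partial>\<mu>)" .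
  \<comment> \<open>Over all \<open>z\<close> the total is the same for every unitary
    \<open>U\<close>, so its integral is exact and only the non-injective \<open>z\<close> need an
    estimate.\<close>
  have full: "(\<Sum>z\<in>?X. \<integral>U. ?g U z x \<partial>\<mu>) = (\<Sum>w\<in>?X. (cmod (hsum I G w x))\<^sup>2)" for x
  proof -
    have "(\<Sum>z\<in>?X. \<integral>U. ?g U z x \<partial>\<mu>) = (\<integral>U. (\<Sum>z\<in>?X. ?g U z x) \<partial>\<mu>)" using gi by simp
    also have "\<dots> = (\<integral>U. (\<Sum>w\<in>?X. (cmod (hsum I G w x))\<^sup>2) \<partial>\<mu>)"
    proof (rule integral_cong_AE)
      show "(\<lambda>U. \<Sum>z\<in>?X. ?g U z x) \<in> borel_measurable \<mu>"
        by (intro borel_measurable_sum borel_measurable_integrable[OF gi])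
      show "AE U in \<mu>. (\<Sum>z\<in>?X. ?g U z x) = (\<Sum>w\<in>?X. (cmod (hsum I G w x))\<^sup>2)"
        using AE_unitary by eventually_elim (rule transposed_isometry[OF I])
    qed simp
    finally show ?thesis by (simp add: prob_space)
  qed
  have coll: "(\<Sum>z\<in>?X - ?L. \<integral>U. ?g U z x \<partial>\<mu>) \<le> ?\<delta> * (\<Sum>w\<in>?X. (cmod (hsum I G w x))\<^sup>2)" for x
  proof -
    have "(\<Sum>z\<in>?X - ?L. \<integral>U. ?g U z x \<partial>\<mu>) = (\<integral>U. (\<Sum>z\<in>?X - ?L. ?g U z x) \<partial>\<mu>)" using gi by simp
    also have "\<dots> \<le> ?\<delta> * (\<Sum>w\<in>?X. (cmod (hsum I G w x))\<^sup>2)" by (rule haar_column_collision[OF I])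
    finally show ?thesis .
  qed
  have split: "(\<Sum>z\<in>?L. \<integral>U. ?g U z x \<partial>\<mu>) = (\<Sum>w\<in>?X. (cmod (hsum I G w x))\<^sup>2) - (\<Sum>z\<in>?X - ?L. \<integral>U. ?g U z x \<partial>\<mu>)" for x
    using sum.subset_diff[OF inj_idx_subset finite_idx[OF I], of "\<lambda>z. \<integral>U. ?g U z x \<partial>\<mu>" ?d] full[of x] by simp
  show "?b \<le> full_moment I G"
    unfolding b full_moment_def split
    by (intro mult_left_mono sum_mono pf_weight_nonneg) (simp add: sum_nonneg)
  have "(1 - ?\<delta>) * full_moment I G = ?\<kappa> * (\<Sum>x\<in>?L. (1 - ?\<delta>) * (\<Sum>w\<in>?X. (cmod (hsum I G w x))\<^sup>2))"
    unfolding full_moment_def by (simp only: sum_distrib_left mult_ac)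
  also have "\<dots> \<le> ?b"
    unfolding b split using coll
    by (intro mult_left_mono sum_mono pf_weight_nonneg) (simp add: algebra_simps)
  finally show "(1 - ?\<delta>) * full_moment I G \<le> ?b" .
qed

end

subsection \<open>Quadratic forms of twirled pure states\<close>

definition encode :: "nat \<Rightarrow> nat \<Rightarrow> (nat \<Rightarrow> nat) \<Rightarrow> nat" where
  "encode d t = inv_into {..<d ^ t} (digits d t)"

text \<open>A vector of \<open>\<complex>\<^bsup>D\<^esup> \<otimes> \<complex>\<^bsup>D\<^esup>\<close>, \<open>D = d\<^bsup>t\<^esup>\<close>, enters as a function of an index function and
  an ancilla index. The ancilla is traced out in \<open>coupling\<close>, so that
  \<open>\<langle>u|(R\<^bsup>\<otimes>t\<^esup> \<otimes> 1)|\<Phi>\<rangle> = amp R (coupling u \<Phi>)\<close>.\<close>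

definition coupling ::
  "nat \<Rightarrow> nat \<Rightarrow> (nat \<Rightarrow> complex) \<Rightarrow> ((nat \<Rightarrow> nat) \<Rightarrow> nat \<Rightarrow> complex) \<Rightarrow> (nat \<Rightarrow> nat) \<Rightarrow> (nat \<Rightarrow> nat) \<Rightarrow> complex" where
  "coupling d t u \<Phi> y x = (\<Sum>a<d ^ t. cnj (u (encode d t y * d ^ t + a)) * \<Phi> x a)"

definition state_norm2 :: "nat \<Rightarrow> nat \<Rightarrow> ((nat \<Rightarrow> nat) \<Rightarrow> nat \<Rightarrow> complex) \<Rightarrow> real" where
  "state_norm2 d t \<Phi> = (\<Sum>x\<in>idx {..<t} d. \<Sum>a<d ^ t. (cmod (\<Phi> x a))\<^sup>2)"

abbreviation state_amp ::
  "nat \<Rightarrow> nat \<Rightarrow> complex mat \<Rightarrow> (nat \<Rightarrow> complex) \<Rightarrow> ((nat \<Rightarrow> nat) \<Rightarrow> nat \<Rightarrow> complex) \<Rightarrow> complex" where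
  "state_amp d t R u \<Phi> \<equiv> amp {..<t} d R (coupling d t u \<Phi>)"

lemma sum_idx_digits:
  assumes "d > 0"
  shows "(\<Sum>x\<in>idx {..<t} d. f x) = (\<Sum>i<d ^ t. f (digits d t i))"
  by (rule sum.reindex_bij_betw[OF bij_betw_digits[OF assms], symmetric])

lemma encode_digits: "d > 0 \<Longrightarrow> i < d ^ t \<Longrightarrow> encode d t (digits d t i) = i"
  unfolding encode_def using bij_betw_digits[of d t] by (intro inv_into_f_f) (auto simp: bij_betw_def)

text \<open>Entry \<open>r\<close> of the vector after the tensor power of \<open>R\<close> has
  acted on the system; the quotient of \<open>r\<close> is the system index and the remainder the
  ancilla index.\<close>

definition evolved ::
  "nat \<Rightarrow> nat \<Rightarrow> complex mat \<Rightarrow> ((nat \<Rightarrow> nat) \<Rightarrow> nat \<Rightarrow> complex) \<Rightarrow> nat \<Rightarrow> complex" where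
  "evolved d t R \<Phi> r = (\<Sum>x\<in>idx {..<t} d. tker {..<t} R (digits d t (r div d ^ t)) x * \<Phi> x (r mod d ^ t))"

lemma amp_coupling:
  assumes "d > 0"
  shows "state_amp d t R u \<Phi> = (\<Sum>r<d ^ t * d ^ t. cnj (u r) * evolved d t R \<Phi> r)"
proof -
  let ?D = "d ^ t" and ?X = "idx {..<t} d"
  have "state_amp d t R u \<Phi> =
      (\<Sum>i<?D. \<Sum>x\<in>?X. \<Sum>a<?D. tker {..<t} R (digits d t i) x * (cnj (u (i * ?D + a)) * \<Phi> x a))"
    unfolding amp_def coupling_def sum_distrib_left
    by (rule trans[OF sum_idx_digits[OF assms]]) (intro sum.cong refl, simp add: encode_digits[OF assms])
  also have "\<dots> = (\<Sum>i<?D. \<Sum>a<?D. \<Sum>x\<in>?X. tker {..<t} R (digits d t i) x * (cnj (u (i * ?D + a)) * \<Phi> x a))"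
    by (rule sum.cong[OF refl], rule sum.swap)
  also have "\<dots> = (\<Sum>i<?D. \<Sum>a<?D. cnj (u (i * ?D + a)) * evolved d t R \<Phi> (i * ?D + a))"
    unfolding evolved_def sum_distrib_left
    by (intro sum.cong refl) (simp add: div_mod_add_mult mult_ac)
  finally show ?thesis by (simp only: sum_mult_lessThan)
qed

text \<open>Parseval in the basis of columns of \<open>P\<close>, followed by the isometry of the
  tensor power. The value does not depend on \<open>R\<close>, so every average over unitaries has
  this same total.\<close>

lemma coupling_parseval:
  assumes d: "d > 0" and R: "R \<in> unitary_group d" and P: "P \<in> unitary_group (d ^ t * d ^ t)"
  shows "(\<Sum>k<d ^ t * d ^ t. (cmod (state_amp d t R (\<lambda>r. P $$ (r, k)) \<Phi>))\<^sup>2) = state_norm2 d t \<Phi>"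
proof -
  let ?D = "d ^ t" and ?X = "idx {..<t} d"
  have "(\<Sum>k<?D * ?D. (cmod (state_amp d t R (\<lambda>r. P $$ (r, k)) \<Phi>))\<^sup>2) =
     (\<Sum>r<?D * ?D. (cmod (evolved d t R \<Phi> r))\<^sup>2)"
    unfolding amp_coupling[OF d]
    by (rule orthonormal_kernel_isometry) (auto simp: unitary_row_orthonormal[OF P])
  also have "\<dots> = (\<Sum>i<?D. \<Sum>a<?D. (cmod (\<Sum>x\<in>?X. tker {..<t} R (digits d t i) x * \<Phi> x a))\<^sup>2)"
    unfolding sum_mult_lessThan evolved_def by (intro sum.cong refl) (simp add: div_mod_add_mult)
  also have "\<dots> = (\<Sum>a<?D. \<Sum>y\<in>?X. (cmod (\<Sum>x\<in>?X. tker {..<t} R y x * \<Phi> x a))\<^sup>2)"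
    by (subst sum.swap) (rule sum.cong[OF refl], rule sum_idx_digits[OF d, symmetric])
  also have "\<dots> = (\<Sum>a<?D. \<Sum>x\<in>?X. (cmod (\<Phi> x a))\<^sup>2)"
    by (rule sum.cong[OF refl], rule tker_isometry[OF _ _ R]) auto
  also have "\<dots> = state_norm2 d t \<Phi>" unfolding state_norm2_def by (rule sum.swap)
  finally show ?thesis .
qed

lemma amp_add: "amp I d U (\<lambda>y x. G y x + G' y x) = amp I d U G + amp I d U G'"
  by (simp add: amp_def distrib_left sum.distrib)

lemma coupling_add:
  "coupling d t u (\<lambda>x a. \<Phi> x a + \<Phi>' x a) = (\<lambda>y x. coupling d t u \<Phi> y x + coupling d t u \<Phi>' y x)"
  by (simp add: coupling_def distrib_left sum.distrib fun_eq_iff)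

definition kernel_act :: "nat \<Rightarrow> nat \<Rightarrow> complex mat \<Rightarrow> ((nat \<Rightarrow> nat) \<Rightarrow> nat \<Rightarrow> complex) \<Rightarrow> (nat \<Rightarrow> nat) \<Rightarrow> nat \<Rightarrow> complex" where
  "kernel_act d t C \<Phi> x a = (\<Sum>w\<in>idx {..<t} d. tker {..<t} C x w * \<Phi> w a)"

text \<open>Moves a Clifford factor from the operator into the state, where its collision mass can
  be measured.\<close>

lemma amp_mult_coupling:
  assumes "R \<in> carrier_mat d d" "C \<in> carrier_mat d d"
  shows "state_amp d t (R * C) u \<Phi> = state_amp d t R u (kernel_act d t C \<Phi>)"
proof -
  have "(\<Sum>x\<in>idx {..<t} d. tker {..<t} C w x * coupling d t u \<Phi> y x) = coupling d t u (kernel_act d t C \<Phi>) y w" for y w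
  proof -
    have "(\<Sum>x\<in>idx {..<t} d. tker {..<t} C w x * coupling d t u \<Phi> y x) =
       (\<Sum>x\<in>idx {..<t} d. \<Sum>a<d ^ t. cnj (u (encode d t y * d ^ t + a)) * (tker {..<t} C w x * \<Phi> x a))"
      unfolding coupling_def sum_distrib_left by (intro sum.cong refl) (simp add: mult_ac)
    then show ?thesis
      unfolding coupling_def kernel_act_def by (subst (asm) sum.swap) (simp only: sum_distrib_left)
  qed
  then show ?thesis by (simp add: amp_mult_right[OF _ assms])
qed

lemma state_norm2_kernel_act:
  assumes "C \<in> unitary_group d"
  shows "state_norm2 d t (kernel_act d t C \<Phi>) = state_norm2 d t \<Phi>"
proof -
  have "(\<Sum>a<d ^ t. \<Sum>x\<in>idx {..<t} d. (cmod (kernel_act d t C \<Phi> x a))\<^sup>2) = (\<Sum>a<d ^ t. \<Sum>x\<in>idx {..<t} d. (cmod (\<Phi> x a))\<^sup>2)"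
    unfolding kernel_act_def by (rule sum.cong[OF refl], rule tker_isometry[OF _ _ assms]) auto
  then show ?thesis unfolding state_norm2_def by (simp only: sum.swap[of _ "{..<d ^ t}" "idx {..<t} d"])
qed

definition vec_state :: "nat \<Rightarrow> nat \<Rightarrow> complex vec \<Rightarrow> (nat \<Rightarrow> nat) \<Rightarrow> nat \<Rightarrow> complex" where
  "vec_state d t \<psi> x a = vec_index \<psi> (encode d t x * d ^ t + a)"

lemma state_norm2_vec_state:
  assumes d: "d > 0" and \<psi>: "\<psi> \<in> carrier_vec (d ^ t * d ^ t)" "\<psi> \<bullet>c \<psi> = 1"
  shows "state_norm2 d t (vec_state d t \<psi>) = 1"
proof -
  let ?D = "d ^ t"
  have "state_norm2 d t (vec_state d t \<psi>) = (\<Sum>i<?D. \<Sum>a<?D. (cmod (vec_index \<psi> (i * ?D + a)))\<^sup>2)"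
    unfolding state_norm2_def sum_idx_digits[OF d] vec_state_def
    by (intro sum.cong refl) (simp add: encode_digits[OF d])
  also have "\<dots> = (\<Sum>r<?D * ?D. (cmod (vec_index \<psi> r))\<^sup>2)" by (simp only: sum_mult_lessThan)
  finally have "complex_of_real (state_norm2 d t (vec_state d t \<psi>)) = (\<Sum>r<?D * ?D. vec_index \<psi> r * cnj (vec_index \<psi> r))"
    by (simp only: of_real_sum complex_norm_square)
  also have "\<dots> = \<psi> \<bullet>c \<psi>" using \<psi>(1) by (auto simp: scalar_prod_def lessThan_atLeast0)
  finally show ?thesis using \<psi>(2) by (simp add: of_real_eq_1_iff)
qed

definition basis_fun :: "nat \<Rightarrow> nat \<Rightarrow> complex" where
  "basis_fun r s = (if s = r then 1 else 0)"

text \<open>An entry of the evolved vector is itself an amplitude, so entries of the twirled state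
  inherit measurability and integrability from \<open>amp\<close>.\<close>

lemma evolved_eq_amp:
  assumes "d > 0" "r < d ^ t * d ^ t"
  shows "state_amp d t R (basis_fun r) \<Phi> = evolved d t R \<Phi> r"
proof -
  have "(\<Sum>s<d ^ t * d ^ t. cnj (basis_fun r s) * evolved d t R \<Phi> s) = (\<Sum>s<d ^ t * d ^ t. if s = r then evolved d t R \<Phi> r else 0)"
    by (rule sum.cong) (auto simp: basis_fun_def)
  then show ?thesis unfolding amp_coupling[OF assms(1)] using assms(2) by simp
qed

text \<open>The matrix in the middle is the block that \<open>tensor_id\<close> cuts out for the
  ancilla pair of \<open>r\<close> and \<open>s\<close>. As \<open>ket_bra\<close> has rank one,
  each block is an outer product and its conjugation splits into two evolved entries.\<close>

lemma tensor_conjugation_index: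
  assumes d: "d > 0" and R: "R \<in> carrier_mat d d" and \<psi>: "\<psi> \<in> carrier_vec (d ^ t * d ^ t)"
    and r: "r < d ^ t * d ^ t" and s: "s < d ^ t * d ^ t"
  shows "(tensor_pow t R * mat (d ^ t) (d ^ t) (\<lambda>(i, j). ket_bra \<psi> $$ (i * d ^ t + r mod d ^ t, j * d ^ t + s mod d ^ t)) *
      mat_adjoint (tensor_pow t R)) $$ (r div d ^ t, s div d ^ t)
    = evolved d t R (vec_state d t \<psi>) r * cnj (evolved d t R (vec_state d t \<psi>) s)"
proof -
  let ?D = "d ^ t" and ?T = "tensor_pow t R"
  define B where "B = mat ?D ?D (\<lambda>(i, j). ket_bra \<psi> $$ (i * ?D + r mod ?D, j * ?D + s mod ?D))"
  have D: "?D > 0" using d by simp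
  note T = tensor_pow_carrier[OF R, of t]
  note rd = div_mod_lessThan_mult[OF r] and sd = div_mod_lessThan_mult[OF s]
  have Bc: "B \<in> carrier_mat ?D ?D" by (simp add: B_def)
  have Bi: "B $$ (i, j) = vec_index \<psi> (i * ?D + r mod ?D) * cnj (vec_index \<psi> (j * ?D + s mod ?D))" if "i < ?D" "j < ?D" for i j
    using that \<psi> add_mult_lessThan[OF that(1) rd(2)] add_mult_lessThan[OF that(2) sd(2)]
    by (simp add: B_def ket_bra_def)
  have ev: "evolved d t R (vec_state d t \<psi>) q = (\<Sum>i<?D. ?T $$ (q div ?D, i) * vec_index \<psi> (i * ?D + q mod ?D))"
    if "q < ?D * ?D" for q
    unfolding evolved_def sum_idx_digits[OF d] vec_state_def
    using div_mod_lessThan_mult[OF that]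
    by (intro sum.cong refl) (simp add: tensor_pow_index[OF R] encode_digits[OF d])
  have "(?T * B * mat_adjoint ?T) $$ (r div ?D, s div ?D) =
     (\<Sum>j<?D. (?T * B) $$ (r div ?D, j) * mat_adjoint ?T $$ (j, s div ?D))"
    using T Bc rd sd by (intro index_mult_mat_sum) auto
  also have "\<dots> = (\<Sum>j<?D. (\<Sum>i<?D. ?T $$ (r div ?D, i) * B $$ (i, j)) * cnj (?T $$ (s div ?D, j)))"
    using T Bc rd sd by (intro sum.cong refl arg_cong2[of _ _ _ _ "(*)"] index_mult_mat_sum) auto
  also have "\<dots> = (\<Sum>j<?D. \<Sum>i<?D. (?T $$ (r div ?D, i) * vec_index \<psi> (i * ?D + r mod ?D)) *
      cnj (?T $$ (s div ?D, j) * vec_index \<psi> (j * ?D + s mod ?D)))"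
    unfolding sum_distrib_right by (intro sum.cong refl) (simp add: Bi mult_ac)
  also have "\<dots> = (\<Sum>i<?D. ?T $$ (r div ?D, i) * vec_index \<psi> (i * ?D + r mod ?D)) *
      cnj (\<Sum>j<?D. ?T $$ (s div ?D, j) * vec_index \<psi> (j * ?D + s mod ?D))"
    unfolding cnj_sum sum_product by (rule sum.swap)
  finally show ?thesis unfolding ev[OF r] ev[OF s] B_def .
qed

definition twirled_state :: "nat \<Rightarrow> nat \<Rightarrow> complex mat measure \<Rightarrow> complex vec \<Rightarrow> complex mat" where
  "twirled_state d t \<nu> \<psi> = tensor_id (d ^ t) (twirl d t \<nu>) (ket_bra \<psi>)"

lemma twirled_state_carrier: "twirled_state d t \<nu> \<psi> \<in> carrier_mat (d ^ t * d ^ t) (d ^ t * d ^ t)"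
  by (simp add: twirled_state_def tensor_id_def)

context unitary_law
begin

lemma twirled_state_index:
  assumes d: "d > 0" and \<psi>: "\<psi> \<in> carrier_vec (d ^ t * d ^ t)"
    and r: "r < d ^ t * d ^ t" and s: "s < d ^ t * d ^ t"
  shows "twirled_state d t \<nu> \<psi> $$ (r, s) =
    (\<integral>R. state_amp d t R (basis_fun r) (vec_state d t \<psi>) *
      cnj (state_amp d t R (basis_fun s) (vec_state d t \<psi>)) \<partial>\<nu>)"
proof -
  have "twirled_state d t \<nu> \<psi> $$ (r, s) = (\<integral>R. (tensor_pow t R *
      mat (d ^ t) (d ^ t) (\<lambda>(i, j). ket_bra \<psi> $$ (i * d ^ t + r mod d ^ t, j * d ^ t + s mod d ^ t)) *
      mat_adjoint (tensor_pow t R)) $$ (r div d ^ t, s div d ^ t) \<partial>\<nu>)"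
    using r s div_mod_lessThan_mult[OF r] div_mod_lessThan_mult[OF s]
    by (simp add: twirled_state_def tensor_id_def twirl_def del: index_mult_mat)
  also have "\<dots> = (\<integral>R. state_amp d t R (basis_fun r) (vec_state d t \<psi>) *
      cnj (state_amp d t R (basis_fun s) (vec_state d t \<psi>)) \<partial>\<nu>)"
  proof (rule integral_cong_unitary)
    show "(\<lambda>R. state_amp d t R (basis_fun r) (vec_state d t \<psi>) *
      cnj (state_amp d t R (basis_fun s) (vec_state d t \<psi>))) \<in> borel_measurable \<nu>"
      by (rule borel_measurable_integrable[OF integrable_amp_mult])
  qed (simp add: evolved_eq_amp[OF d] r s tensor_conjugation_index[OF d unitary_groupD(1) \<psi> r s] del: index_mult_mat)
  finally show ?thesis .
qed

lemma twirled_state_hermitian: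
  assumes "d > 0" "\<psi> \<in> carrier_vec (d ^ t * d ^ t)"
  shows "mat_adjoint (twirled_state d t \<nu> \<psi>) = twirled_state d t \<nu> \<psi>"
proof (rule eq_matI)
  note c = carrier_matD[OF twirled_state_carrier[of d t \<nu> \<psi>]]
  fix r s assume "r < dim_row (twirled_state d t \<nu> \<psi>)" "s < dim_col (twirled_state d t \<nu> \<psi>)"
  then have rs: "r < d ^ t * d ^ t" "s < d ^ t * d ^ t" by (simp_all add: c)
  have "cnj (twirled_state d t \<nu> \<psi> $$ (s, r)) = twirled_state d t \<nu> \<psi> $$ (r, s)"
    unfolding twirled_state_index[OF assms rs] twirled_state_index[OF assms rs(2,1)]
    by (subst integral_bounded_linear[OF bounded_linear_cnj integrable_amp_mult, symmetric]) (simp add: mult.commute)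
  then show "mat_adjoint (twirled_state d t \<nu> \<psi>) $$ (r, s) = twirled_state d t \<nu> \<psi> $$ (r, s)"
    using rs by (simp add: c)
qed (simp_all add: carrier_matD[OF twirled_state_carrier])

text \<open>Expanding the amplitude of \<open>u\<close> over \<open>basis_fun\<close> leaves
  finitely many integrable products of amplitudes, so the double sum passes through the
  integral.\<close>

lemma twirled_state_form:
  assumes d: "d > 0" and \<psi>: "\<psi> \<in> carrier_vec (d ^ t * d ^ t)"
  shows "(\<Sum>r<d ^ t * d ^ t. \<Sum>s<d ^ t * d ^ t. cnj (u r) * twirled_state d t \<nu> \<psi> $$ (r, s) * u s) =
    of_real (\<integral>R. (cmod (state_amp d t R u (vec_state d t \<psi>)))\<^sup>2 \<partial>\<nu>)"
proof -
  let ?N = "d ^ t * d ^ t"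
  let ?v = "\<lambda>r R. state_amp d t R (basis_fun r) (vec_state d t \<psi>)"
  have "of_real ((cmod (state_amp d t R u (vec_state d t \<psi>)))\<^sup>2) =
      (\<Sum>r<?N. \<Sum>s<?N. (cnj (u r) * u s) * (?v r R * cnj (?v s R)))" for R
  proof -
    have "state_amp d t R u (vec_state d t \<psi>) = (\<Sum>r<?N. cnj (u r) * ?v r R)"
      unfolding amp_coupling[OF d, of t R u] by (intro sum.cong refl) (simp add: evolved_eq_amp[OF d])
    then have "of_real ((cmod (state_amp d t R u (vec_state d t \<psi>)))\<^sup>2) =
      (\<Sum>r<?N. cnj (u r) * ?v r R) * cnj (\<Sum>r<?N. cnj (u r) * ?v r R)"
      by (simp only: complex_norm_square)
    then show ?thesis
      unfolding cnj_sum sum_product by (simp add: mult_ac)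
  qed
  then have "of_real (\<integral>R. (cmod (state_amp d t R u (vec_state d t \<psi>)))\<^sup>2 \<partial>\<nu>) =
      (\<integral>R. (\<Sum>r<?N. \<Sum>s<?N. (cnj (u r) * u s) * (?v r R * cnj (?v s R))) \<partial>\<nu>)"
    by (simp only: integral_complex_of_real[symmetric])
  also have "\<dots> = (\<Sum>r<?N. \<Sum>s<?N. (cnj (u r) * u s) * (\<integral>R. ?v r R * cnj (?v s R) \<partial>\<nu>))"
    by (subst Bochner_Integration.integral_sum,
        (intro Bochner_Integration.integrable_sum integrable_mult_right integrable_amp_mult),
        rule sum.cong[OF refl], subst Bochner_Integration.integral_sum,
        (intro integrable_mult_right integrable_amp_mult)) simp
  also have "\<dots> = (\<Sum>r<?N. \<Sum>s<?N. cnj (u r) * twirled_state d t \<nu> \<psi> $$ (r, s) * u s)"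
    by (intro sum.cong refl) (simp add: twirled_state_index[OF d \<psi>])
  finally show ?thesis ..
qed

end

lemma pf_avg_nonneg: "(\<And>R. 0 \<le> F R) \<Longrightarrow> 0 \<le> pf_avg d F"
  unfolding pf_avg_def by (intro divide_nonneg_nonneg sum_nonneg) auto

text \<open>The Clifford average is moved outermost: the state is split into injective and collision
  parts after \<open>C\<close> has acted, and the moment over P and F is taken with \<open>C\<close>
  fixed.\<close>

lemma expectation_pfc:
  fixes F :: "complex mat \<Rightarrow> real"
  shows "measure_pmf.expectation (pfc_ensemble n) F = cl_avg n (\<lambda>C. pf_avg (2 ^ n) (\<lambda>R. F (R * C)))"
proof -
  let ?d = "2 ^ n :: nat"
  have c: "clifford_classes n \<noteq> {}" "finite (clifford_classes n)"
    using clifford_classes_nonempty finite_clifford_classes by auto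
  have p: "perms {..<?d} \<noteq> {}" "finite (perms {..<?d})"
    using permutes_id[of "{..<?d}"] unfolding perms_def by (blast, simp add: finite_permutations)
  have s: "signs ?d \<noteq> {}" "finite (signs ?d)"
    by (auto simp: signs_def PiE_eq_empty_iff finite_PiE)
  have e: "pfc_ensemble n = bind_pmf (pmf_of_set (perms {..<?d})) (\<lambda>\<pi>. bind_pmf (pmf_of_set (signs ?d)) (\<lambda>f.
      bind_pmf (pmf_of_set (clifford_classes n)) (\<lambda>Q. return_pmf (perm_op ?d \<pi> * sign_op ?d f * representative Q))))"
    unfolding pfc_ensemble_def random_clifford_def perms_def signs_def clifford_classes_def representative_def
    by (simp add: bind_map_pmf)
  have "measure_pmf.expectation (pfc_ensemble n) F = (\<Sum>\<pi>\<in>perms {..<?d}. \<Sum>f\<in>signs ?d. \<Sum>Q\<in>clifford_classes n.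
     F (perm_op ?d \<pi> * sign_op ?d f * representative Q)) / (fact ?d * 2 ^ ?d * card (clifford_classes n))"
    unfolding e
    by (simp add: pmf_expectation_bind_pmf_of_set p s c card_perms card_signs sum_divide_distrib sum_distrib_left
        scaleR_conv_of_real divide_simps mult.assoc)
  also have "(\<Sum>\<pi>\<in>perms {..<?d}. \<Sum>f\<in>signs ?d. \<Sum>Q\<in>clifford_classes n. F (perm_op ?d \<pi> * sign_op ?d f * representative Q)) =
     (\<Sum>Q\<in>clifford_classes n. \<Sum>\<pi>\<in>perms {..<?d}. \<Sum>f\<in>signs ?d. F (perm_op ?d \<pi> * sign_op ?d f * representative Q))"
    by (rule sum_rotate3)
  finally show ?thesis
    by (simp add: cl_avg_def pf_avg_def sum_divide_distrib)
qed

lemma set_pfc_ensemble: "set_pmf (pfc_ensemble n) \<subseteq> unitary_group (2 ^ n)"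
proof
  let ?d = "2 ^ n :: nat"
  fix U assume "U \<in> set_pmf (pfc_ensemble n)"
  moreover have "set_pmf (pmf_of_set {\<pi>. \<pi> permutes {..<?d}}) = {\<pi>. \<pi> permutes {..<?d}}"
    using permutes_id[of "{..<?d}"] by (intro set_pmf_of_set finite_permutations) (blast, simp)
  moreover have "set_pmf (random_clifford n) \<subseteq> unitary_group ?d"
    using clifford_classes_nonempty[of n] finite_clifford_classes[of n] representative_clifford[of _ n] clifford_groupD(1)
    unfolding random_clifford_def clifford_classes_def representative_def by auto
  ultimately obtain \<pi> f C where "\<pi> permutes {..<?d}" "C \<in> unitary_group ?d" "U = perm_op ?d \<pi> * sign_op ?d f * C"
    unfolding pfc_ensemble_def by auto
  then show "U \<in> unitary_group ?d" using unitary_group_mult pf_unitary by blast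
qed

subsection \<open>Comparing the two moments\<close>

lemma pf_avg_sum: "pf_avg d (\<lambda>R. \<Sum>k\<in>K. F k R) = (\<Sum>k\<in>K. pf_avg d (F k))"
  unfolding pf_avg_def by (simp only: sum.swap[of _ K] sum_divide_distrib)

lemma pf_avg_add: "pf_avg d (\<lambda>R. F R + F' R) = pf_avg d F + pf_avg d F'"
  unfolding pf_avg_def by (simp add: sum.distrib add_divide_distrib)

lemma pf_avg_cmult: "pf_avg d (\<lambda>R. c * F R) = c * pf_avg d F"
  unfolding pf_avg_def by (simp add: sum_distrib_left[symmetric])

text \<open>Weighted arithmetic-geometric mean inequality for the cross term. The weight
  \<open>s\<close> stays free so that it can be matched to the small mass of \<open>q\<close>; the
  second bound is generous in \<open>q\<close> so that both share the same error terms.\<close>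

lemma norm_add_square_perturb:
  fixes p q :: complex
  assumes "s > 0"
  shows "(cmod (p + q))\<^sup>2 \<le> (1 + s) * (cmod p)\<^sup>2 + (1 + 1 / s) * (cmod q)\<^sup>2"
    and "(cmod p)\<^sup>2 \<le> (cmod (p + q))\<^sup>2 + s * (cmod p)\<^sup>2 + (1 + 1 / s) * (cmod q)\<^sup>2"
proof -
  have "0 \<le> (s * cmod p - cmod q)\<^sup>2 / s" using assms by simp
  also have "\<dots> = s * (cmod p)\<^sup>2 - 2 * cmod p * cmod q + (cmod q)\<^sup>2 / s"
    using assms by (simp add: power2_eq_square field_simps)
  finally have am: "2 * cmod p * cmod q \<le> s * (cmod p)\<^sup>2 + (cmod q)\<^sup>2 / s" by simp
  have "(cmod (p + q))\<^sup>2 \<le> (cmod p + cmod q)\<^sup>2" by (intro power_mono norm_triangle_ineq) simp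
  then show "(cmod (p + q))\<^sup>2 \<le> (1 + s) * (cmod p)\<^sup>2 + (1 + 1 / s) * (cmod q)\<^sup>2"
    using am by (simp add: power2_sum algebra_simps)
  have "\<bar>cmod p - cmod q\<bar> \<le> \<bar>cmod (p + q)\<bar>" using norm_triangle_ineq3[of p "- q"] by simp
  then have "(cmod p - cmod q)\<^sup>2 \<le> (cmod (p + q))\<^sup>2" by (simp only: abs_le_square_iff)
  then show "(cmod p)\<^sup>2 \<le> (cmod (p + q))\<^sup>2 + s * (cmod p)\<^sup>2 + (1 + 1 / s) * (cmod q)\<^sup>2"
    using am zero_le_power2[of "cmod q"] unfolding power2_diff distrib_right times_divide_eq_left mult_1
    by linarith
qed

section \<open>Splitting a state into injective and collision parts\<close>

definition inj_part :: "nat \<Rightarrow> nat \<Rightarrow> ((nat \<Rightarrow> nat) \<Rightarrow> nat \<Rightarrow> complex) \<Rightarrow> (nat \<Rightarrow> nat) \<Rightarrow> nat \<Rightarrow> complex" where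
  "inj_part d t \<Phi> x a = (if x \<in> inj_idx {..<t} d then \<Phi> x a else 0)"

definition collision_part :: "nat \<Rightarrow> nat \<Rightarrow> ((nat \<Rightarrow> nat) \<Rightarrow> nat \<Rightarrow> complex) \<Rightarrow> (nat \<Rightarrow> nat) \<Rightarrow> nat \<Rightarrow> complex" where
  "collision_part d t \<Phi> x a = (if x \<in> inj_idx {..<t} d then 0 else \<Phi> x a)"

lemma amp_parts:
  "state_amp d t R u \<Phi> =
    state_amp d t R u (inj_part d t \<Phi>) + state_amp d t R u (collision_part d t \<Phi>)"
proof -
  have "(\<lambda>x a. inj_part d t \<Phi> x a + collision_part d t \<Phi> x a) = \<Phi>"
    by (intro ext) (simp add: inj_part_def collision_part_def)
  then have "coupling d t u \<Phi> = coupling d t u (\<lambda>x a. inj_part d t \<Phi> x a + collision_part d t \<Phi> x a)"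
    by simp
  then show ?thesis by (simp only: coupling_add amp_add)
qed

lemma state_norm2_inj_part_le: "state_norm2 d t (inj_part d t \<Phi>) \<le> state_norm2 d t \<Phi>"
  unfolding state_norm2_def by (intro sum_mono) (simp add: inj_part_def)

text \<open>The Clifford unitary does not touch the ancilla, so the collision bound applies to each
  ancilla slice separately.\<close>

lemma cl_avg_collision_part:
  "cl_avg n (\<lambda>C. state_norm2 (2 ^ n) t (collision_part (2 ^ n) t (kernel_act (2 ^ n) t C \<Phi>)))
    \<le> collision_rate t (2 ^ n) * state_norm2 (2 ^ n) t \<Phi>"
proof -
  let ?d = "2 ^ n :: nat"
  let ?X = "idx {..<t} ?d" and ?L = "inj_idx {..<t} ?d"
  have "state_norm2 ?d t (collision_part ?d t (kernel_act ?d t C \<Phi>)) =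
     (\<Sum>a<?d ^ t. \<Sum>x\<in>?X - ?L. (cmod (\<Sum>w\<in>?X. tker {..<t} C x w * \<Phi> w a))\<^sup>2)" for C
  proof -
    have "state_norm2 ?d t (collision_part ?d t (kernel_act ?d t C \<Phi>)) =
       (\<Sum>a<?d ^ t. \<Sum>x\<in>?X. (cmod (collision_part ?d t (kernel_act ?d t C \<Phi>) x a))\<^sup>2)"
      unfolding state_norm2_def by (rule sum.swap)
    also have "\<dots> = (\<Sum>a<?d ^ t. \<Sum>x\<in>?X - ?L. (cmod (\<Sum>w\<in>?X. tker {..<t} C x w * \<Phi> w a))\<^sup>2)"
      by (rule sum.cong[OF refl], rule sum.mono_neutral_cong_right)
        (auto simp: collision_part_def kernel_act_def)
    finally show ?thesis .
  qed
  then have "cl_avg n (\<lambda>C. state_norm2 ?d t (collision_part ?d t (kernel_act ?d t C \<Phi>))) =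
     (\<Sum>a<?d ^ t. cl_avg n (\<lambda>C. \<Sum>x\<in>?X - ?L. (cmod (\<Sum>w\<in>?X. tker {..<t} C x w * \<Phi> w a))\<^sup>2))"
    by (simp only: cl_avg_sum)
  also have "\<dots> \<le> (\<Sum>a<?d ^ t. collision_rate t ?d * (\<Sum>w\<in>?X. (cmod (\<Phi> w a))\<^sup>2))"
    by (intro sum_mono clifford_collision[of "{..<t}", simplified])
  also have "\<dots> = collision_rate t ?d * state_norm2 ?d t \<Phi>"
    unfolding state_norm2_def by (subst sum.swap) (simp only: sum_distrib_left)
  finally show ?thesis .
qed

definition pf_moment :: "nat \<Rightarrow> nat \<Rightarrow> (nat \<Rightarrow> complex) \<Rightarrow> ((nat \<Rightarrow> nat) \<Rightarrow> nat \<Rightarrow> complex) \<Rightarrow> real" where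
  "pf_moment d t u \<Phi> = pf_avg d (\<lambda>R. (cmod (state_amp d t R u \<Phi>))\<^sup>2)"

lemma pf_moment_perturb:
  assumes "s > 0"
  shows "pf_moment d t u \<Phi> \<le> (1 + s) * pf_moment d t u (inj_part d t \<Phi>) + (1 + 1 / s) * pf_moment d t u (collision_part d t \<Phi>)"
    and "pf_moment d t u (inj_part d t \<Phi>) \<le> pf_moment d t u \<Phi> + s * pf_moment d t u (inj_part d t \<Phi>) + (1 + 1 / s) * pf_moment d t u (collision_part d t \<Phi>)"
  unfolding pf_moment_def pf_avg_cmult[symmetric] pf_avg_add[symmetric] amp_parts[of t d _ u \<Phi>]
  by (intro pf_avg_mono norm_add_square_perturb[OF assms])+

lemma sum_pf_moment:
  assumes "d > 0" "P \<in> unitary_group (d ^ t * d ^ t)"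
  shows "(\<Sum>k<d ^ t * d ^ t. pf_moment d t (\<lambda>r. P $$ (r, k)) \<Phi>) = state_norm2 d t \<Phi>"
proof -
  have "(\<Sum>k<d ^ t * d ^ t. pf_moment d t (\<lambda>r. P $$ (r, k)) \<Phi>) = pf_avg d (\<lambda>R. state_norm2 d t \<Phi>)"
    unfolding pf_moment_def pf_avg_sum[symmetric]
    by (rule pf_avg_cong) (rule coupling_parseval[OF assms(1) _ assms(2)])
  then show ?thesis by (simp add: pf_avg_const)
qed

context haar_law
begin

definition haar_moment :: "nat \<Rightarrow> (nat \<Rightarrow> complex) \<Rightarrow> ((nat \<Rightarrow> nat) \<Rightarrow> nat \<Rightarrow> complex) \<Rightarrow> real" where
  "haar_moment t u \<Phi> = (\<integral>U. (cmod (state_amp (2 ^ n) t U u \<Phi>))\<^sup>2 \<partial>\<mu>)"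

lemma haar_moment_perturb:
  assumes "s > 0"
  shows "haar_moment t u \<Phi> \<le> (1 + s) * haar_moment t u (inj_part (2 ^ n) t \<Phi>) + (1 + 1 / s) * haar_moment t u (collision_part (2 ^ n) t \<Phi>)"
    and "haar_moment t u (inj_part (2 ^ n) t \<Phi>) \<le> haar_moment t u \<Phi> + s * haar_moment t u (inj_part (2 ^ n) t \<Phi>) + (1 + 1 / s) * haar_moment t u (collision_part (2 ^ n) t \<Phi>)"
proof -
  let ?f = "\<lambda>\<Phi> U. (cmod (state_amp (2 ^ n) t U u \<Phi>))\<^sup>2"
  let ?\<Phi>1 = "inj_part (2 ^ n) t \<Phi>" and ?\<Phi>2 = "collision_part (2 ^ n) t \<Phi>"
  note p = norm_add_square_perturb[OF assms]
  have "(\<integral>U. ?f \<Phi> U \<partial>\<mu>) \<le> (\<integral>U. (1 + s) * ?f ?\<Phi>1 U + (1 + 1 / s) * ?f ?\<Phi>2 U \<partial>\<mu>)"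
    using p(1)[of "state_amp (2 ^ n) t _ u ?\<Phi>1" "state_amp (2 ^ n) t _ u ?\<Phi>2"]
    by (intro integral_mono Bochner_Integration.integrable_add integrable_mult_right integrable_amp)
      (simp only: amp_parts[of t "2 ^ n" _ u \<Phi>])
  then show "haar_moment t u \<Phi> \<le> (1 + s) * haar_moment t u ?\<Phi>1 + (1 + 1 / s) * haar_moment t u ?\<Phi>2"
    by (simp add: haar_moment_def integrable_amp)
  have "(\<integral>U. ?f ?\<Phi>1 U \<partial>\<mu>) \<le> (\<integral>U. ?f \<Phi> U + s * ?f ?\<Phi>1 U + (1 + 1 / s) * ?f ?\<Phi>2 U \<partial>\<mu>)"
    using p(2)[of "state_amp (2 ^ n) t _ u ?\<Phi>1" "state_amp (2 ^ n) t _ u ?\<Phi>2"]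
    by (intro integral_mono Bochner_Integration.integrable_add integrable_mult_right integrable_amp)
      (simp only: amp_parts[of t "2 ^ n" _ u \<Phi>])
  then show "haar_moment t u ?\<Phi>1 \<le> haar_moment t u \<Phi> + s * haar_moment t u ?\<Phi>1 + (1 + 1 / s) * haar_moment t u ?\<Phi>2"
    by (simp add: haar_moment_def integrable_amp)
qed

lemma sum_haar_moment:
  assumes "P \<in> unitary_group ((2 ^ n) ^ t * (2 ^ n) ^ t)"
  shows "(\<Sum>k<(2 ^ n) ^ t * (2 ^ n) ^ t. haar_moment t (\<lambda>r. P $$ (r, k)) \<Phi>) = state_norm2 (2 ^ n) t \<Phi>"
proof -
  let ?f = "\<lambda>k U. (cmod (state_amp (2 ^ n) t U (\<lambda>r. P $$ (r, k)) \<Phi>))\<^sup>2"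
  have "(\<Sum>k<(2 ^ n) ^ t * (2 ^ n) ^ t. haar_moment t (\<lambda>r. P $$ (r, k)) \<Phi>) = (\<integral>U. (\<Sum>k<(2 ^ n) ^ t * (2 ^ n) ^ t. ?f k U) \<partial>\<mu>)"
    unfolding haar_moment_def by (intro Bochner_Integration.integral_sum[symmetric] integrable_amp)
  also have "\<dots> = (\<integral>U. state_norm2 (2 ^ n) t \<Phi> \<partial>\<mu>)"
  proof (rule integral_cong_AE)
    show "AE U in \<mu>. (\<Sum>k<(2 ^ n) ^ t * (2 ^ n) ^ t. ?f k U) = state_norm2 (2 ^ n) t \<Phi>"
      using AE_unitary by eventually_elim (rule coupling_parseval[OF _ _ assms], simp_all)
    show "(\<lambda>U. \<Sum>k<(2 ^ n) ^ t * (2 ^ n) ^ t. ?f k U) \<in> borel_measurable \<mu>"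
      by (intro borel_measurable_sum borel_measurable_integrable[OF integrable_amp])
  qed simp
  finally show ?thesis by (simp add: prob_space)
qed

text \<open>Puts the Haar moment in the form of the P F C moment, so that the two can be compared
  for each Clifford unitary separately.\<close>

lemma haar_moment_clifford:
  assumes C: "C \<in> unitary_group (2 ^ n)"
  shows "haar_moment t u (kernel_act (2 ^ n) t C \<Phi>) = haar_moment t u \<Phi>"
proof -
  have "(\<integral>U. (cmod (state_amp (2 ^ n) t (U * C) u \<Phi>))\<^sup>2 \<partial>\<mu>) =
      haar_moment t u (kernel_act (2 ^ n) t C \<Phi>)"
    unfolding haar_moment_def
    by (intro integral_amp_cong amp_mult_coupling unitary_groupD(1) C)
  then show ?thesis by (simp only: haar_amp_mult_right[OF C] haar_moment_def)
qed

text \<open>A majorant of the moment difference that is linear in the moments, so that its sum over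
  a basis is exact. The first line compares the moments on the injective part, the second carries
  the cross terms and the third the collision part.\<close>

definition defect :: "nat \<Rightarrow> real \<Rightarrow> (nat \<Rightarrow> complex) \<Rightarrow> ((nat \<Rightarrow> nat) \<Rightarrow> nat \<Rightarrow> complex) \<Rightarrow> real" where
  "defect t s u \<Phi> = (let \<Phi>1 = inj_part (2 ^ n) t \<Phi>; \<Phi>2 = collision_part (2 ^ n) t \<Phi> in
    (1 + 4 * collision_rate t (2 ^ n)) * haar_moment t u \<Phi>1 - pf_moment (2 ^ n) t u \<Phi>1 +
    s * (pf_moment (2 ^ n) t u \<Phi>1 + haar_moment t u \<Phi>1) +
    (1 + 1 / s) * (pf_moment (2 ^ n) t u \<Phi>2 + haar_moment t u \<Phi>2))"

text \<open>On the injective part both moments lie below the full moment \<open>S\<close>, and the Haar moment is at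
  least \<open>(1 - \<delta>) S\<close>; the one-sided bound \<open>S - pf_moment\<close> costs nothing after summing over an
  orthonormal basis, because both moments then have the same sum.\<close>

lemma moment_difference_le_defect:
  assumes s: "s > 0" and \<delta>: "collision_rate t (2 ^ n) \<le> 1 / 2"
  shows "\<bar>pf_moment (2 ^ n) t u \<Phi> - haar_moment t u \<Phi>\<bar> \<le> defect t s u \<Phi>"
proof -
  let ?d = "2 ^ n :: nat"
  let ?\<Phi>1 = "inj_part ?d t \<Phi>" and ?\<Phi>2 = "collision_part ?d t \<Phi>" and ?\<delta> = "collision_rate t ?d"
  let ?G = "coupling ?d t u ?\<Phi>1"
  define a b S where "a = pf_moment ?d t u ?\<Phi>1" and "b = haar_moment t u ?\<Phi>1" and "S = full_moment {..<t} ?G"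
  have G0: "?G y x = 0" if "x \<notin> inj_idx {..<t} ?d" for y x
    using that by (simp add: coupling_def inj_part_def)
  have aS: "a \<le> S" unfolding a_def S_def pf_moment_def by (rule pf_le_full_moment) (auto simp: G0)
  have bS: "b \<le> S" "(1 - ?\<delta>) * S \<le> b"
    using haar_amp_bounds[of "{..<t}" ?G] G0 by (simp_all add: b_def S_def haar_moment_def)
  have \<delta>0: "0 \<le> ?\<delta>" by (simp add: collision_rate_def)
  have "0 \<le> b" unfolding b_def haar_moment_def by (intro Bochner_Integration.integral_nonneg) simp
  have "S \<le> (1 + 2 * ?\<delta>) * ((1 - ?\<delta>) * S)"
  proof -
    have "0 \<le> S" using \<open>0 \<le> b\<close> bS by simp
    \<comment> \<open>The product (1 + 2 \<delta>) (1 - \<delta>) exceeds 1 by \<delta> (1 - 2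
      \<delta>); this is where \<delta> at most 1/2 is used.\<close>
    then have "0 \<le> (?\<delta> * (1 - 2 * ?\<delta>)) * S" using \<delta> \<delta>0 by (intro mult_nonneg_nonneg) auto
    then show ?thesis by (simp add: algebra_simps)
  qed
  also have "\<dots> \<le> (1 + 2 * ?\<delta>) * b" using bS(2) \<delta>0 by (intro mult_left_mono) auto
  \<comment> \<open>From \<open>a\<close> \<le> (1 + 2 \<delta>) \<open>b\<close>, the case of
    \<open>a - b\<close> asks for 2 \<open>a\<close> \<le> (2 + 4 \<delta>) \<open>b\<close>; this
    doubling is the origin of the 4.\<close>
  finally have "\<bar>a - b\<bar> \<le> (1 + 4 * ?\<delta>) * b - a"
    using aS bS(1) by (simp add: algebra_simps abs_le_iff)
  then show ?thesis
    using pf_moment_perturb[OF s, of ?d t u \<Phi>] haar_moment_perturb[OF s, of t u \<Phi>]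
    unfolding defect_def Let_def a_def b_def by (simp add: algebra_simps abs_le_iff)
qed

text \<open>The leading terms cancel because both moments have the same total over a basis; only
  \<delta>, \<open>s\<close> and the collision mass are left.\<close>

lemma sum_defect:
  assumes P: "P \<in> unitary_group ((2 ^ n) ^ t * (2 ^ n) ^ t)"
  shows "(\<Sum>k<(2 ^ n) ^ t * (2 ^ n) ^ t. defect t s (\<lambda>r. P $$ (r, k)) \<Phi>) =
    (4 * collision_rate t (2 ^ n) + 2 * s) * state_norm2 (2 ^ n) t (inj_part (2 ^ n) t \<Phi>) +
    2 * (1 + 1 / s) * state_norm2 (2 ^ n) t (collision_part (2 ^ n) t \<Phi>)"
  unfolding defect_def Let_def sum.distrib sum_subtractf sum_distrib_left[symmetric]
    sum_haar_moment[OF P] sum_pf_moment[OF _ P, simplified] by (simp add: algebra_simps)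

text \<open>The majorant \<open>q\<close> is kept abstract because small and large t / sqrt d use
  different ones. It may depend on the Clifford unitary, and only its average has to be
  bounded.\<close>

lemma trace_norm_twirl_difference_le:
  assumes \<psi>: "\<psi> \<in> carrier_vec ((2 ^ n) ^ t * (2 ^ n) ^ t)"
    and q: "\<And>u C. C \<in> clifford_group n \<Longrightarrow>
      \<bar>pf_moment (2 ^ n) t u (kernel_act (2 ^ n) t C (vec_state (2 ^ n) t \<psi>)) -
        haar_moment t u (kernel_act (2 ^ n) t C (vec_state (2 ^ n) t \<psi>))\<bar> \<le> q u C"
    and K: "\<And>P. P \<in> unitary_group ((2 ^ n) ^ t * (2 ^ n) ^ t) \<Longrightarrow>
      cl_avg n (\<lambda>C. \<Sum>k<(2 ^ n) ^ t * (2 ^ n) ^ t. q (\<lambda>r. P $$ (r, k)) C) \<le> K"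
  shows "trace_norm (twirled_state (2 ^ n) t (measure_pmf (pfc_ensemble n)) \<psi> - twirled_state (2 ^ n) t \<mu> \<psi>) \<le> K"
proof -
  let ?d = "2 ^ n :: nat"
  let ?N = "?d ^ t * ?d ^ t" and ?p = "measure_pmf (pfc_ensemble n)" and ?\<Phi> = "vec_state ?d t \<psi>"
  let ?A = "twirled_state ?d t ?p \<psi>" and ?B = "twirled_state ?d t \<mu> \<psi>"
  interpret p: unitary_law ?p ?d by (rule pmf_unitary_law[OF set_pfc_ensemble])
  have d: "?d > 0" by simp
  note cA = twirled_state_carrier[of ?d t ?p \<psi>] and cB = twirled_state_carrier[of ?d t \<mu> \<psi>]
  show ?thesis
  proof (rule trace_norm_hermitian_le)
    show "?A - ?B \<in> carrier_mat ?N ?N" by (rule minus_carrier_mat[OF cB])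
    show "mat_adjoint (?A - ?B) = ?A - ?B"
    proof (rule eq_matI)
      fix i j assume "i < dim_row (?A - ?B)" "j < dim_col (?A - ?B)"
      then have ij: "i < ?N" "j < ?N" using cB by auto
      have "mat_adjoint ?A $$ (i, j) = ?A $$ (i, j)" "mat_adjoint ?B $$ (i, j) = ?B $$ (i, j)"
        using p.twirled_state_hermitian[OF d \<psi>] twirled_state_hermitian[OF d \<psi>] by simp_all
      then show "mat_adjoint (?A - ?B) $$ (i, j) = (?A - ?B) $$ (i, j)" using ij cA cB by simp
    qed (use cB in auto)
    fix u :: "nat \<Rightarrow> complex"
    have pfc: "(\<integral>R. (cmod (state_amp ?d t R u ?\<Phi>))\<^sup>2 \<partial>?p) =
       cl_avg n (\<lambda>C. pf_moment ?d t u (kernel_act ?d t C ?\<Phi>))"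
      unfolding expectation_pfc pf_moment_def
      by (intro cl_avg_cong pf_avg_cong) (simp add: amp_mult_coupling unitary_groupD(1) clifford_groupD(2))
    have hr: "(\<integral>R. (cmod (state_amp ?d t R u ?\<Phi>))\<^sup>2 \<partial>\<mu>) =
       cl_avg n (\<lambda>C. haar_moment t u (kernel_act ?d t C ?\<Phi>))"
    proof -
      have "cl_avg n (\<lambda>C. haar_moment t u (kernel_act ?d t C ?\<Phi>)) = cl_avg n (\<lambda>C. haar_moment t u ?\<Phi>)"
        by (intro cl_avg_cong haar_moment_clifford clifford_groupD(1))
      then show ?thesis by (simp add: cl_avg_const haar_moment_def)
    qed
    have "(\<Sum>i<?N. \<Sum>j<?N. cnj (u i) * (?A - ?B) $$ (i, j) * u j) =
       (\<Sum>i<?N. \<Sum>j<?N. cnj (u i) * ?A $$ (i, j) * u j - cnj (u i) * ?B $$ (i, j) * u j)"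
      using cA cB by (intro sum.cong refl) (simp add: algebra_simps)
    also have "\<dots> = of_real (cl_avg n (\<lambda>C. pf_moment ?d t u (kernel_act ?d t C ?\<Phi>)) - cl_avg n (\<lambda>C. haar_moment t u (kernel_act ?d t C ?\<Phi>)))"
      unfolding sum_subtractf p.twirled_state_form[OF d \<psi>] twirled_state_form[OF d \<psi>] pfc hr by simp
    finally have "cmod (\<Sum>i<?N. \<Sum>j<?N. cnj (u i) * (?A - ?B) $$ (i, j) * u j) =
       \<bar>cl_avg n (\<lambda>C. pf_moment ?d t u (kernel_act ?d t C ?\<Phi>)) - cl_avg n (\<lambda>C. haar_moment t u (kernel_act ?d t C ?\<Phi>))\<bar>"
      by (simp only: norm_of_real)
    also have "\<dots> \<le> cl_avg n (q u)"
    proof -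
      have "cl_avg n (\<lambda>C. pf_moment ?d t u (kernel_act ?d t C ?\<Phi>)) \<le> cl_avg n (\<lambda>C. haar_moment t u (kernel_act ?d t C ?\<Phi>) + q u C)"
        "cl_avg n (\<lambda>C. haar_moment t u (kernel_act ?d t C ?\<Phi>)) \<le> cl_avg n (\<lambda>C. pf_moment ?d t u (kernel_act ?d t C ?\<Phi>) + q u C)"
        using q[of _ u] by (intro cl_avg_mono, force simp: abs_le_iff)+
      then show ?thesis unfolding cl_avg_add by simp
    qed
    finally show "cmod (\<Sum>i<?N. \<Sum>j<?N. cnj (u i) * (?A - ?B) $$ (i, j) * u j) \<le> cl_avg n (q u)" .
  next
    fix P :: "complex mat" assume "P \<in> unitary_group ?N"
    from K[OF this] show "(\<Sum>k<?N. cl_avg n (q (\<lambda>i. P $$ (i, k)))) \<le> K" by (simp only: cl_avg_sum)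
  qed
qed

text \<open>With r = t / sqrt d the collision rate is 2 r^2, which is at most 1/2 exactly when r is
  at most 1/2. Beyond this threshold the trivial bound is already good enough.\<close>

lemma trace_norm_twirl_difference:
  assumes t: "t \<ge> 1" and \<psi>: "\<psi> \<in> carrier_vec ((2 ^ n) ^ t * (2 ^ n) ^ t)" "\<psi> \<bullet>c \<psi> = 1"
  shows "trace_norm (twirled_state (2 ^ n) t (measure_pmf (pfc_ensemble n)) \<psi> - twirled_state (2 ^ n) t \<mu> \<psi>)
    \<le> 12 * real t / sqrt (real (2 ^ n))"
proof -
  let ?d = "2 ^ n :: nat"
  let ?N = "?d ^ t * ?d ^ t" and ?\<Phi> = "vec_state ?d t \<psi>" and ?\<delta> = "collision_rate t ?d"
  define r where "r = real t / sqrt (real ?d)"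
  have r: "r > 0" using t by (simp add: r_def)
  have \<delta>: "?\<delta> = 2 * r\<^sup>2" by (simp add: collision_rate_def r_def power_divide)
  have N1: "state_norm2 ?d t ?\<Phi> = 1" by (rule state_norm2_vec_state[OF _ \<psi>]) simp
  have NC: "state_norm2 ?d t (kernel_act ?d t C ?\<Phi>) = 1" if "C \<in> clifford_group n" for C
    using state_norm2_kernel_act[OF clifford_groupD(1)[OF that]] N1 by simp
  have "trace_norm (twirled_state ?d t (measure_pmf (pfc_ensemble n)) \<psi> - twirled_state ?d t \<mu> \<psi>) \<le> 12 * r"
  proof (cases "r \<le> 1 / 2")
    case True
    have rr: "r\<^sup>2 \<le> r / 2" using mult_left_mono[OF True, of r] r by (simp add: power2_eq_square)
    then have \<delta>2: "?\<delta> \<le> 1 / 2" using True \<delta> by simp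
    show ?thesis
    proof (rule trace_norm_twirl_difference_le[OF \<psi>(1) moment_difference_le_defect[OF _ \<delta>2]])
      \<comment> \<open>The weight \<open>s\<close> is taken as \<open>2 * r\<close>: a collision
        mass of order r^2 makes \<open>s\<close> plus mass divided by \<open>s\<close> smallest for
        \<open>s\<close> of order r.\<close>
      show "2 * r > 0" using r by simp
      fix P :: "complex mat" assume P: "P \<in> unitary_group ?N"
      let ?N2 = "\<lambda>C. state_norm2 ?d t (collision_part ?d t (kernel_act ?d t C ?\<Phi>))"
      have "cl_avg n (\<lambda>C. \<Sum>k<?N. defect t (2 * r) (\<lambda>i. P $$ (i, k)) (kernel_act ?d t C ?\<Phi>)) \<le>
         cl_avg n (\<lambda>C. (4 * ?\<delta> + 4 * r) + (2 * (1 + 1 / (2 * r))) * ?N2 C)"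
      proof (rule cl_avg_mono)
        fix C assume C: "C \<in> clifford_group n"
        have "state_norm2 ?d t (inj_part ?d t (kernel_act ?d t C ?\<Phi>)) \<le> 1"
          using state_norm2_inj_part_le[of ?d t "kernel_act ?d t C ?\<Phi>"] NC[OF C] by simp
        moreover have "0 \<le> 4 * ?\<delta> + 2 * (2 * r)" using r by (simp add: \<delta>)
        ultimately have "(4 * ?\<delta> + 2 * (2 * r)) * state_norm2 ?d t (inj_part ?d t (kernel_act ?d t C ?\<Phi>)) \<le> 4 * ?\<delta> + 2 * (2 * r)"
          by (rule mult_left_le)
        then show "(\<Sum>k<?N. defect t (2 * r) (\<lambda>i. P $$ (i, k)) (kernel_act ?d t C ?\<Phi>)) \<le>
          (4 * ?\<delta> + 4 * r) + (2 * (1 + 1 / (2 * r))) * ?N2 C"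
          unfolding sum_defect[OF P] by simp
      qed
      also have "\<dots> = (4 * ?\<delta> + 4 * r) + (2 * (1 + 1 / (2 * r))) * cl_avg n ?N2"
        unfolding cl_avg_add cl_avg_cmult cl_avg_const ..
      also have "\<dots> \<le> (4 * ?\<delta> + 4 * r) + (2 * (1 + 1 / (2 * r))) * ?\<delta>"
        using cl_avg_collision_part[of n t ?\<Phi>] r by (intro add_left_mono mult_left_mono) (auto simp: N1)
      \<comment> \<open>The quadratic terms are 8 from four times the rate and 4 from the collision
        part; the linear ones are 4 from \<open>s\<close> and 2 from its inverse. Since r^2 is at
        most r / 2, this gives the constant 12.\<close>
      also have "\<dots> = 12 * r\<^sup>2 + 6 * r" unfolding \<delta> using r by (simp add: power2_eq_square field_simps)
      also have "\<dots> \<le> 12 * r" using rr by simp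
      finally show "cl_avg n (\<lambda>C. \<Sum>k<?N. defect t (2 * r) (\<lambda>i. P $$ (i, k)) (kernel_act ?d t C ?\<Phi>)) \<le> 12 * r" .
    qed
  next
    case False
    have nn: "0 \<le> pf_moment ?d t u \<Phi>" "0 \<le> haar_moment t u \<Phi>" for u \<Phi>
      unfolding pf_moment_def haar_moment_def by (auto intro!: pf_avg_nonneg Bochner_Integration.integral_nonneg)
    show ?thesis
    \<comment> \<open>The difference of two nonnegative moments is at most their sum, whose total
      over a basis is 2, and 2 is below 12 r here.\<close>
    proof (rule trace_norm_twirl_difference_le[OF \<psi>(1)])
      fix u C
      show "\<bar>pf_moment ?d t u (kernel_act ?d t C ?\<Phi>) - haar_moment t u (kernel_act ?d t C ?\<Phi>)\<bar> \<le>
        pf_moment ?d t u (kernel_act ?d t C ?\<Phi>) + haar_moment t u (kernel_act ?d t C ?\<Phi>)"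
        using nn[of u "kernel_act ?d t C ?\<Phi>"] by simp
    next
      fix P :: "complex mat" assume P: "P \<in> unitary_group ?N"
      have "cl_avg n (\<lambda>C. \<Sum>k<?N. pf_moment ?d t (\<lambda>r. P $$ (r, k)) (kernel_act ?d t C ?\<Phi>) +
          haar_moment t (\<lambda>r. P $$ (r, k)) (kernel_act ?d t C ?\<Phi>)) = cl_avg n (\<lambda>C. 2)"
        unfolding sum.distrib sum_haar_moment[OF P] sum_pf_moment[OF _ P, simplified]
        by (intro cl_avg_cong) (simp add: NC)
      then show "cl_avg n (\<lambda>C. \<Sum>k<?N. pf_moment ?d t (\<lambda>r. P $$ (r, k)) (kernel_act ?d t C ?\<Phi>) +
          haar_moment t (\<lambda>r. P $$ (r, k)) (kernel_act ?d t C ?\<Phi>)) \<le> 12 * r"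
        using False by (simp add: cl_avg_const)
    qed
  qed
  then show ?thesis by (simp add: r_def)
qed

end

theorem theorem3p1:
  shows "\<exists>c::real. c > 0 \<and>
    (\<forall>(n::nat) (t::nat) (\<mu> :: complex mat measure).
       n \<ge> 1 \<longrightarrow> t \<ge> 1 \<longrightarrow> haar_prob_measure (2 ^ n) \<mu> \<longrightarrow>
       diamond_dist ((2 ^ n) ^ t) (twirl (2 ^ n) t (measure_pmf (pfc_ensemble n))) (twirl (2 ^ n) t \<mu>)
         \<le> c * real t / sqrt (real (2 ^ n)))"
proof (intro exI[of _ 12] conjI allI impI)
  fix n t :: nat and \<mu> :: "complex mat measure"
  assume t: "t \<ge> 1" and h: "haar_prob_measure (2 ^ n) \<mu>"
  interpret haar_law \<mu> n by unfold_locales (rule h)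
  let ?D = "(2 ^ n) ^ t :: nat"
  \<comment> \<open>Bounding the supremum from above requires that some unit vector exists.\<close>
  have "unit_vec (?D * ?D) 0 \<bullet>c (unit_vec (?D * ?D) 0 :: complex vec) = 1"
    by (simp add: scalar_prod_def unit_vec_def if_distrib cong: if_cong)
  then have "{\<psi> \<in> carrier_vec (?D * ?D). \<psi> \<bullet>c \<psi> = (1 :: complex)} \<noteq> {}"
    using unit_vec_carrier[of "?D * ?D" 0] by blast
  then show "diamond_dist ?D (twirl (2 ^ n) t (measure_pmf (pfc_ensemble n))) (twirl (2 ^ n) t \<mu>)
      \<le> 12 * real t / sqrt (real (2 ^ n))"
    unfolding diamond_dist_def
    by (rule cSUP_least) (use trace_norm_twirl_difference[OF t] in \<open>auto simp: twirled_state_def\<close>)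
qed simp

end
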